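(* In the setting of the context, let $R_h$ be the stabilization operator in the parametric domain (defined in the context). Then there exists $C>0$, independent of $h$ and $K$, such that for every $K\in\mathcal G_h$ $$\|\mathsf h^{1/2}R_h(v_h)\|_{L^2(\Gamma_K)}\le C\,\|\nabla v_h\|_{L^2(\Omega\cap K')}\qquad\forall\,v_h\in\tilde V_h,$$ where $K'=K$ if $K\in\mathcal M_h^g$, and otherwise $K'\in\mathcal N(K)\cap\mathcal M_h^g$ is the good neighbor of $K$ used in the definition of $R_h$.
   Context: Splines. Let $d\in\{2,3\}$ and $p\ge1$. A $p$-open knot vector on $[0,1]$ is $\Xi=\{\xi_1,\dots,\xi_{n+p+1}\}$ with $0=\xi_1=\dots=\xi_{p+1}<\xi_{p+2}\le\dots\le\xi_n<\xi_{n+1}=\dots=\xi_{n+p+1}=1$, internal knots having multiplicity at most $p$; its distinct values are the breakpoints, and $S_p(\Xi)$ is the span of the associated B-splines $\hat B_{i,p}$. For $\mathbf\Xi=\Xi_1\times\dots\times\Xi_d$, $S_p(\mathbf\Xi)=\bigotimes_\ell S_p(\Xi_\ell)$ with tensor-product B-spline basis $\hat B_{\mathbf i,p}$. The breakpoints define a Cartesian mesh $\hat{\mathcal M}_{0,h}$ of open boxes $Q$ of $\hat\Omega_0=(0,1)^d$; $h_Q=\mathrm{diam}(Q)$, $h=\max_Q h_Q$. The family $\{\hat{\mathcal M}_{0,h}\}_h$ is shape-regular: the ratio between the smallest edge of $Q$ and $h_Q$ is bounded below by a positive constant uniformly in $Q$ and $h$. Geometry. $\Omega_0=\mathbf F(\hat\Omega_0)\subset\mathbb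 R^d$ with $\mathbf F\in(S_{p^0}(\mathbf\Xi^0))^d$; $\mathbf F$ is bi-Lipschitz, $\mathbf F|_{\overline Q}\in C^\infty(\overline Q)$ for all $Q\in\hat{\mathcal M}_{0,h}$, and $\mathbf F^{-1}|_{\overline K}\in C^\infty(\overline K)$ for all $K=\mathbf F(Q)$. The space $S_p(\mathbf\Xi)$ is a refinement of $S_{p^0}(\mathbf\Xi^0)$, $B_{\mathbf i,p}=\hat B_{\mathbf i,p}\circ\mathbf F^{-1}$ and $V_h=\mathrm{span}\{B_{\mathbf i,p}\}$. The trimmed domain is $\Omega=\Omega_0\setminus\overline\Omega_1$, with $\Omega_1$ a bounded domain and $\Omega$ Lipschitz; $\Gamma_{trim}=\partial\Omega\cap\partial\Omega_1$; $\hat\Omega=\mathbf F^{-1}(\Omega)$; $\tilde V_h=\mathrm{span}\{B_{\mathbf i,p}|_\Omega\}$. $\partial\Omega=\Gamma_D\cup\Gamma_N$ with disjoint interiors; $n$ is the outward unit normal. $\mathcal M_h=\{\mathbf F(Q):Q\in\hat{\mathcal M}_{0,h},\,Q\cap\hat\Omega\neq\emptyset\}$ and $\mathcal G_h=\{K\in\mathcal M_h:\overline K\cap\Gamma_{trim}\ne\emptyset\}$. $\mathsf h$ is the piecewise constant function with $\mathsf h|_K=h_K:=\mathrm{diam}(K)$, and $\Gamma_K:=\Gamma_D\cap\overline K$. Standing assumption: $|\Gamma_K|\le Ch_K^{d-1}$ for all $K\in\mathcal M_h$, with $C$ independent of $h$ and $K$. Good/bad elements. Fix $\theta\in(0,1]$.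 $Q$ (and $K=\mathbf F(Q)\in\mathcal M_h$) is good if $|\hat\Omega\cap Q|\ge\theta|Q|$, bad otherwise; $\mathcal M_h^g,\mathcal M_h^b$ are the sets of good and bad physical elements. Neighbors: $\mathcal N(K)=\{K'\in\mathcal M_h:\mathrm{dist}(K,K')\le C_{\mathcal N}h_K\}\setminus\{K\}$ with $C_{\mathcal N}$ a fixed constant independent of the mesh size. Standing assumption: $\mathcal N(K)\cap\mathcal M_h^g\neq\emptyset$ for every $K\in\mathcal M_h^b$. Stabilization in the parametric domain. For $v_h\in\tilde V_h$ let $\hat v_h=v_h\circ\mathbf F$. $R_h(v_h)$ is defined locally: on $\Gamma_K$, $K\in\mathcal G_h$, $R_h(v_h)=R_K(v_h)$, where: if $K\in\mathcal M_h^g$, $R_K(v_h)=\partial(v_h|_K)/\partial n$; if $K=\mathbf F(Q)\in\mathcal M_h^b$, with chosen good neighbor $K'=\mathbf F(Q')\in\mathcal N(K)\cap\mathcal M_h^g$, $R_K(v_h)=\frac{\partial}{\partial n}\big(\mathcal E(\hat v_h|_{Q'})\circ\mathbf F^{-1}\big)$, where $\mathcal E:\mathbb Q_p(Q')\to\mathbb Q_p(Q'\cup Q)$ is the natural extension of a polynomial and $\mathbb Q_p$ denotes polynomials of degree at most $p$ in each coordinate ($\hat v_h$ is such a polynomial on $Q'\cap\hat\Omega$, which determines it on $Q'$). *)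

theory Defs
  imports "HOL-Analysis.Analysis"
begin

section \<open>Splines\<close>

text \<open>A knot vector is a sorted list; the informal \<open>\<xi>\<^sub>1, \<dots>, \<xi>\<^bsub>n+p+1\<^esub>\<close> are
  \<^term>\<open>\<Xi> ! 0\<close>, \<open>\<dots>\<close>, \<^term>\<open>\<Xi> ! (n + p)\<close>, and the breakpoints are \<^term>\<open>set \<Xi>\<close>.\<close>

definition open_knot_vector :: "nat \<Rightarrow> real list \<Rightarrow> bool" where
  "open_knot_vector p \<Xi> \<longleftrightarrow>
     sorted \<Xi> \<and> set \<Xi> \<subseteq> {0..1} \<and>
     count_list \<Xi> 0 = p + 1 \<and> count_list \<Xi> 1 = p + 1 \<and>
     (\<forall>t\<in>{0<..<1}. count_list \<Xi> t \<le> p)"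

definition num_bsplines :: "nat \<Rightarrow> real list \<Rightarrow> nat" where
  "num_bsplines p \<Xi> = length \<Xi> - (p + 1)"

text \<open>Cox--de Boor recursion; the convention \<open>0/0 = 0\<close> is that of HOL. The last nonempty knot
  span is closed on the right, so that the B-splines are continuous on all of \<open>[0,1]\<close>.\<close>

fun bspline :: "nat \<Rightarrow> real list \<Rightarrow> nat \<Rightarrow> real \<Rightarrow> real" where
  "bspline 0 \<Xi> i t =
     (if \<Xi> ! i \<le> t \<and> t < \<Xi> ! (i + 1) \<or> t = 1 \<and> \<Xi> ! i < 1 \<and> \<Xi> ! (i + 1) = 1 then 1 else 0)"
| "bspline (Suc p) \<Xi> i t =
     (t - \<Xi> ! i) / (\<Xi> ! (i + p + 1) - \<Xi> ! i) * bspline p \<Xi> i t +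
     (\<Xi> ! (i + p + 2) - t) / (\<Xi> ! (i + p + 2) - \<Xi> ! (i + 1)) * bspline p \<Xi> (i + 1) t"

definition tensor_bspline ::
    "nat \<Rightarrow> ('d::finite \<Rightarrow> real list) \<Rightarrow> ('d \<Rightarrow> nat) \<Rightarrow> real^'d \<Rightarrow> real" where
  "tensor_bspline p \<Xi> i \<zeta> = (\<Prod>l\<in>UNIV. bspline p (\<Xi> l) (i l) (\<zeta> $ l))"

text \<open>The span of the tensor-product B-splines. These vanish outside the closed unit cube, so
  equality and inclusion of such spaces may be tested on total functions.\<close>

definition spline_space :: "nat \<Rightarrow> ('d::finite \<Rightarrow> real list) \<Rightarrow> (real^'d \<Rightarrow> real) set" where
  "spline_space p \<Xi> =
     {s. \<exists>c. s = (\<lambda>\<zeta>. \<Sum>i | \<forall>l. i l < num_bsplines p (\<Xi> l). c i * tensor_bspline p \<Xi> i \<zeta>)}"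

definition tensor_polys :: "nat \<Rightarrow> (real^'d::finite \<Rightarrow> real) set" where
  "tensor_polys p =
     {q. \<exists>c. q = (\<lambda>\<zeta>. \<Sum>a | \<forall>l. a l \<le> p. c a * (\<Prod>l\<in>UNIV. (\<zeta> $ l) ^ a l))}"


section \<open>Cartesian meshes\<close>

definition param_mesh :: "('d::finite \<Rightarrow> real list) \<Rightarrow> (real^'d) set set" where
  "param_mesh \<Xi> = {box a b |a b. \<forall>l. a $ l \<in> set (\<Xi> l) \<and> b $ l \<in> set (\<Xi> l) \<and>
     a $ l < b $ l \<and> set (\<Xi> l) \<inter> {a $ l <..< b $ l} = {}}"

definition mesh_size :: "('d::finite \<Rightarrow> real list) \<Rightarrow> real" where
  "mesh_size \<Xi> = Max (diameter ` param_mesh \<Xi>)"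

definition shape_regular :: "('h \<Rightarrow> 'd::finite \<Rightarrow> real list) \<Rightarrow> 'h set \<Rightarrow> bool" where
  "shape_regular \<Xi> H \<longleftrightarrow> (\<exists>\<kappa>>0. \<forall>h\<in>H. \<forall>a b. box a b \<in> param_mesh (\<Xi> h) \<longrightarrow>
     (\<forall>l. b $ l - a $ l \<ge> \<kappa> * diameter (box a b)))"


section \<open>Regularity of maps and domains\<close>

definition bi_lipschitz_on :: "'a::metric_space set \<Rightarrow> ('a \<Rightarrow> 'b::metric_space) \<Rightarrow> bool" where
  "bi_lipschitz_on S F \<longleftrightarrow> inj_on F S \<and>
     (\<exists>L. L-lipschitz_on S F) \<and> (\<exists>L. L-lipschitz_on (F ` S) (inv_into S F))"

fun Ck_on :: "nat \<Rightarrow> (real^'n::finite) set \<Rightarrow> (real^'n \<Rightarrow> 'b::real_normed_vector) \<Rightarrow> bool" where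
  "Ck_on 0 U f \<longleftrightarrow> continuous_on U f"
| "Ck_on (Suc k) U f \<longleftrightarrow> continuous_on U f \<and>
     (\<forall>l. \<exists>g. Ck_on k U g \<and>
        (\<forall>x\<in>U. ((\<lambda>t. f (x + t *\<^sub>R axis l 1)) has_vector_derivative g x) (at 0)))"

text \<open>\<open>C\<^sup>\<infinity>\<close> on a closed set: restriction of a smooth map on an open neighbourhood.\<close>

definition smooth_on_closed ::
    "(real^'n::finite) set \<Rightarrow> (real^'n \<Rightarrow> 'b::real_normed_vector) \<Rightarrow> bool" where
  "smooth_on_closed S f \<longleftrightarrow>
     (\<exists>U g. open U \<and> S \<subseteq> U \<and> (\<forall>k. Ck_on k U g) \<and> (\<forall>x\<in>S. g x = f x))"

text \<open>In the open set \<open>U\<close>, the set \<open>\<Omega>\<close> is the strict subgraph, in the direction of the unit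
  vector \<open>e\<close>, of a Lipschitz function \<open>\<phi>\<close> on the hyperplane orthogonal to \<open>e\<close>.\<close>

definition lipschitz_chart ::
    "'a::euclidean_space set \<Rightarrow> 'a set \<Rightarrow> 'a \<Rightarrow> ('a \<Rightarrow> real) \<Rightarrow> bool" where
  "lipschitz_chart \<Omega> U e \<phi> \<longleftrightarrow> open U \<and> norm e = 1 \<and>
     (\<exists>L. L-lipschitz_on {z. z \<bullet> e = 0} \<phi>) \<and>
     \<Omega> \<inter> U = {y\<in>U. y \<bullet> e < \<phi> (y - (y \<bullet> e) *\<^sub>R e)}"

definition lipschitz_domain :: "'a::euclidean_space set \<Rightarrow> bool" where
  "lipschitz_domain \<Omega> \<longleftrightarrow> open \<Omega> \<and>
     (\<forall>x\<in>frontier \<Omega>. \<exists>U e \<phi>. x \<in> U \<and> lipschitz_chart \<Omega> U e \<phi>)"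

text \<open>At a boundary point where the graph function is differentiable, the outward normal is the
  normalised gradient of the local defining function \<open>y \<mapsto> y \<bullet> e - \<phi> (y - (y \<bullet> e) e)\<close>. It does
  not depend on the chart. By Rademacher's theorem the remaining boundary points form a null set
  of the surface measure; there the normal is set to \<open>0\<close>.\<close>

definition is_outward_normal :: "'a::euclidean_space set \<Rightarrow> 'a \<Rightarrow> 'a \<Rightarrow> bool" where
  "is_outward_normal \<Omega> x \<nu> \<longleftrightarrow> x \<in> frontier \<Omega> \<and>
     (\<exists>U e \<phi> g. x \<in> U \<and> lipschitz_chart \<Omega> U e \<phi> \<and>
        GDERIV (\<lambda>y. \<phi> (y - (y \<bullet> e) *\<^sub>R e)) x :> g \<and> \<nu> = (e - g) /\<^sub>R norm (e - g))"

definition outward_normal :: "'a::euclidean_space set \<Rightarrow> 'a \<Rightarrow> 'a" where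
  "outward_normal \<Omega> x =
     (if \<exists>\<nu>. is_outward_normal \<Omega> x \<nu> then SOME \<nu>. is_outward_normal \<Omega> x \<nu> else 0)"


section \<open>Surface measure and norms\<close>

text \<open>The \<open>s\<close>-dimensional Hausdorff measure, normalised so that for \<open>s\<close> equal to the dimension of
  the space it is Lebesgue measure. The covering sets must be bounded because the library assigns
  no meaningful diameter to unbounded sets.\<close>

definition hausdorff_gauge :: "nat \<Rightarrow> 'a::metric_space set \<Rightarrow> ennreal" where
  "hausdorff_gauge s A =
     (if A = {} then 0 else ennreal (unit_ball_vol (real s) * (diameter A / 2) ^ s))"

definition hausdorff_content :: "nat \<Rightarrow> real \<Rightarrow> 'a::metric_space set \<Rightarrow> ennreal" where
  "hausdorff_content s \<delta> A =
     (INF U \<in> {U :: nat \<Rightarrow> 'a set. A \<subseteq> (\<Union>n. U n) \<and> (\<forall>n. bounded (U n) \<and> diameter (U n) \<le> \<delta>)}.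
        \<Sum>n. hausdorff_gauge s (U n))"

definition hausdorff_outer :: "nat \<Rightarrow> 'a::metric_space set \<Rightarrow> ennreal" where
  "hausdorff_outer s A = (SUP \<delta>\<in>{0<..}. hausdorff_content s \<delta> A)"

definition hausdorff_measure :: "nat \<Rightarrow> 'a::metric_space measure" where
  "hausdorff_measure s = measure_of UNIV (sets borel) (hausdorff_outer s)"

text \<open>The outer measure is countably additive on Borel sets by Caratheodory's criterion, so
  \<^const>\<open>measure_of\<close> does not fall back to the zero measure.\<close>

lemma hausdorff_gauge_empty [simp]: "hausdorff_gauge s {} = 0"
  by (simp add: hausdorff_gauge_def)

lemma hausdorff_content_le:
  assumes "A \<subseteq> (\<Union>n. U n)" "\<And>n. bounded (U n)" "\<And>n. diameter (U n) \<le> \<delta>"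
  shows "hausdorff_content s \<delta> A \<le> (\<Sum>n. hausdorff_gauge s (U n))"
  unfolding hausdorff_content_def by (rule INF_lower) (use assms in auto)

lemma hausdorff_content_empty: "\<delta> > 0 \<Longrightarrow> hausdorff_content s \<delta> {} = 0"
  using hausdorff_content_le[of "{}" "\<lambda>_. {}" \<delta> s] by simp

lemma hausdorff_content_mono: "A \<subseteq> B \<Longrightarrow> hausdorff_content s \<delta> A \<le> hausdorff_content s \<delta> B"
  unfolding hausdorff_content_def by (rule INF_superset_mono) auto

lemma hausdorff_content_antimono:
  "\<delta> \<le> \<epsilon> \<Longrightarrow> hausdorff_content s \<epsilon> A \<le> hausdorff_content s \<delta> A"
  unfolding hausdorff_content_def by (rule INF_superset_mono) (auto intro: order_trans)

lemma hausdorff_content_UN: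
  "hausdorff_content s \<delta> (\<Union>i::nat. A i) \<le> (\<Sum>i. hausdorff_content s \<delta> (A i))"
proof (rule ennreal_le_epsilon)
  fix e :: real
  assume "0 < e" "(\<Sum>n. hausdorff_content s \<delta> (A n)) < top"
  then have "hausdorff_content s \<delta> (A n) < hausdorff_content s \<delta> (A n) + e * (1/2)^Suc n" for n
    by (auto simp add: less_top dest!: ennreal_suminf_lessD)
  then have "\<exists>U :: nat \<Rightarrow> _. A n \<subseteq> (\<Union>i. U i) \<and> (\<forall>i. bounded (U i) \<and> diameter (U i) \<le> \<delta>) \<and>
      (\<Sum>i. hausdorff_gauge s (U i)) < hausdorff_content s \<delta> (A n) + e * (1/2)^Suc n" for n
    unfolding hausdorff_content_def INF_less_iff by auto
  then obtain B :: "nat \<Rightarrow> nat \<Rightarrow> _" where B: "\<And>n. A n \<subseteq> (\<Union>i. B n i)"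
      "\<And>n i. bounded (B n i)" "\<And>n i. diameter (B n i) \<le> \<delta>"
      and less: "\<And>n. (\<Sum>i. hausdorff_gauge s (B n i)) < hausdorff_content s \<delta> (A n) + e * (1/2)^Suc n"
    by metis
  define C where "C = case_prod B o prod_decode"
  have "(\<Union>i. A i) \<subseteq> (\<Union>i. C i)"
    using B(1) by (auto simp add: C_def subset_eq) (metis prod.case prod_encode_inverse)
  then have "hausdorff_content s \<delta> (\<Union>i. A i) \<le> (\<Sum>i. hausdorff_gauge s (C i))"
    by (rule hausdorff_content_le) (use B in \<open>auto simp: C_def split: prod.splits\<close>)
  also have "\<dots> = (\<Sum>n. \<Sum>i. hausdorff_gauge s (B n i))"
    unfolding C_def comp_def by (intro suminf_ennreal_2dimen) auto
  also have "\<dots> \<le> (\<Sum>n. hausdorff_content s \<delta> (A n) + e * (1/2) ^ Suc n)"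
    by (intro suminf_le allI less_imp_le[OF less]) auto
  also have "\<dots> = (\<Sum>n. hausdorff_content s \<delta> (A n)) + (\<Sum>n. ennreal e * ennreal ((1/2) ^ Suc n))"
    using \<open>0 < e\<close> by (subst suminf_add[symmetric])
      (auto simp del: ennreal_suminf_cmult simp add: ennreal_mult[symmetric])
  also have "\<dots> = (\<Sum>n. hausdorff_content s \<delta> (A n)) + e"
    unfolding ennreal_suminf_cmult
    by (subst suminf_ennreal_eq[OF zero_le_power power_half_series]) auto
  finally show "hausdorff_content s \<delta> (\<Union>i. A i) \<le> (\<Sum>n. hausdorff_content s \<delta> (A n)) + e" .
qed

lemma hausdorff_content_le_outer: "\<delta> > 0 \<Longrightarrow> hausdorff_content s \<delta> A \<le> hausdorff_outer s A"
  unfolding hausdorff_outer_def by (rule SUP_upper) auto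

lemma hausdorff_outer_empty [simp]: "hausdorff_outer s {} = 0"
  by (simp add: hausdorff_outer_def hausdorff_content_empty)

lemma hausdorff_outer_mono: "A \<subseteq> B \<Longrightarrow> hausdorff_outer s A \<le> hausdorff_outer s B"
  unfolding hausdorff_outer_def by (intro SUP_mono) (auto intro: hausdorff_content_mono)

lemma hausdorff_outer_UN: "hausdorff_outer s (\<Union>i::nat. A i) \<le> (\<Sum>i. hausdorff_outer s (A i))"
proof -
  have "hausdorff_content s \<delta> (\<Union>i. A i) \<le> (\<Sum>i. hausdorff_outer s (A i))" if "\<delta> > 0" for \<delta>
    using hausdorff_content_UN[of s \<delta> A]
    by (rule order_trans) (intro suminf_le hausdorff_content_le_outer that, auto)
  then show ?thesis by (subst hausdorff_outer_def) (rule SUP_least, auto)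
qed

lemma outer_measure_space_hausdorff: "outer_measure_space UNIV (hausdorff_outer s)"
  unfolding outer_measure_space_def positive_def increasing_def countably_subadditive_def
  by (simp add: hausdorff_outer_mono hausdorff_outer_UN)

lemma hausdorff_outer_Un: "hausdorff_outer s (A \<union> B) \<le> hausdorff_outer s A + hausdorff_outer s B"
proof -
  let ?f = "\<lambda>i::nat. if i = 0 then A else if i = 1 then B else {}"
  have "(\<Union>i. ?f i) = A \<union> B"
    by (auto split: if_splits)
  moreover have "(\<Sum>i. hausdorff_outer s (?f i)) = hausdorff_outer s A + hausdorff_outer s B"
    by (subst suminf_finite[of "{0,1}"]) auto
  ultimately show ?thesis using hausdorff_outer_UN[of s ?f] by simp
qed

lemma hausdorff_outer_separated:
  assumes r: "r > 0" and sep: "\<And>a b. a \<in> A \<Longrightarrow> b \<in> B \<Longrightarrow> dist a b \<ge> r"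
  shows "hausdorff_outer s A + hausdorff_outer s B \<le> hausdorff_outer s (A \<union> B)"
proof -
  have *: "hausdorff_content s \<delta> A + hausdorff_content s \<delta> B \<le> hausdorff_content s \<delta> (A \<union> B)"
    if \<delta>: "0 < \<delta>" "\<delta> < r" for \<delta>
    unfolding hausdorff_content_def[of s \<delta> "A \<union> B"]
  proof (rule INF_greatest, clarify)
    fix U :: "nat \<Rightarrow> _"
    assume U: "A \<union> B \<subseteq> (\<Union>n. U n)" "\<forall>n. bounded (U n) \<and> diameter (U n) \<le> \<delta>"
    define V where "V n = (if U n \<inter> A = {} then {} else U n)" for n
    define W where "W n = (if U n \<inter> B = {} then {} else U n)" for n
    have disj: "U n \<inter> A = {} \<or> U n \<inter> B = {}" for n
    proof (rule ccontr)
      assume "\<not> ?thesis"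
      then obtain a b where "a \<in> U n" "a \<in> A" "b \<in> U n" "b \<in> B" by auto
      then have "r \<le> dist a b" "dist a b \<le> diameter (U n)"
        using sep U(2) diameter_bounded_bound by blast+
      with U(2) \<delta> show False by (meson dual_order.strict_trans2 linorder_not_le)
    qed
    have "hausdorff_content s \<delta> A \<le> (\<Sum>n. hausdorff_gauge s (V n))"
      using U \<delta> by (intro hausdorff_content_le) (auto simp: V_def, blast)
    moreover have "hausdorff_content s \<delta> B \<le> (\<Sum>n. hausdorff_gauge s (W n))"
      using U \<delta> by (intro hausdorff_content_le) (auto simp: W_def, blast)
    ultimately have "hausdorff_content s \<delta> A + hausdorff_content s \<delta> B \<le>
        (\<Sum>n. hausdorff_gauge s (V n)) + (\<Sum>n. hausdorff_gauge s (W n))"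
      by (rule add_mono)
    also have "\<dots> = (\<Sum>n. hausdorff_gauge s (V n) + hausdorff_gauge s (W n))"
      by (rule suminf_add) auto
    also have "\<dots> \<le> (\<Sum>n. hausdorff_gauge s (U n))"
      using disj by (intro suminf_le allI) (auto simp: V_def W_def)
    finally show "hausdorff_content s \<delta> A + hausdorff_content s \<delta> B \<le> (\<Sum>n. hausdorff_gauge s (U n))" .
  qed
  have "hausdorff_outer s A + hausdorff_outer s B =
      (SUP \<delta>\<in>{0<..}. hausdorff_content s \<delta> A + hausdorff_content s \<delta> B)"
    unfolding hausdorff_outer_def
  proof (rule SUP_add_directed_ennreal[symmetric])
    fix i j :: real assume "i \<in> {0<..}" "j \<in> {0<..}"
    then show "\<exists>k\<in>{0<..}. hausdorff_content s i A + hausdorff_content s j B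
        \<le> hausdorff_content s k A + hausdorff_content s k B"
      by (intro bexI[of _ "min i j"] add_mono hausdorff_content_antimono) auto
  qed
  also have "\<dots> \<le> hausdorff_outer s (A \<union> B)"
  proof (rule SUP_least)
    fix \<delta> :: real assume \<delta>: "\<delta> \<in> {0<..}"
    let ?m = "min \<delta> (r/2)"
    have "hausdorff_content s \<delta> A + hausdorff_content s \<delta> B
        \<le> hausdorff_content s ?m A + hausdorff_content s ?m B"
      by (intro add_mono hausdorff_content_antimono) auto
    also have "\<dots> \<le> hausdorff_content s ?m (A \<union> B)" using \<delta> r by (intro *) auto
    also have "\<dots> \<le> hausdorff_outer s (A \<union> B)" using \<delta> r by (intro hausdorff_content_le_outer) auto
    finally show "hausdorff_content s \<delta> A + hausdorff_content s \<delta> B \<le> hausdorff_outer s (A \<union> B)" .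
  qed
  finally show ?thesis .
qed

lemma hausdorff_outer_shells:
  fixes B :: "nat \<Rightarrow> 'a::metric_space set"
  assumes sep: "\<And>j k. j < k \<Longrightarrow> \<exists>r>0. \<forall>i\<le>j. \<forall>x\<in>B i. \<forall>y\<in>B k. dist x y \<ge> r"
    and sub: "\<And>k. B k \<subseteq> A"
  shows "(\<Sum>k. hausdorff_outer s (B k)) \<le> hausdorff_outer s A"
proof -
  have "(\<Sum>k<n. hausdorff_outer s (B k)) \<le> hausdorff_outer s (\<Union>k<n. B k)" for n
  proof (induction n)
    case (Suc n)
    have "\<exists>r>0. \<forall>x\<in>(\<Union>k<n. B k). \<forall>y\<in>B n. dist x y \<ge> r"
    proof (cases n)
      case (Suc m)
      then show ?thesis using sep[of m n] by (auto simp: less_Suc_eq_le)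
    qed (auto intro: exI[of _ 1])
    then obtain r where "r > 0" "\<forall>x\<in>(\<Union>k<n. B k). \<forall>y\<in>B n. dist x y \<ge> r" by blast
    then have "hausdorff_outer s (\<Union>k<n. B k) + hausdorff_outer s (B n)
        \<le> hausdorff_outer s ((\<Union>k<n. B k) \<union> B n)"
      by (intro hausdorff_outer_separated[of r]) auto
    with Suc show ?case
      by (auto simp: lessThan_Suc Un_commute add.commute intro: order_trans add_mono)
  qed simp
  also have "hausdorff_outer s (\<Union>k<n. B k) \<le> hausdorff_outer s A" for n
    by (rule hausdorff_outer_mono) (use sub in auto)
  finally show ?thesis by (subst suminf_eq_SUP) (rule SUP_least)
qed

lemma ennreal_suminf_tail_tendsto_0:
  fixes f :: "nat \<Rightarrow> ennreal"
  assumes "(\<Sum>k. f k) < top"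
  shows "(\<lambda>n. \<Sum>k. f (k + n)) \<longlonglongrightarrow> 0"
proof -
  have fin: "f k < top" for k using assms by (rule ennreal_suminf_lessD)
  define g where "g k = enn2real (f k)" for k
  have f: "f = (\<lambda>k. ennreal (g k))" and g: "g k \<ge> 0" for k
    using fin by (auto simp: g_def)
  have sm: "summable g"
    using assms g unfolding f by (intro summable_suminf_not_top) auto
  have "(\<Sum>k. f (k + n)) = ennreal (\<Sum>k. g (k + n))" for n
    unfolding f using g sm by (intro suminf_ennreal2) auto
  moreover have "(\<lambda>n. \<Sum>k. g (k + n)) \<longlonglongrightarrow> 0"
    using suminf_exist_split2[OF sm] by simp
  ultimately show ?thesis by (simp add: tendsto_ennreal_iff flip: ennreal_0)
qed

lemma hausdorff_outer_caratheodory: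
  fixes S :: "'a::metric_space set"
  assumes "closed S"
  shows "hausdorff_outer s (A \<inter> S) + hausdorff_outer s (A - S) = hausdorff_outer s A"
proof (rule antisym)
  show "hausdorff_outer s A \<le> hausdorff_outer s (A \<inter> S) + hausdorff_outer s (A - S)"
    using hausdorff_outer_Un[of s "A \<inter> S" "A - S"] by (simp add: Int_Diff_Un)
  consider "S = {}" | "hausdorff_outer s A = top" | "S \<noteq> {}" "hausdorff_outer s A < top"
    using less_top by blast
  then show "hausdorff_outer s (A \<inter> S) + hausdorff_outer s (A - S) \<le> hausdorff_outer s A"
  proof cases
    case 3
    define B where "B k = {x\<in>A. 1 / real (k + 2) \<le> infdist x S \<and> infdist x S < 1 / real (k + 1)}" for k
    define E where "E n = {x\<in>A. 1 / real (n + 1) \<le> infdist x S}" for n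
    have sep: "\<exists>r>0. \<forall>i\<le>j. \<forall>x\<in>B (2*i+c). \<forall>y\<in>B (2*k+c). dist x y \<ge> r" if "j < k" for j k c
    proof (intro exI conjI allI impI ballI)
      let ?r = "1 / real (2*j+c+2) - 1 / real (2*j+c+3)"
      show "?r > 0" by (simp add: frac_less2)
      fix i x y assume "i \<le> j" "x \<in> B (2*i+c)" "y \<in> B (2*k+c)"
      then have "1 / real (2*i+c+2) \<le> infdist x S" "infdist y S < 1 / real (2*k+c+1)"
        by (auto simp: B_def)
      moreover have "1 / real (2*j+c+2) \<le> 1 / real (2*i+c+2)"
        using \<open>i \<le> j\<close> by (intro divide_left_mono) auto
      moreover have "1 / real (2*k+c+1) \<le> 1 / real (2*j+c+3)"
        using that by (intro divide_left_mono) auto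
      ultimately show "dist x y \<ge> ?r" using infdist_triangle[of x S y] by linarith
    qed
    have sum: "(\<Sum>k. hausdorff_outer s (B (2*k+c))) \<le> hausdorff_outer s A" for c
      using sep by (intro hausdorff_outer_shells) (auto simp: B_def)
    have "(\<Sum>k<n. hausdorff_outer s (B k)) \<le> hausdorff_outer s A + hausdorff_outer s A" for n
    proof -
      have "(\<Sum>k<n. hausdorff_outer s (B k)) \<le> (\<Sum>k<2*n. hausdorff_outer s (B k))"
        by (intro sum_mono2) auto
      also have "\<dots> = (\<Sum>k<n. hausdorff_outer s (B (2*k+0))) + (\<Sum>k<n. hausdorff_outer s (B (2*k+1)))"
        by (induction n) (auto simp: algebra_simps)
      also have "\<dots> \<le> (\<Sum>k. hausdorff_outer s (B (2*k+0))) + (\<Sum>k. hausdorff_outer s (B (2*k+1)))"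
        by (intro add_mono sum_le_suminf) auto
      also have "\<dots> \<le> hausdorff_outer s A + hausdorff_outer s A"
        by (intro add_mono sum)
      finally show ?thesis .
    qed
    then have "(\<Sum>k. hausdorff_outer s (B k)) \<le> hausdorff_outer s A + hausdorff_outer s A"
      by (subst suminf_eq_SUP) (rule SUP_least)
    also have "\<dots> < top" using 3(2) by simp
    finally have tail: "(\<lambda>n. \<Sum>k. hausdorff_outer s (B (k + n))) \<longlonglongrightarrow> 0"
      by (rule ennreal_suminf_tail_tendsto_0)
    have bound: "hausdorff_outer s (A \<inter> S) + hausdorff_outer s (A - S)
        \<le> hausdorff_outer s A + (\<Sum>k. hausdorff_outer s (B (k + n)))" for n
    proof -
      have "A - S \<subseteq> E n \<union> (\<Union>k. B (k + n))"
      proof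
        fix x assume x: "x \<in> A - S"
        then have pos: "infdist x S > 0" using assms 3(1) infdist_pos_not_in_closed by blast
        show "x \<in> E n \<union> (\<Union>k. B (k + n))"
        proof (cases "1 / real (n + 1) \<le> infdist x S")
          case False
          then have big: "real (n + 1) < 1 / infdist x S" using pos by (simp add: field_simps)
          define m where "m = nat (\<lceil>1 / infdist x S\<rceil> - 1)"
          have "\<lceil>1 / infdist x S\<rceil> > int (n + 1)" using big by linarith
          then have m: "n + 1 \<le> m" "real m < 1 / infdist x S" "1 / infdist x S \<le> real (m + 1)"
            unfolding m_def by (linarith)+
          have "x \<in> B ((m - 1 - n) + n)"
            using m pos x by (auto simp: B_def field_simps of_nat_diff)
          then show ?thesis by blast
        qed (use x in \<open>auto simp: E_def\<close>)
      qed
      then have "hausdorff_outer s (A - S) \<le> hausdorff_outer s (E n) + hausdorff_outer s (\<Union>k. B (k + n))"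
        using hausdorff_outer_mono hausdorff_outer_Un order_trans by metis
      also have "\<dots> \<le> hausdorff_outer s (E n) + (\<Sum>k. hausdorff_outer s (B (k + n)))"
        by (intro add_left_mono hausdorff_outer_UN)
      finally have "hausdorff_outer s (A \<inter> S) + hausdorff_outer s (A - S) \<le>
          (hausdorff_outer s (A \<inter> S) + hausdorff_outer s (E n)) + (\<Sum>k. hausdorff_outer s (B (k + n)))"
        by (simp add: add.assoc add_left_mono)
      also have "hausdorff_outer s (A \<inter> S) + hausdorff_outer s (E n) \<le> hausdorff_outer s ((A \<inter> S) \<union> E n)"
      proof (rule hausdorff_outer_separated)
        fix a b assume "a \<in> A \<inter> S" "b \<in> E n"
        then have "1 / real (n + 1) \<le> dist b a"
          unfolding E_def using infdist_le[of a S b] by auto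
        then show "1 / real (n + 1) \<le> dist a b" by (simp add: dist_commute)
      qed simp
      also have "\<dots> \<le> hausdorff_outer s A"
        by (rule hausdorff_outer_mono) (auto simp: E_def)
      finally show ?thesis by (simp add: add_right_mono)
    qed
    have "(\<lambda>n. hausdorff_outer s A + (\<Sum>k. hausdorff_outer s (B (k + n)))) \<longlonglongrightarrow> hausdorff_outer s A + 0"
      by (intro tendsto_add tendsto_const tail)
    then show ?thesis
      using bound by (intro LIMSEQ_le_const[where X="\<lambda>n. hausdorff_outer s A + (\<Sum>k. hausdorff_outer s (B (k + n)))"]) auto
  qed auto
qed

lemma
  fixes A :: "'a::metric_space set"
  shows sets_hausdorff_measure [measurable_cong, simp]:
      "sets (hausdorff_measure s :: 'a measure) = sets borel"
    and emeasure_hausdorff_measure: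
      "A \<in> sets borel \<Longrightarrow> emeasure (hausdorff_measure s) A = hausdorff_outer s A"
proof -
  let ?\<mu> = "hausdorff_outer s :: 'a set \<Rightarrow> ennreal"
  let ?L = "lambda_system UNIV UNIV ?\<mu>"
  interpret P: sigma_algebra UNIV "UNIV :: 'a set set"
    using sigma_algebra_Pow[of "UNIV :: 'a set"] by simp
  have L: "measure_space UNIV ?L ?\<mu>"
    by (rule P.caratheodory_lemma[OF outer_measure_space_hausdorff])
  have "Collect closed \<subseteq> ?L"
    using hausdorff_outer_caratheodory by (auto simp: P.lambda_system_eq)
  then have "sigma_sets UNIV (Collect closed) \<subseteq> ?L"
    using L by (intro sigma_algebra.sigma_sets_subset) (auto simp: measure_space_def)
  then have sub: "sets borel \<subseteq> ?L"
    by (simp add: borel_eq_closed)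
  show "sets (hausdorff_measure s) = sets (borel :: 'a measure)"
    unfolding hausdorff_measure_def using sets.sigma_sets_eq[of "borel :: 'a measure"] by simp
  assume A: "A \<in> sets borel"
  show "emeasure (hausdorff_measure s) A = ?\<mu> A"
    unfolding hausdorff_measure_def
  proof (rule emeasure_measure_of_sigma)
    show "sigma_algebra UNIV (sets (borel :: 'a measure))"
      using sets.sigma_algebra_axioms[of "borel :: 'a measure"] by simp
    show "positive (sets borel) ?\<mu>" by (simp add: positive_def)
    show "countably_additive (sets borel) ?\<mu>"
      using L sub unfolding measure_space_def countably_additive_def by blast
  qed fact
qed

abbreviation surface_measure :: "(real^'d::finite) measure" where
  "surface_measure \<equiv> hausdorff_measure (CARD('d) - 1)"

definition L2_norm :: "'a measure \<Rightarrow> 'a set \<Rightarrow> ('a \<Rightarrow> 'b::real_normed_vector) \<Rightarrow> ennreal" where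
  "L2_norm M A f =
     (let I = (\<integral>\<^sup>+x\<in>A. ennreal ((norm (f x))\<^sup>2) \<partial>M)
      in if I = \<infinity> then \<infinity> else ennreal (sqrt (enn2real I)))"

definition grad :: "(real^'d::finite \<Rightarrow> real) \<Rightarrow> real^'d \<Rightarrow> real^'d" where
  "grad f x = (\<chi> l. frechet_derivative f (at x) (axis l 1))"


section \<open>The trimmed geometry\<close>

text \<open>Throughout, \<open>F\<close> is the geometry map, relevant on the closed unit cube \<open>cbox 0 1\<close> only.\<close>

definition param_inv :: "(real^'d::finite \<Rightarrow> real^'d) \<Rightarrow> real^'d \<Rightarrow> real^'d" where
  "param_inv F = inv_into (cbox 0 1) F"

definition param_preimage ::
    "(real^'d::finite \<Rightarrow> real^'d) \<Rightarrow> (real^'d) set \<Rightarrow> (real^'d) set" where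
  "param_preimage F A = {\<zeta>\<in>box 0 1. F \<zeta> \<in> A}"

text \<open>The space \<open>span {B\<^sub>i|\<^sub>\<Omega>}\<close>. Its members are functions on \<open>\<Omega>\<close>; the values of the total
  HOL function outside \<open>\<Omega>\<close> are irrelevant.\<close>

definition trimmed_space ::
    "nat \<Rightarrow> ('d::finite \<Rightarrow> real list) \<Rightarrow> (real^'d \<Rightarrow> real^'d) \<Rightarrow> (real^'d) set
      \<Rightarrow> (real^'d \<Rightarrow> real) set" where
  "trimmed_space p \<Xi> F \<Omega> = {v. \<exists>s\<in>spline_space p \<Xi>. \<forall>x\<in>\<Omega>. v x = s (param_inv F x)}"

definition physical_mesh ::
    "('d::finite \<Rightarrow> real list) \<Rightarrow> (real^'d \<Rightarrow> real^'d) \<Rightarrow> (real^'d) set \<Rightarrow> (real^'d) set set" where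
  "physical_mesh \<Xi> F \<Omega> = {F ` Q |Q. Q \<in> param_mesh \<Xi> \<and> Q \<inter> param_preimage F \<Omega> \<noteq> {}}"

definition cut_elements ::
    "('d::finite \<Rightarrow> real list) \<Rightarrow> (real^'d \<Rightarrow> real^'d) \<Rightarrow> (real^'d) set \<Rightarrow> (real^'d) set
      \<Rightarrow> (real^'d) set set" where
  "cut_elements \<Xi> F \<Omega> \<Gamma>trim = {K \<in> physical_mesh \<Xi> F \<Omega>. closure K \<inter> \<Gamma>trim \<noteq> {}}"

definition good_elements ::
    "real \<Rightarrow> ('d::finite \<Rightarrow> real list) \<Rightarrow> (real^'d \<Rightarrow> real^'d) \<Rightarrow> (real^'d) set
      \<Rightarrow> (real^'d) set set" where
  "good_elements \<theta> \<Xi> F \<Omega> = {F ` Q |Q. Q \<in> param_mesh \<Xi> \<and> Q \<inter> param_preimage F \<Omega> \<noteq> {} \<and>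
     measure lborel (param_preimage F \<Omega> \<inter> Q) \<ge> \<theta> * measure lborel Q}"

definition bad_elements ::
    "real \<Rightarrow> ('d::finite \<Rightarrow> real list) \<Rightarrow> (real^'d \<Rightarrow> real^'d) \<Rightarrow> (real^'d) set
      \<Rightarrow> (real^'d) set set" where
  "bad_elements \<theta> \<Xi> F \<Omega> = physical_mesh \<Xi> F \<Omega> - good_elements \<theta> \<Xi> F \<Omega>"

definition neighbors ::
    "real \<Rightarrow> ('d::finite \<Rightarrow> real list) \<Rightarrow> (real^'d \<Rightarrow> real^'d) \<Rightarrow> (real^'d) set
      \<Rightarrow> (real^'d) set \<Rightarrow> (real^'d) set set" where
  "neighbors CN \<Xi> F \<Omega> K = {K' \<in> physical_mesh \<Xi> F \<Omega>. setdist K K' \<le> CN * diameter K} - {K}"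


section \<open>The stabilization operator\<close>

text \<open>The polynomial of degree at most \<open>p\<close> in each coordinate that coincides with \<open>v \<circ> F\<close> on the part of
  \<open>Q = F\<^sup>-\<^sup>1(K)\<close> inside the trimmed parametric domain, viewed as a polynomial function on the whole
  space: this is \<open>v \<circ> F\<close> on \<open>Q\<close> together with its natural extension \<open>\<E>\<close> to other elements. It is
  unique because a polynomial is determined by its values on a nonempty open set.\<close>

definition local_poly ::
    "nat \<Rightarrow> (real^'d::finite \<Rightarrow> real^'d) \<Rightarrow> (real^'d) set \<Rightarrow> (real^'d \<Rightarrow> real) \<Rightarrow> (real^'d) set
      \<Rightarrow> real^'d \<Rightarrow> real" where
  "local_poly p F \<Omega> v K = (THE q. q \<in> tensor_polys p \<and>
     (\<forall>\<zeta> \<in> param_preimage F K \<inter> param_preimage F \<Omega>. q \<zeta> = v (F \<zeta>)))"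

text \<open>\<open>K'\<close> is \<open>K\<close> itself if \<open>K\<close> is good (then \<open>local_poly p F \<Omega> v K \<circ> F\<^sup>-\<^sup>1\<close> is \<open>v|\<^sub>K\<close>), and the
  good neighbour of \<open>K\<close> otherwise. As \<open>F\<^sup>-\<^sup>1\<close> is smooth up to the boundary of \<open>K\<close>, the gradient on
  the closure of \<open>K\<close> is the limit of the gradient taken inside the open set \<open>K\<close>.\<close>

definition stabilization ::
    "nat \<Rightarrow> (real^'d::finite \<Rightarrow> real^'d) \<Rightarrow> (real^'d) set \<Rightarrow> (real^'d) set \<Rightarrow> (real^'d) set
      \<Rightarrow> (real^'d \<Rightarrow> real) \<Rightarrow> real^'d \<Rightarrow> real" where
  "stabilization p F \<Omega> K K' v x =
     outward_normal \<Omega> x \<bullet> Lim (at x within K) (grad (local_poly p F \<Omega> v K' \<circ> param_inv F))"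

end

theory Submission
  imports Defs
begin

text \<open>On a good element \<open>K' = F(Q')\<close> the function \<open>v \<circ> F\<close> is a polynomial \<open>q\<close>, so the operator
  \<open>R\<^sub>K\<close> is controlled pointwise by the gradient of \<open>q\<close> on \<open>Q = F\<^sup>-\<^sup>1(K)\<close>. Shape regularity of a
  tensor-product mesh in dimension at least two makes all elements of comparable size, so \<open>Q\<close> lies
  in a fixed dilate of \<open>Q'\<close>. By Markov's inequality the gradient of \<open>v\<close> is at most a
  multiple of its \<open>L\<^sup>2\<close> norm divided by the square root of \<open>|Q'|\<close>, outside a set whose preimage covers at most half of the
  good part of \<open>Q'\<close>, and a Remez inequality transports this bound for the partial derivatives of
  \<open>q\<close> from the remaining part of \<open>Q'\<close> to the dilate. Integrating over \<open>\<Gamma>\<^sub>K\<close>, whose area is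
  at most a multiple of \<open>h\<^sub>K\<^sup>d\<^sup>-\<^sup>1\<close>, gives the estimate.\<close>

section \<open>A Remez inequality for sets of positive measure\<close>

text \<open>The part of a good element inside the trimmed domain can have any shape; only its volume
  fraction is known, so norm equivalence on one fixed reference set does not apply. The Remez
  constant depends only on the degree, the dimension, that fraction and the dilation factor, hence
  on no element. The inequality is applied to the partial derivatives of \<open>q\<close>, not to
  \<open>q\<close>, because the right-hand side contains only the gradient of \<open>v\<close>. A
  good \<open>K\<close> needs no separate argument: it is the case \<open>Q = Q'\<close> of the
  dilation. All passages between the parametric and the physical domain rest on the two Lipschitz
  constants, used for difference quotients, diameters and volumes, so no Jacobian determinant
  occurs. Smoothness of the inverse map up to the boundary of an element serves to give the limit in
  \<open>stabilization\<close> a value and to make the exceptional set of Markov's inequality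
  open.\<close>

lemma exists_separated_subset:
  fixes S :: "real set"
  assumes S: "S \<in> sets borel" and \<eta>: "\<eta> \<ge> 0"
    and big: "ennreal (2 * \<eta> * real n) < emeasure lborel S" and k: "k \<le> Suc n"
  shows "\<exists>A\<subseteq>S. finite A \<and> card A = k \<and> (\<forall>x\<in>A. \<forall>y\<in>A. x \<noteq> y \<longrightarrow> \<eta> \<le> \<bar>x - y\<bar>)"
  using k
proof (induction k)
  case 0
  show ?case by (intro exI[of _ "{}"]) auto
next
  case (Suc k)
  then obtain A where A: "A \<subseteq> S" "finite A" "card A = k"
      "\<And>x y. x \<in> A \<Longrightarrow> y \<in> A \<Longrightarrow> x \<noteq> y \<Longrightarrow> \<eta> \<le> \<bar>x - y\<bar>" by auto
  \<comment> \<open>Greedy choice: the \<open>k\<close> points found so far forbid a total length of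
    at most \<open>2 * \<eta> * k\<close>, and \<open>k \<le> n\<close> at this stage, so a point of
    \<open>S\<close> is left.\<close>
  let ?U = "\<Union>x\<in>A. {x - \<eta> <..< x + \<eta>}"
  have "emeasure lborel ?U \<le> (\<Sum>x\<in>A. emeasure lborel {x - \<eta> <..< x + \<eta>})"
    using A(2) by (intro emeasure_subadditive_finite) auto
  also have "\<dots> = (\<Sum>x\<in>A. ennreal (2 * \<eta>))"
    using \<eta> by (intro sum.cong) auto
  also have "\<dots> = ennreal (2 * \<eta> * real k)"
    using \<eta> A(3) by (simp add: ennreal_mult' mult.commute ennreal_of_nat_eq_real_of_nat)
  also have "\<dots> \<le> ennreal (2 * \<eta> * real n)"
    using \<eta> Suc.prems by (intro ennreal_leI mult_left_mono) auto
  also note big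
  finally have lt: "emeasure lborel ?U < emeasure lborel S" .
  have "\<not> S \<subseteq> ?U"
  proof
    assume "S \<subseteq> ?U"
    then have "emeasure lborel S \<le> emeasure lborel ?U"
      using \<open>finite A\<close> by (intro emeasure_mono sets.finite_UN) auto
    with lt show False by simp
  qed
  then obtain y where y: "y \<in> S" "y \<notin> ?U" by blast
  show ?case
  \<comment> \<open>For \<open>\<eta> = 0\<close> the forbidden intervals are empty and
    \<open>y\<close> may already belong to \<open>A\<close>; but \<open>S\<close> has positive
    measure and is therefore infinite.\<close>
  proof (cases "\<eta> = 0")
    case True
    have "infinite S"
    proof
      assume "finite S"
      then have "emeasure lborel S = 0" by (rule finite_imp_null_set_lborel[THEN null_setsD1])
      with big show False by simp
    qed
    then obtain A where "A \<subseteq> S" "finite A" "card A = Suc k" by (meson infinite_arbitrarily_large)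
    then show ?thesis using True by auto
  next
    case False
    with y(2) \<eta> have ny: "y \<notin> A" by auto
    have far: "\<eta> \<le> \<bar>x - y\<bar>" if "x \<in> A" for x
      using y(2) that by (force simp: abs_if not_less)
    show ?thesis
      using A y(1) ny far
      by (intro exI[of _ "insert y A"]) (auto simp: abs_minus_commute)
  qed
qed

lemma lagrange_interpolation:
  fixes P :: "'a::field poly"
  assumes A: "finite A" and deg: "degree P < card A"
  shows "poly P t = (\<Sum>x\<in>A. poly P x * (\<Prod>y\<in>A - {x}. (t - y) / (x - y)))"
proof -
  define L where "L x = (\<Prod>y\<in>A - {x}. smult (1 / (x - y)) [:- y, 1:])" for x
  define Q where "Q = (\<Sum>x\<in>A. smult (poly P x) (L x))"
  have pL: "poly (L x) s = (\<Prod>y\<in>A - {x}. (s - y) / (x - y))" for x s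
    unfolding L_def poly_prod by (intro prod.cong) (auto simp: diff_divide_distrib)
  have "degree (L x) \<le> card A - 1" if "x \<in> A" for x
  proof -
    have "degree (L x) \<le> (\<Sum>y\<in>A - {x}. degree (smult (1 / (x - y)) [:- y, 1:]))"
      unfolding L_def using A by (intro order_trans[OF degree_prod_sum_le]) (auto simp del: smult_pCons)
    also have "\<dots> \<le> (\<Sum>y\<in>A - {x}. 1)" by (intro sum_mono) (simp add: degree_smult_le)
    finally show ?thesis using that A by simp
  qed
  then have "degree Q \<le> card A - 1"
    unfolding Q_def using A by (intro degree_sum_le) (auto intro: order_trans[OF degree_smult_le])
  moreover have "poly P s = poly Q s" if s: "s \<in> A" for s
  proof -
    have "poly (L x) s = (if x = s then 1 else 0)" if "x \<in> A" for x
      unfolding pL using s A by (auto intro!: prod.neutral simp: prod_zero_iff)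
    then have "poly Q s = (\<Sum>x\<in>A. poly P x * (if x = s then 1 else 0))"
      unfolding Q_def poly_sum by (intro sum.cong) auto
    also have "\<dots> = (\<Sum>x\<in>A. if x = s then poly P x else 0)" by (intro sum.cong) auto
    also have "\<dots> = poly P s" using s A by (subst sum.delta) auto
    finally show ?thesis by simp
  qed
  ultimately have "P = Q" using deg by (intro poly_eqI_degree[of A]) auto
  then have "poly P t = poly Q t" by simp
  also have "\<dots> = (\<Sum>x\<in>A. poly P x * (\<Prod>y\<in>A - {x}. (t - y) / (x - y)))"
    unfolding Q_def poly_sum by (simp add: pL)
  finally show ?thesis .
qed

text \<open>Interpolation at \<open>p + 1\<close> points of \<open>S\<close> with mutual distance at
  least \<open>\<eta>\<close> bounds every Lagrange factor by
  \<open>(M + 1) * (b - a) / \<eta>\<close>. The resulting constant is cruder than the sharp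
  Chebyshev one, but likewise independent of \<open>S\<close>, \<open>a\<close> and
  \<open>b\<close>.\<close>

lemma remez_univariate:
  fixes P :: "real poly"
  assumes deg: "degree P \<le> p" and ab: "a < b" and S: "S \<in> sets borel" "S \<subseteq> {a..b}"
    and big: "ennreal (\<theta> * (b - a)) \<le> emeasure lborel S" and \<theta>: "0 < \<theta>" and M: "0 \<le> M"
    and bd: "\<And>x. x \<in> S \<Longrightarrow> \<bar>poly P x\<bar> \<le> B" and t: "\<bar>t - a\<bar> \<le> M * (b - a)"
  shows "\<bar>poly P t\<bar> \<le> real (Suc p) * (2 * (M + 1) * real (Suc p) / \<theta>) ^ p * B"
proof -
  \<comment> \<open>The denominator contains \<open>Suc p\<close> rather than \<open>p\<close>, so
    that the forbidden length \<open>2 * \<eta> * p\<close> stays strictly below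
    \<open>\<theta> * (b - a)\<close>.\<close>
  define \<eta> where "\<eta> = \<theta> * (b - a) / (2 * real (Suc p))"
  have \<eta>: "\<eta> > 0" using \<theta> ab by (simp add: \<eta>_def)
  have "2 * \<eta> * real p < \<theta> * (b - a)"
    using \<theta> ab by (simp add: \<eta>_def field_simps)
  then have "ennreal (2 * \<eta> * real p) < ennreal (\<theta> * (b - a))"
    using \<eta> by (intro ennreal_lessI) (auto simp: \<theta> ab)
  with big have "ennreal (2 * \<eta> * real p) < emeasure lborel S" by simp
  then obtain A where A: "A \<subseteq> S" "finite A" "card A = Suc p"
      "\<And>x y. x \<in> A \<Longrightarrow> y \<in> A \<Longrightarrow> x \<noteq> y \<Longrightarrow> \<eta> \<le> \<bar>x - y\<bar>"
    using exists_separated_subset[OF S(1), of \<eta> p "Suc p"] \<eta> by auto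
  \<comment> \<open>\<open>R\<close> is the quotient of \<open>(M + 1) * (b - a)\<close>, which
    bounds the distance from \<open>t\<close> to any node, by the least distance
    \<open>\<eta>\<close> between two nodes.\<close>
  define R where "R = 2 * (M + 1) * real (Suc p) / \<theta>"
  have "2 * (M + 1) * c / \<theta> * (\<theta> * (b - a) / (2 * c)) = (M + 1) * (b - a)" if "c > 0" for c
    using \<theta> that by (simp add: field_simps)
  from this[of "real (Suc p)"] have R: "R * \<eta> = (M + 1) * (b - a)"
    unfolding R_def \<eta>_def by simp
  have R0: "0 \<le> R" using \<theta> M by (simp add: R_def)
  have "\<bar>poly P t\<bar> \<le> (\<Sum>x\<in>A. \<bar>poly P x * (\<Prod>y\<in>A - {x}. (t - y) / (x - y))\<bar>)"
    using lagrange_interpolation[of A P t] A(2,3) deg by (simp add: sum_abs)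
  also have "\<dots> \<le> (\<Sum>x\<in>A. B * R ^ p)"
  proof (rule sum_mono)
    fix x assume x: "x \<in> A"
    have "\<bar>\<Prod>y\<in>A - {x}. (t - y) / (x - y)\<bar> = (\<Prod>y\<in>A - {x}. \<bar>t - y\<bar> / \<bar>x - y\<bar>)"
      by (simp add: abs_prod)
    also have "\<dots> \<le> (\<Prod>y\<in>A - {x}. R)"
    proof (rule prod_mono, safe)
      fix y assume y: "y \<in> A" "y \<noteq> x"
      have d: "\<eta> \<le> \<bar>x - y\<bar>" using A(4)[of x y] x y by auto
      have "y \<in> {a..b}" using y A(1) S(2) by blast
      then have "\<bar>t - y\<bar> \<le> M * (b - a) + (b - a)" using t by auto
      then have "\<bar>t - y\<bar> \<le> (M + 1) * (b - a)" by (simp add: algebra_simps)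
      also have "\<dots> \<le> R * \<bar>x - y\<bar>" unfolding R[symmetric] by (intro mult_left_mono d R0)
      finally show "\<bar>t - y\<bar> / \<bar>x - y\<bar> \<le> R" using d \<eta> by (simp add: field_simps)
    qed simp
    also have "\<dots> = R ^ p" using A(2,3) x by simp
    finally have "\<bar>poly P x\<bar> * \<bar>\<Prod>y\<in>A - {x}. (t - y) / (x - y)\<bar> \<le> B * R ^ p"
      using bd[of x] x A(1) R0 by (intro mult_mono) (auto intro: order_trans[OF abs_ge_zero])
    then show "\<bar>poly P x * (\<Prod>y\<in>A - {x}. (t - y) / (x - y))\<bar> \<le> B * R ^ p"
      by (simp add: abs_mult)
  qed
  also have "\<dots> = real (Suc p) * R ^ p * B" by (simp add: A(3))
  finally show ?thesis by (simp add: R_def)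
qed

text \<open>The induction on the dimension runs over the index set of a product measure: by Fubini a
  large set has many large one-dimensional slices.\<close>

lemma remez_PiM:
  fixes p :: nat and M :: real
  assumes "finite I" and M: "0 \<le> M" and "0 < \<theta>"
  shows "\<exists>C>0. \<forall>a b S f B x. (\<forall>i\<in>I. a i < b i) \<and> S \<in> sets (\<Pi>\<^sub>M i\<in>I. lborel) \<and>
    S \<subseteq> (\<Pi>\<^sub>E i\<in>I. {a i..b i}) \<and>
    ennreal (\<theta> * (\<Prod>i\<in>I. b i - a i)) \<le> emeasure (\<Pi>\<^sub>M i\<in>I. lborel) S \<and>
    (\<forall>i\<in>I. \<forall>x. \<exists>P. degree P \<le> p \<and> (\<forall>t. f (x(i := t)) = poly P t)) \<and>
    (\<forall>x\<in>S. \<bar>f x\<bar> \<le> B) \<and> x \<in> extensional I \<and>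
    (\<forall>i\<in>I. \<bar>x i - a i\<bar> \<le> M * (b i - a i)) \<longrightarrow> \<bar>f x :: real\<bar> \<le> C * B"
  using assms(1,3)
proof (induction I arbitrary: \<theta> rule: finite_induct)
  case empty
  show ?case
  proof (intro exI[of _ 1] conjI allI impI)
    fix S :: "('a \<Rightarrow> real) set" and f :: "('a \<Rightarrow> real) \<Rightarrow> real" and B and x a b :: "'a \<Rightarrow> real"
    assume H: "(\<forall>i\<in>{}. a i < b i) \<and> S \<in> sets (\<Pi>\<^sub>M i\<in>{}. lborel) \<and>
      S \<subseteq> (\<Pi>\<^sub>E i\<in>{}. {a i..b i}) \<and>
      ennreal (\<theta> * (\<Prod>i\<in>{}. b i - a i)) \<le> emeasure (\<Pi>\<^sub>M i\<in>{}. lborel) S \<and>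
      (\<forall>i\<in>{}. \<forall>x. \<exists>P. degree P \<le> p \<and> (\<forall>t. f (x(i := t)) = poly P t)) \<and>
      (\<forall>x\<in>S. \<bar>f x\<bar> \<le> B) \<and> x \<in> extensional {} \<and>
      (\<forall>i\<in>{}. \<bar>x i - a i\<bar> \<le> M * (b i - a i))"
    then have "S \<noteq> {}" using empty by auto
    with H show "\<bar>f x\<bar> \<le> 1 * B" by (auto simp: PiE_empty_domain)
  qed simp
next
  case (insert i I)
  interpret product_sigma_finite "\<lambda>_::'a. lborel :: real measure" ..
  \<comment> \<open>\<open>\<theta>\<close> is halved: one half goes into the measure of the set of
    large slices, the other into the length of each such slice.\<close>
  obtain C where C: "C > 0" and IH: "\<forall>a b S f B x. (\<forall>i\<in>I. a i < b i) \<and> S \<in> sets (\<Pi>\<^sub>M i\<in>I. lborel) \<and>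
    S \<subseteq> (\<Pi>\<^sub>E i\<in>I. {a i..b i}) \<and>
    ennreal (\<theta> / 2 * (\<Prod>i\<in>I. b i - a i)) \<le> emeasure (\<Pi>\<^sub>M i\<in>I. lborel) S \<and>
    (\<forall>i\<in>I. \<forall>x. \<exists>P. degree P \<le> p \<and> (\<forall>t. f (x(i := t)) = poly P t)) \<and>
    (\<forall>x\<in>S. \<bar>f x\<bar> \<le> B) \<and> x \<in> extensional I \<and>
    (\<forall>i\<in>I. \<bar>x i - a i\<bar> \<le> M * (b i - a i)) \<longrightarrow> \<bar>f x :: real\<bar> \<le> C * B"
    using insert.IH[OF half_gt_zero[OF insert.prems]] by blast
  define D where "D = real (Suc p) * (2 * (M + 1) * real (Suc p) / (\<theta> / 2)) ^ p"
  have D: "D > 0" using insert.prems M by (simp add: D_def add_nonneg_pos)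
  show ?case
  proof (intro exI[of _ "C * D"] conjI allI impI)
    show "C * D > 0" using C D by simp
    fix a b x :: "'a \<Rightarrow> real" and S :: "('a \<Rightarrow> real) set" and f :: "('a \<Rightarrow> real) \<Rightarrow> real" and B :: real
    assume H: "(\<forall>j\<in>insert i I. a j < b j) \<and> S \<in> sets (\<Pi>\<^sub>M j\<in>insert i I. lborel) \<and>
      S \<subseteq> (\<Pi>\<^sub>E j\<in>insert i I. {a j..b j}) \<and>
      ennreal (\<theta> * (\<Prod>j\<in>insert i I. b j - a j)) \<le> emeasure (\<Pi>\<^sub>M j\<in>insert i I. lborel) S \<and>
      (\<forall>j\<in>insert i I. \<forall>x. \<exists>P. degree P \<le> p \<and> (\<forall>t. f (x(j := t)) = poly P t)) \<and>
      (\<forall>x\<in>S. \<bar>f x\<bar> \<le> B) \<and> x \<in> extensional (insert i I) \<and>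
      (\<forall>j\<in>insert i I. \<bar>x j - a j\<bar> \<le> M * (b j - a j))"
    then have ab: "\<forall>j\<in>insert i I. a j < b j" and S[measurable]: "S \<in> sets (\<Pi>\<^sub>M j\<in>insert i I. lborel)"
      and Sb: "S \<subseteq> (\<Pi>\<^sub>E j\<in>insert i I. {a j..b j})"
      and big: "ennreal (\<theta> * (\<Prod>j\<in>insert i I. b j - a j)) \<le> emeasure (\<Pi>\<^sub>M j\<in>insert i I. lborel) S"
      and f: "\<forall>j\<in>insert i I. \<forall>x. \<exists>P. degree P \<le> p \<and> (\<forall>t. f (x(j := t)) = poly P t)"
      and bd: "\<forall>x\<in>S. \<bar>f x\<bar> \<le> B" and x: "x \<in> extensional (insert i I)"
      and xb: "\<forall>j\<in>insert i I. \<bar>x j - a j\<bar> \<le> M * (b j - a j)" by blast+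
    let ?P = "\<Pi>\<^sub>M j\<in>I. lborel :: real measure"
    define sl where "sl y = {t. y(i := t) \<in> S}" for y
    have sl_meas: "sl y \<in> sets borel" if "y \<in> space ?P" for y
    proof -
      have "(\<lambda>t. y(i := t)) \<in> lborel \<rightarrow>\<^sub>M (\<Pi>\<^sub>M j\<in>insert i I. lborel)"
        using that insert.hyps by (intro measurable_fun_upd[where J=I]) auto
      from measurable_sets[OF this S] show ?thesis by (simp add: sl_def vimage_def)
    qed
    have sl_sub: "sl y \<subseteq> {a i..b i}" for y using Sb by (auto simp: sl_def PiE_iff)
    have sl_ne: "y \<in> (\<Pi>\<^sub>E j\<in>I. {a j..b j})" if ne: "sl y \<noteq> {}" "y \<in> space ?P" for y
    proof -
      obtain t where "y(i := t) \<in> S" using ne(1) unfolding sl_def by blast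
      then have *: "y(i := t) \<in> (\<Pi>\<^sub>E j\<in>insert i I. {a j..b j})" using Sb by blast
      have "y j \<in> {a j..b j}" if "j \<in> I" for j
        using PiE_mem[OF *, of j] that insert.hyps by (cases "j = i") auto
      then show ?thesis using ne(2) by (auto simp: PiE_iff space_PiM)
    qed
    define g where "g y = emeasure lborel (sl y)" for y
    have [measurable]: "(\<lambda>p. (fst p)(i := snd p)) \<in> (?P \<Otimes>\<^sub>M lborel) \<rightarrow>\<^sub>M (\<Pi>\<^sub>M j\<in>insert i I. lborel)"
      using measurable_add_dim[of i I "\<lambda>_. lborel"] by (simp add: case_prod_beta')
    have g_eq: "(\<integral>\<^sup>+t. indicator S (y(i := t)) \<partial>lborel) = g y" if "y \<in> space ?P" for y
    proof -
      have "(\<integral>\<^sup>+t. indicator S (y(i := t)) \<partial>lborel) = (\<integral>\<^sup>+t. indicator (sl y) t \<partial>lborel)"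
        by (intro nn_integral_cong) (auto simp: sl_def indicator_def)
      also have "\<dots> = g y" using sl_meas[OF that] by (simp add: g_def)
      finally show ?thesis .
    qed
    have "(\<lambda>y. \<integral>\<^sup>+t. indicator S (y(i := t)) \<partial>lborel) \<in> borel_measurable ?P"
      by (rule lborel.borel_measurable_nn_integral) (simp add: case_prod_beta', measurable)
    then have g_meas[measurable]: "g \<in> borel_measurable ?P"
      using g_eq by (subst measurable_cong[where g="\<lambda>y. \<integral>\<^sup>+t. indicator S (y(i := t)) \<partial>lborel"]) auto
    define T where "T = {y\<in>space ?P. ennreal (\<theta> / 2 * (b i - a i)) \<le> g y}"
    have T[measurable]: "T \<in> sets ?P" unfolding T_def by measurable
    have pos: "0 < \<theta> / 2 * (b i - a i)" using ab insert.prems by simp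
    have T_sub: "T \<subseteq> (\<Pi>\<^sub>E j\<in>I. {a j..b j})"
    proof
      fix y assume y: "y \<in> T"
      then have "g y \<noteq> 0" using pos by (auto simp: T_def)
      then have "sl y \<noteq> {}" by (auto simp: g_def)
      then show "y \<in> (\<Pi>\<^sub>E j\<in>I. {a j..b j})" using sl_ne y by (auto simp: T_def)
    qed
    let ?X = "\<Pi>\<^sub>E j\<in>I. {a j..b j}"
    have X[measurable]: "?X \<in> sets ?P" using insert.hyps by (intro sets_PiM_I_finite) auto
    have eX: "emeasure ?P ?X = ennreal (\<Prod>j\<in>I. b j - a j)"
      using insert.hyps ab by (subst emeasure_PiM) (auto simp: prod_ennreal less_imp_le)
    \<comment> \<open>A slice over \<open>T\<close> has length at most \<open>b i - a i\<close>; any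
      other slice is shorter than the fraction \<open>\<theta> / 2\<close> of that, and slices are
      empty outside the box \<open>?X\<close>. Integrating and comparing with \<open>big\<close>
      leaves \<open>T\<close> at least the fraction \<open>\<theta> / 2\<close> of
      \<open>?X\<close>.\<close>
    have g_le: "g y \<le> ennreal (b i - a i) * indicator T y + ennreal (\<theta> / 2 * (b i - a i)) * indicator ?X y"
      if y: "y \<in> space ?P" for y
    proof (cases "y \<in> T")
      case True
      have "g y \<le> emeasure lborel {a i..b i}" unfolding g_def by (intro emeasure_mono sl_sub) auto
      then show ?thesis using ab True by (auto intro: order_trans add_increasing2)
    next
      case False
      then have 1: "g y \<le> ennreal (\<theta> / 2 * (b i - a i))" using y by (auto simp: T_def)
      show ?thesis
      proof (cases "sl y = {}")
        case False
        then show ?thesis using sl_ne[OF _ y] 1 \<open>y \<notin> T\<close> by (auto)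
      qed (simp add: g_def)
    qed
    have prod: "(\<Prod>j\<in>insert i I. b j - a j) = (b i - a i) * (\<Prod>j\<in>I. b j - a j)"
      using insert.hyps by simp
    have P0: "0 < (\<Prod>j\<in>I. b j - a j)" using ab by (intro prod_pos) auto
    have "emeasure (\<Pi>\<^sub>M j\<in>insert i I. lborel) S = (\<integral>\<^sup>+y. (\<integral>\<^sup>+t. indicator S (y(i := t)) \<partial>lborel) \<partial>?P)"
      using product_nn_integral_insert[OF insert.hyps, of "indicator S"] by simp
    also have "\<dots> = (\<integral>\<^sup>+y. g y \<partial>?P)" by (intro nn_integral_cong g_eq)
    also have "\<dots> \<le> (\<integral>\<^sup>+y. ennreal (b i - a i) * indicator T y + ennreal (\<theta> / 2 * (b i - a i)) * indicator ?X y \<partial>?P)"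
      by (intro nn_integral_mono g_le)
    also have "\<dots> = ennreal (b i - a i) * emeasure ?P T + ennreal (\<theta> / 2 * (b i - a i)) * emeasure ?P ?X"
      by (simp add: nn_integral_add nn_integral_cmult_indicator)
    finally have main: "ennreal (\<theta> * ((b i - a i) * (\<Prod>j\<in>I. b j - a j)))
        \<le> ennreal (b i - a i) * emeasure ?P T + ennreal (\<theta> / 2 * (b i - a i)) * ennreal (\<Prod>j\<in>I. b j - a j)"
      using big prod eX by simp
    \<comment> \<open>\<open>T\<close> has finite measure, so the subtraction that isolates it can
      be carried out in the reals.\<close>
    have "emeasure ?P T \<le> emeasure ?P ?X" by (intro emeasure_mono T_sub) auto
    then have "emeasure ?P T < top" unfolding eX by (rule le_less_trans) simp
    then obtain \<tau> where \<tau>: "emeasure ?P T = ennreal \<tau>" "\<tau> \<ge> 0" by (cases "emeasure ?P T") auto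
    have "\<theta> * ((b i - a i) * (\<Prod>j\<in>I. b j - a j))
        \<le> (b i - a i) * \<tau> + \<theta> / 2 * (b i - a i) * (\<Prod>j\<in>I. b j - a j)"
      using main pos P0 \<tau> ab
      by (simp add: ennreal_mult[symmetric] ennreal_plus[symmetric] del: ennreal_plus)
    moreover have "\<theta> * (w * q) = \<theta> / 2 * w * q + w * (\<theta> / 2 * q)" for w q by (simp add: field_simps)
    ultimately have "(b i - a i) * (\<theta> / 2 * (\<Prod>j\<in>I. b j - a j)) \<le> (b i - a i) * \<tau>"
      by (metis add.commute add_le_cancel_left)
    then have "\<theta> / 2 * (\<Prod>j\<in>I. b j - a j) \<le> \<tau>" using ab by simp
    then have bigT: "ennreal (\<theta> / 2 * (\<Prod>j\<in>I. b j - a j)) \<le> emeasure ?P T"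
      unfolding \<tau> by (intro ennreal_leI)
    define t where "t = x i"
    define x' where "x' = x(i := undefined)"
    have xx: "x = x'(i := t)" "x' \<in> extensional I" using x insert.hyps by (auto simp: x'_def t_def extensional_def)
    \<comment> \<open>Coordinate \<open>i\<close> is frozen at the target value \<open>t\<close>:
      over \<open>T\<close> the one-dimensional estimate along the slice gives the bound
      \<open>D * B\<close>, and the induction hypothesis carries it from \<open>T\<close> to
      \<open>x'\<close>.\<close>
    have "\<bar>f (x'(i := t))\<bar> \<le> C * (D * B)"
    proof (rule IH[rule_format, of a b T "\<lambda>y. f (y(i := t))"], intro conjI)
      show "\<forall>i\<in>I. a i < b i" using ab by auto
      show "\<forall>j\<in>I. \<forall>x. \<exists>P. degree P \<le> p \<and> (\<forall>s. f (x(j := s, i := t)) = poly P s)"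
      proof (intro ballI allI)
        fix j y assume j: "j \<in> I"
        then have "\<exists>P. degree P \<le> p \<and> (\<forall>s. f ((y(i := t))(j := s)) = poly P s)" using f by blast
        moreover have "(y(i := t))(j := s) = y(j := s, i := t)" for s
          using j insert.hyps by (intro fun_upd_twist) auto
        ultimately show "\<exists>P. degree P \<le> p \<and> (\<forall>s. f (y(j := s, i := t)) = poly P s)" by simp
      qed
      show "\<forall>y\<in>T. \<bar>f (y(i := t))\<bar> \<le> D * B"
      proof
        fix y assume y: "y \<in> T"
        then have yP: "y \<in> space ?P" by (simp add: T_def)
        obtain P where P: "degree P \<le> p" "\<And>s. f (y(i := s)) = poly P s" using f by blast
        have "\<bar>poly P t\<bar> \<le> D * B" unfolding D_def
        proof (rule remez_univariate[OF P(1) _ sl_meas[OF yP] sl_sub])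
          show "ennreal (\<theta> / 2 * (b i - a i)) \<le> emeasure lborel (sl y)" using y by (simp add: T_def g_def)
          show "\<bar>poly P s\<bar> \<le> B" if "s \<in> sl y" for s using bd that P(2) by (auto simp: sl_def)
        qed (use ab M xb insert.prems in \<open>auto simp: t_def\<close>)
        then show "\<bar>f (y(i := t))\<bar> \<le> D * B" using P by simp
      qed
      show "\<forall>j\<in>I. \<bar>x' j - a j\<bar> \<le> M * (b j - a j)" using xb insert.hyps by (auto simp: x'_def)
    qed (use T T_sub bigT xx in auto)
    then show "\<bar>f x\<bar> \<le> C * D * B" using xx(1) by (simp add: mult.assoc)
  qed
qed

text \<open>Only restrictions to axis-parallel lines are recorded, which is the form in which the
  induction over coordinates consumes a polynomial.\<close>

definition coordinatewise_poly :: "nat \<Rightarrow> ('a::euclidean_space \<Rightarrow> real) \<Rightarrow> bool" where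
  "coordinatewise_poly p f \<longleftrightarrow>
     (\<forall>i\<in>Basis. \<forall>x. \<exists>P. degree P \<le> p \<and> (\<forall>t. f (x + t *\<^sub>R i) = poly P t))"

text \<open>Lebesgue measure is the image of the product measure under the map \<open>e\<close> from
  coordinate families to vectors, so the product estimate transfers to the pullback \<open>T\<close>
  of \<open>S\<close>.\<close>

lemma remez_euclidean:
  fixes p :: nat and M \<theta> :: real
  assumes M: "0 \<le> M" and \<theta>: "0 < \<theta>"
  obtains C where "C > 0"
    "\<And>a b S f B (x :: 'a::euclidean_space). (\<And>i. i \<in> Basis \<Longrightarrow> a \<bullet> i < b \<bullet> i) \<Longrightarrow> S \<in> sets borel \<Longrightarrow>
      S \<subseteq> cbox a b \<Longrightarrow> \<theta> * measure lborel (cbox a b) \<le> measure lborel S \<Longrightarrow> coordinatewise_poly p f \<Longrightarrow>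
      (\<And>x. x \<in> S \<Longrightarrow> \<bar>f x\<bar> \<le> B) \<Longrightarrow>
      (\<And>i. i \<in> Basis \<Longrightarrow> \<bar>x \<bullet> i - a \<bullet> i\<bar> \<le> M * (b \<bullet> i - a \<bullet> i)) \<Longrightarrow> \<bar>f x\<bar> \<le> C * B"
proof -
  obtain C where C: "C > 0" and R: "\<forall>a b S f B x. (\<forall>i\<in>Basis. a i < b i) \<and> S \<in> sets (\<Pi>\<^sub>M i\<in>Basis. lborel) \<and>
    S \<subseteq> (\<Pi>\<^sub>E i\<in>Basis. {a i..b i}) \<and>
    ennreal (\<theta> * (\<Prod>i\<in>Basis. b i - a i)) \<le> emeasure (\<Pi>\<^sub>M i\<in>Basis. lborel) S \<and>
    (\<forall>i\<in>Basis. \<forall>x. \<exists>P. degree P \<le> p \<and> (\<forall>t. f (x(i := t)) = poly P t)) \<and>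
    (\<forall>x\<in>S. \<bar>f x\<bar> \<le> B) \<and> x \<in> extensional Basis \<and>
    (\<forall>i\<in>Basis. \<bar>x (i::'a) - a i\<bar> \<le> M * (b i - a i)) \<longrightarrow> \<bar>f x :: real\<bar> \<le> C * B"
    using remez_PiM[OF finite_Basis M \<theta>, where p=p] by blast
  show thesis
  proof (rule that[OF C])
    fix a b x :: 'a and S :: "'a set" and f :: "'a \<Rightarrow> real" and B :: real
    assume ab: "\<And>i. i \<in> Basis \<Longrightarrow> a \<bullet> i < b \<bullet> i" and S[measurable]: "S \<in> sets borel" and sub: "S \<subseteq> cbox a b"
      and big: "\<theta> * measure lborel (cbox a b) \<le> measure lborel S"
      and "coordinatewise_poly p f"
      and bd: "\<And>x. x \<in> S \<Longrightarrow> \<bar>f x\<bar> \<le> B"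
      and x: "\<And>i. i \<in> Basis \<Longrightarrow> \<bar>x \<bullet> i - a \<bullet> i\<bar> \<le> M * (b \<bullet> i - a \<bullet> i)"
    then have f: "\<forall>i\<in>Basis. \<forall>x. \<exists>P. degree P \<le> p \<and> (\<forall>t. f (x + t *\<^sub>R i) = poly P t)"
      by (simp add: coordinatewise_poly_def)
    let ?P = "\<Pi>\<^sub>M i\<in>(Basis::'a set). lborel :: real measure"
    define e where "e \<phi> = (\<Sum>i\<in>Basis. \<phi> i *\<^sub>R i)" for \<phi> :: "'a \<Rightarrow> real"
    have e_inner: "e \<phi> \<bullet> i = \<phi> i" if "i \<in> Basis" for \<phi> i
      using that by (simp add: e_def inner_sum_left inner_Basis if_distrib cong: if_cong)
    have e_meas[measurable]: "e \<in> ?P \<rightarrow>\<^sub>M borel" unfolding e_def by measurable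
    have lb: "lborel = distr ?P borel e" unfolding e_def by (rule lborel_eq)
    define T where "T = e -` S \<inter> space ?P"
    have T: "T \<in> sets ?P" unfolding T_def by measurable
    have eT: "emeasure ?P T = emeasure lborel S"
      by (subst lb, subst emeasure_distr) (auto simp: T_def)
    have fin: "emeasure lborel S < top"
      using emeasure_mono[OF sub, of lborel] emeasure_lborel_cbox_finite[of a b]
      by (auto intro: le_less_trans)
    have me: "measure lborel (cbox a b) = (\<Prod>i\<in>Basis. b \<bullet> i - a \<bullet> i)"
      using ab by (subst measure_lborel_cbox) (auto simp: inner_diff_left less_imp_le)
    have "\<bar>f (e (restrict (\<lambda>i. x \<bullet> i) Basis))\<bar> \<le> C * B"
    proof (rule R[rule_format, of "\<lambda>i. a \<bullet> i" "\<lambda>i. b \<bullet> i" T "\<lambda>\<phi>. f (e \<phi>)"], intro conjI)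
      show "T \<subseteq> (\<Pi>\<^sub>E i\<in>Basis. {a \<bullet> i..b \<bullet> i})"
      proof
        fix \<phi> assume "\<phi> \<in> T"
        then have "e \<phi> \<in> cbox a b" and ext: "\<phi> \<in> extensional Basis"
          using sub by (auto simp: T_def space_PiM PiE_iff)
        then show "\<phi> \<in> (\<Pi>\<^sub>E i\<in>Basis. {a \<bullet> i..b \<bullet> i})" by (simp add: mem_box PiE_iff e_inner)
      qed
      show "ennreal (\<theta> * (\<Prod>i\<in>Basis. b \<bullet> i - a \<bullet> i)) \<le> emeasure ?P T"
        using big fin unfolding eT me by (simp add: emeasure_eq_ennreal_measure less_top ennreal_leI)
      show "\<forall>i\<in>Basis. \<forall>\<phi>. \<exists>P. degree P \<le> p \<and> (\<forall>t. f (e (\<phi>(i := t))) = poly P t)"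
      proof (intro ballI allI)
        fix i :: 'a and \<phi> assume i: "i \<in> Basis"
        have "e (\<phi>(i := t)) = e (\<phi>(i := 0)) + t *\<^sub>R i" for t
          by (rule euclidean_eqI) (use i in \<open>auto simp: e_inner inner_add_left inner_Basis\<close>)
        moreover obtain P where "degree P \<le> p" "\<And>t. f (e (\<phi>(i := 0)) + t *\<^sub>R i) = poly P t"
          using bspec[OF f i] by blast
        ultimately show "\<exists>P. degree P \<le> p \<and> (\<forall>t. f (e (\<phi>(i := t))) = poly P t)" by metis
      qed
      show "\<forall>\<phi>\<in>T. \<bar>f (e \<phi>)\<bar> \<le> B" using bd by (simp add: T_def)
      show "\<forall>i\<in>Basis. \<bar>restrict (\<lambda>i. x \<bullet> i) Basis i - a \<bullet> i\<bar> \<le> M * (b \<bullet> i - a \<bullet> i)" using x by simp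
    qed (use ab T in simp_all)
    moreover have "e (restrict (\<lambda>i. x \<bullet> i) Basis) = x"
      by (rule euclidean_eqI) (simp add: e_inner)
    ultimately show "\<bar>f x\<bar> \<le> C * B" by simp
  qed
qed

text \<open>The class \<open>P\<close> of functions is an argument because it fixes the dimension.\<close>

definition remez_constant :: "(real^'d::finite \<Rightarrow> real) set \<Rightarrow> real \<Rightarrow> real \<Rightarrow> real \<Rightarrow> bool" where
  "remez_constant P \<theta> M C \<longleftrightarrow> 0 < C \<and> (\<forall>f\<in>P. \<forall>a b S B x.
     (\<forall>l. a $ l < b $ l) \<and> S \<in> sets borel \<and> S \<subseteq> box a b \<and>
     \<theta> * measure lborel (box a b) \<le> measure lborel S \<and> (\<forall>x\<in>S. \<bar>f x\<bar> \<le> B) \<and>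
     (\<forall>l. \<bar>x $ l - a $ l\<bar> \<le> M * (b $ l - a $ l)) \<longrightarrow> \<bar>f x\<bar> \<le> C * B)"

lemma remez_constantD:
  assumes "remez_constant P \<theta> M C" "f \<in> P" "\<And>l. a $ l < b $ l" "S \<in> sets borel" "S \<subseteq> box a b"
    and "\<theta> * measure lborel (box a b) \<le> measure lborel S" "\<And>x. x \<in> S \<Longrightarrow> \<bar>f x\<bar> \<le> B"
    and "\<And>l. \<bar>x $ l - a $ l\<bar> \<le> M * (b $ l - a $ l)"
  shows "\<bar>f x\<bar> \<le> C * B"
proof -
  have "\<forall>a b S B x. (\<forall>l. a $ l < b $ l) \<and> S \<in> sets borel \<and> S \<subseteq> box a b \<and>
     \<theta> * measure lborel (box a b) \<le> measure lborel S \<and> (\<forall>x\<in>S. \<bar>f x\<bar> \<le> B) \<and>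
     (\<forall>l. \<bar>x $ l - a $ l\<bar> \<le> M * (b $ l - a $ l)) \<longrightarrow> \<bar>f x\<bar> \<le> C * B"
    by (rule bspec[OF conjunct2[OF assms(1)[unfolded remez_constant_def]] assms(2)])
  then show ?thesis
    by (elim allE[of _ a] allE[of _ b] allE[of _ S] allE[of _ B] allE[of _ x] mp) (intro conjI allI ballI assms)
qed

lemma ex_remez_constant:
  assumes M: "0 \<le> M" and \<theta>: "0 < \<theta>"
  shows "\<exists>C. remez_constant {f :: real^'d::finite \<Rightarrow> real. coordinatewise_poly p f} \<theta> M C"
proof (rule remez_euclidean[OF M \<theta>, where p=p])
  fix C assume C: "C > 0" and R: "\<And>a b S f B (x :: real^'d). (\<And>i. i \<in> Basis \<Longrightarrow> a \<bullet> i < b \<bullet> i) \<Longrightarrow>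
      S \<in> sets borel \<Longrightarrow> S \<subseteq> cbox a b \<Longrightarrow> \<theta> * measure lborel (cbox a b) \<le> measure lborel S \<Longrightarrow>
      coordinatewise_poly p f \<Longrightarrow> (\<And>x. x \<in> S \<Longrightarrow> \<bar>f x\<bar> \<le> B) \<Longrightarrow>
      (\<And>i. i \<in> Basis \<Longrightarrow> \<bar>x \<bullet> i - a \<bullet> i\<bar> \<le> M * (b \<bullet> i - a \<bullet> i)) \<Longrightarrow> \<bar>f x\<bar> \<le> C * B"
  have "remez_constant {f :: real^'d \<Rightarrow> real. coordinatewise_poly p f} \<theta> M C"
    unfolding remez_constant_def
  proof (intro conjI C ballI allI impI; elim conjE)
    fix f :: "real^'d \<Rightarrow> real" and a b x :: "real^'d" and S B
    assume f: "f \<in> {f. coordinatewise_poly p f}" and lt: "\<forall>l. a $ l < b $ l"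
      and S: "S \<in> sets borel" "S \<subseteq> box a b"
      and big: "\<theta> * measure lborel (box a b) \<le> measure lborel S"
      and bd: "\<forall>x\<in>S. \<bar>f x\<bar> \<le> B" and x: "\<forall>l. \<bar>x $ l - a $ l\<bar> \<le> M * (b $ l - a $ l)"
    show "\<bar>f x\<bar> \<le> C * B"
    proof (rule R[OF _ S(1)])
      show "S \<subseteq> cbox a b" using S(2) box_subset_cbox by blast
      have "measure lborel (cbox a b) = measure lborel (box a b)"
        by (simp add: measure_lborel_box_eq measure_lborel_cbox_eq)
      then show "\<theta> * measure lborel (cbox a b) \<le> measure lborel S" using big by simp
      show "coordinatewise_poly p f" using f by simp
      show "\<bar>f x\<bar> \<le> B" if "x \<in> S" for x using bd that by blast
      show "a \<bullet> i < b \<bullet> i" "\<bar>x \<bullet> i - a \<bullet> i\<bar> \<le> M * (b \<bullet> i - a \<bullet> i)" if "i \<in> Basis" for i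
        using that lt x by (auto simp: Basis_vec_def inner_axis)
    qed
  qed
  then show ?thesis ..
qed

section \<open>Splines on mesh elements\<close>

lemma coordinatewise_poly_0: "coordinatewise_poly p (\<lambda>x. 0)"
  unfolding coordinatewise_poly_def by (auto intro!: exI[of _ 0])

lemma coordinatewise_poly_lincomb:
  assumes "coordinatewise_poly p f" "coordinatewise_poly p g"
  shows "coordinatewise_poly p (\<lambda>x. c * f x + d * g x)"
  unfolding coordinatewise_poly_def
proof (intro ballI allI)
  fix i x :: 'a assume i: "i \<in> Basis"
  obtain P where P: "degree P \<le> p" "\<And>t. f (x + t *\<^sub>R i) = poly P t"
    using assms(1) i unfolding coordinatewise_poly_def by meson
  obtain Q where Q: "degree Q \<le> p" "\<And>t. g (x + t *\<^sub>R i) = poly Q t"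
    using assms(2) i unfolding coordinatewise_poly_def by meson
  show "\<exists>P. degree P \<le> p \<and> (\<forall>t. c * f (x + t *\<^sub>R i) + d * g (x + t *\<^sub>R i) = poly P t)"
    using P Q by (intro exI[of _ "smult c P + smult d Q"])
      (auto intro!: degree_add_le order_trans[OF degree_smult_le])
qed

lemma coordinatewise_poly_prod:
  fixes P :: "'d::finite \<Rightarrow> real poly"
  assumes "\<And>l. degree (P l) \<le> p"
  shows "coordinatewise_poly p (\<lambda>x :: real^'d. \<Prod>l\<in>UNIV. poly (P l) (x $ l))"
  unfolding coordinatewise_poly_def
proof (intro ballI allI)
  fix i x :: "real^'d" assume "i \<in> Basis"
  then obtain m where i: "i = axis m 1" by (auto simp: Basis_vec_def)
  let ?c = "\<Prod>l\<in>UNIV - {m}. poly (P l) (x $ l)"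
  have "(\<Prod>l\<in>UNIV. poly (P l) ((x + t *\<^sub>R i) $ l)) = poly (smult ?c (P m \<circ>\<^sub>p [:x $ m, 1:])) t" for t
  proof -
    have "(\<Prod>l\<in>UNIV. poly (P l) ((x + t *\<^sub>R i) $ l))
        = poly (P m) (x $ m + t) * (\<Prod>l\<in>UNIV - {m}. poly (P l) ((x + t *\<^sub>R i) $ l))"
      by (subst prod.remove[of _ m]) (auto simp: i axis_def)
    also have "(\<Prod>l\<in>UNIV - {m}. poly (P l) ((x + t *\<^sub>R i) $ l)) = ?c"
      by (intro prod.cong) (auto simp: i axis_def)
    finally show ?thesis by (simp add: poly_pcompose)
  qed
  moreover have "degree (smult ?c (P m \<circ>\<^sub>p [:x $ m, 1:])) \<le> p"
    using assms[of m] by (auto intro!: order_trans[OF degree_smult_le] order_trans[OF degree_pcompose_le])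
  ultimately show "\<exists>R. degree R \<le> p \<and> (\<forall>t. (\<Prod>l\<in>UNIV. poly (P l) ((x + t *\<^sub>R i) $ l)) = poly R t)"
    by blast
qed

text \<open>The Remez inequality will be applied to the partial derivatives \<open>r l\<close>; the
  predicate therefore keeps the derivative of \<open>q\<close> together with the degree bound that
  each partial derivative inherits.\<close>

definition poly_with_partials ::
    "nat \<Rightarrow> (real^'d::finite \<Rightarrow> real) \<Rightarrow> ('d \<Rightarrow> real^'d \<Rightarrow> real) \<Rightarrow> bool" where
  "poly_with_partials p q r \<longleftrightarrow> coordinatewise_poly p q \<and>
     (\<forall>l. coordinatewise_poly p (r l) \<and> continuous_on UNIV (r l)) \<and>
     (\<forall>x. (q has_derivative (\<lambda>h. \<Sum>l\<in>UNIV. h $ l * r l x)) (at x))"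

lemma poly_with_partials_prod:
  fixes P :: "'d::finite \<Rightarrow> real poly"
  assumes "\<And>l. degree (P l) \<le> p"
  shows "\<exists>r. poly_with_partials p (\<lambda>x. \<Prod>l\<in>UNIV. poly (P l) (x $ l)) r"
proof -
  \<comment> \<open>Differentiating only factor \<open>l\<close> while keeping the shape of a
    product lets \<open>coordinatewise_poly_prod\<close> apply to the partial derivative as
    well.\<close>
  define r where "r l x = (\<Prod>j\<in>UNIV. poly ((P(l := pderiv (P l))) j) (x $ j))" for l and x :: "real^'d"
  have "degree ((P(l := pderiv (P l))) j) \<le> p" for l j
    using assms[of j] by (auto simp: degree_pderiv)
  then have "coordinatewise_poly p (r l)" for l
    unfolding r_def by (rule coordinatewise_poly_prod)
  moreover have "continuous_on UNIV (r l)" for l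
    unfolding r_def by (intro continuous_intros)
  moreover have "((\<lambda>x. \<Prod>l\<in>UNIV. poly (P l) (x $ l)) has_derivative (\<lambda>h. \<Sum>l\<in>UNIV. h $ l * r l x)) (at x)" for x
  proof -
    have "((\<lambda>x. poly (P l) (x $ l)) has_derivative (\<lambda>h. h $ l * poly (pderiv (P l)) (x $ l))) (at x)" for l
      by (rule has_derivative_compose[where f="\<lambda>x. x $ l" and g="poly (P l)", OF bounded_linear_imp_has_derivative[OF bounded_linear_vec_nth], THEN has_derivative_eq_rhs])
         (auto intro: poly_DERIV[unfolded has_field_derivative_def] simp: fun_eq_iff mult.commute)
    then have "((\<lambda>x. \<Prod>l\<in>UNIV. poly (P l) (x $ l)) has_derivative
        (\<lambda>h. \<Sum>l\<in>UNIV. h $ l * poly (pderiv (P l)) (x $ l) * (\<Prod>j\<in>UNIV - {l}. poly (P j) (x $ j)))) (at x)"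
      by (intro has_derivative_prod)
    moreover have "r l x = poly (pderiv (P l)) (x $ l) * (\<Prod>j\<in>UNIV - {l}. poly (P j) (x $ j))" for l
      unfolding r_def by (subst prod.remove[of _ l]) (auto intro!: prod.cong)
    ultimately show ?thesis by (simp add: mult.assoc)
  qed
  ultimately show ?thesis
    unfolding poly_with_partials_def
    by (intro exI[of _ r] conjI allI coordinatewise_poly_prod assms) assumption+
qed

lemma poly_with_partials_lincomb:
  assumes "poly_with_partials p q r" "poly_with_partials p q' r'"
  shows "poly_with_partials p (\<lambda>x. c * q x + d * q' x) (\<lambda>l x. c * r l x + d * r' l x)"
proof -
  have "((\<lambda>x. c * q x + d * q' x) has_derivative
      (\<lambda>h. c * (\<Sum>l\<in>UNIV. h $ l * r l x) + d * (\<Sum>l\<in>UNIV. h $ l * r' l x))) (at x)" for x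
    using assms unfolding poly_with_partials_def
    by (intro has_derivative_add has_derivative_mult_right) blast+
  then have "((\<lambda>x. c * q x + d * q' x) has_derivative
      (\<lambda>h. \<Sum>l\<in>UNIV. h $ l * (c * r l x + d * r' l x))) (at x)" for x
    by (simp add: sum_distrib_left sum.distrib[symmetric] algebra_simps)
  then show ?thesis
    using assms unfolding poly_with_partials_def
    by (auto intro!: coordinatewise_poly_lincomb continuous_intros)
qed

lemma poly_with_partials_0: "poly_with_partials p (\<lambda>x. 0) (\<lambda>l x. 0)"
  unfolding poly_with_partials_def by (auto simp: coordinatewise_poly_0)

lemma poly_with_partials_sum:
  assumes "\<And>a. a \<in> A \<Longrightarrow> \<exists>r. poly_with_partials p (f a) r"
  shows "\<exists>r. poly_with_partials p (\<lambda>x. \<Sum>a\<in>A. c a * f a x) r"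
  using assms
proof (induction A rule: infinite_finite_induct)
  case (insert a A)
  then obtain r r' where r: "poly_with_partials p (f a) r"
    "poly_with_partials p (\<lambda>x. \<Sum>a\<in>A. c a * f a x) r'" by (meson insertI1 insertI2)
  have "(\<lambda>x. \<Sum>a\<in>insert a A. c a * f a x) = (\<lambda>x. c a * f a x + 1 * (\<Sum>a\<in>A. c a * f a x))"
    using insert.hyps by simp
  then show ?case using poly_with_partials_lincomb[OF r, of "c a" 1] by auto
qed (auto intro: poly_with_partials_0)

lemma tensor_polys_partials:
  fixes q :: "real^'d::finite \<Rightarrow> real"
  assumes "q \<in> tensor_polys p"
  shows "\<exists>r. poly_with_partials p q r"
proof -
  obtain c where q: "q = (\<lambda>\<zeta>. \<Sum>a | \<forall>l. a l \<le> p. c a * (\<Prod>l\<in>UNIV. (\<zeta> $ l) ^ a l))"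
    using assms unfolding tensor_polys_def by blast
  show ?thesis unfolding q
  proof (rule poly_with_partials_sum)
    fix a :: "'d \<Rightarrow> nat" assume "a \<in> {a. \<forall>l. a l \<le> p}"
    then show "\<exists>r. poly_with_partials p (\<lambda>\<zeta>. \<Prod>l\<in>UNIV. (\<zeta> $ l) ^ a l) r"
      using poly_with_partials_prod[of "\<lambda>l. monom 1 (a l)" p] by (simp add: degree_monom_eq poly_monom)
  qed
qed

lemma tensor_polys_lincomb:
  assumes "\<And>i. i \<in> A \<Longrightarrow> f i \<in> tensor_polys p"
  shows "(\<lambda>x. \<Sum>i\<in>A. k i * f i x) \<in> tensor_polys p"
proof -
  let ?m = "\<lambda>\<zeta> a. \<Prod>l\<in>UNIV. (\<zeta> $ l) ^ a l :: real"
  have "\<forall>i\<in>A. \<exists>c. f i = (\<lambda>\<zeta>. \<Sum>a | \<forall>l. a l \<le> p. c a * ?m \<zeta> a)"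
    using assms unfolding tensor_polys_def by blast
  then obtain c where c: "\<And>i. i \<in> A \<Longrightarrow> f i = (\<lambda>\<zeta>. \<Sum>a | \<forall>l. a l \<le> p. c i a * ?m \<zeta> a)"
    by (auto dest: bchoice)
  have "(\<Sum>i\<in>A. k i * f i \<zeta>) = (\<Sum>a | \<forall>l. a l \<le> p. (\<Sum>i\<in>A. k i * c i a) * ?m \<zeta> a)" for \<zeta>
  proof -
    have "(\<Sum>i\<in>A. k i * f i \<zeta>) = (\<Sum>i\<in>A. \<Sum>a | \<forall>l. a l \<le> p. k i * c i a * ?m \<zeta> a)"
      by (intro sum.cong refl) (simp add: c sum_distrib_left mult.assoc)
    also have "\<dots> = (\<Sum>a | \<forall>l. a l \<le> p. \<Sum>i\<in>A. k i * c i a * ?m \<zeta> a)" by (rule sum.swap)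
    finally show ?thesis by (simp add: sum_distrib_right)
  qed
  then show ?thesis
    unfolding tensor_polys_def mem_Collect_eq by (intro exI[of _ "\<lambda>a. \<Sum>i\<in>A. k i * c i a"]) auto
qed

lemma tensor_polys_diff:
  assumes "f \<in> tensor_polys p" "g \<in> tensor_polys p"
  shows "(\<lambda>x. f x - g x) \<in> tensor_polys p"
  using tensor_polys_lincomb[of UNIV "\<lambda>b. if b then f else g" p "\<lambda>b. if b then 1 else - 1"] assms
  by (simp add: UNIV_bool)

lemma tensor_polys_prod:
  fixes P :: "'d::finite \<Rightarrow> real poly"
  assumes "\<And>l. degree (P l) \<le> p"
  shows "(\<lambda>x. \<Prod>l\<in>UNIV. poly (P l) (x $ l)) \<in> tensor_polys p"
proof -
  have "(\<Prod>l\<in>UNIV. poly (P l) (x $ l))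
      = (\<Sum>a | \<forall>l. a l \<le> p. (\<Prod>l\<in>UNIV. coeff (P l) (a l)) * (\<Prod>l\<in>UNIV. (x $ l) ^ a l))" for x :: "real^'d"
  proof -
    have "poly (P l) (x $ l) = (\<Sum>k\<in>{..p}. coeff (P l) k * (x $ l) ^ k)" for l
      by (subst poly_as_sum_of_monoms'[OF assms, symmetric]) (simp add: poly_sum poly_monom)
    then have "(\<Prod>l\<in>UNIV. poly (P l) (x $ l)) = (\<Prod>l\<in>UNIV. \<Sum>k\<in>{..p}. coeff (P l) k * (x $ l) ^ k)" by simp
    also have "\<dots> = (\<Sum>a\<in>PiE UNIV (\<lambda>_. {..p}). \<Prod>l\<in>UNIV. coeff (P l) (a l) * (x $ l) ^ a l)"
      by (rule prod_sum_PiE) auto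
    also have "PiE UNIV (\<lambda>_::'d. {..p}) = {a. \<forall>l. a l \<le> p}" by (auto simp: PiE_iff)
    finally show ?thesis by (simp add: prod.distrib)
  qed
  then show ?thesis
    unfolding tensor_polys_def mem_Collect_eq by (intro exI[of _ "\<lambda>a. \<Prod>l\<in>UNIV. coeff (P l) (a l)"]) auto
qed

text \<open>No knot lies inside the span, so each one is at most \<open>a\<close> or at least
  \<open>b\<close>, and the degree-0 functions are constant there; \<open>b \<le> 1\<close> keeps
  \<open>t\<close> off the closing clause \<open>t = 1\<close>. Each recursion step then multiplies
  by affine factors.\<close>

lemma bspline_poly_on_span:
  assumes "a < b" "b \<le> 1" "set \<Xi> \<inter> {a<..<b} = {}" "i + p + 1 < length \<Xi>"
  shows "\<exists>P. degree P \<le> p \<and> (\<forall>t\<in>{a<..<b}. bspline p \<Xi> i t = poly P t)"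
  using assms(4)
proof (induction p arbitrary: i)
  case 0
  have k: "\<Xi> ! j \<le> a \<or> b \<le> \<Xi> ! j" if "j < length \<Xi>" for j
    using assms(3) nth_mem[OF that] by force
  have "bspline 0 \<Xi> i t = (if \<Xi> ! i \<le> a \<and> b \<le> \<Xi> ! (i + 1) then 1 else 0)" if t: "t \<in> {a<..<b}" for t
    using k[of i] k[of "i + 1"] 0 t assms(1,2) by auto
  then show ?case
    by (intro exI[of _ "[:if \<Xi> ! i \<le> a \<and> b \<le> \<Xi> ! (i + 1) then 1 else 0:]"]) auto
next
  case (Suc p)
  obtain P where P: "degree P \<le> p" "\<forall>t\<in>{a<..<b}. bspline p \<Xi> i t = poly P t"
    using Suc.IH[of i] Suc.prems by auto
  obtain Q where Q: "degree Q \<le> p" "\<forall>t\<in>{a<..<b}. bspline p \<Xi> (i + 1) t = poly Q t"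
    using Suc.IH[of "i + 1"] Suc.prems by auto
  \<comment> \<open>A vanishing knot difference makes the quotient 0 in \<open>bspline\<close> and
    the coefficient 0 in \<open>smult\<close> alike, so repeated knots cause no case
    distinction.\<close>
  let ?R = "smult (1 / (\<Xi> ! (i + p + 1) - \<Xi> ! i)) ([:- \<Xi> ! i, 1:] * P)
    + smult (1 / (\<Xi> ! (i + p + 2) - \<Xi> ! (i + 1))) ([:\<Xi> ! (i + p + 2), -1:] * Q)"
  have "degree (u * v) \<le> Suc p" if "degree u \<le> 1" "degree v \<le> p" for u v :: "real poly"
    using degree_mult_le[of u v] that by linarith
  then have "degree ?R \<le> Suc p"
    using P(1) Q(1) by (intro degree_add_le order_trans[OF degree_smult_le])
      (auto simp del: mult_pCons_left)
  moreover have "bspline (Suc p) \<Xi> i t = poly ?R t" if "t \<in> {a<..<b}" for t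
    unfolding bspline.simps bspec[OF P(2) that] bspec[OF Q(2) that] by (simp add: divide_inverse algebra_simps)
  ultimately show ?case by blast
qed

lemma spline_tensor_poly_on_element:
  fixes \<Xi> :: "'d::finite \<Rightarrow> real list"
  assumes \<Xi>: "\<forall>l. open_knot_vector p (\<Xi> l)" and s: "s \<in> spline_space p \<Xi>" and Q: "Q \<in> param_mesh \<Xi>"
  shows "\<exists>q\<in>tensor_polys p. \<forall>\<zeta>\<in>Q. s \<zeta> = q \<zeta>"
proof -
  obtain a b where ab: "Q = box a b" "\<And>l. b $ l \<in> set (\<Xi> l)" "\<And>l. a $ l < b $ l"
      "\<And>l. set (\<Xi> l) \<inter> {a $ l <..< b $ l} = {}"
    using Q unfolding param_mesh_def by blast
  have b1: "b $ l \<le> 1" for l using ab(2)[of l] \<Xi> unfolding open_knot_vector_def by fastforce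
  obtain c where c: "s = (\<lambda>\<zeta>. \<Sum>i | \<forall>l. i l < num_bsplines p (\<Xi> l). c i * tensor_bspline p \<Xi> i \<zeta>)"
    using s unfolding spline_space_def by blast
  have "\<exists>P. degree P \<le> p \<and> (\<forall>t\<in>{a $ l<..<b $ l}. bspline p (\<Xi> l) j t = poly P t)"
    if "j < num_bsplines p (\<Xi> l)" for j l
    using that ab(3,4) b1 by (intro bspline_poly_on_span) (auto simp: num_bsplines_def)
  then obtain P where P: "\<And>j l. j < num_bsplines p (\<Xi> l) \<Longrightarrow> degree (P j l) \<le> p"
     "\<And>j l t. j < num_bsplines p (\<Xi> l) \<Longrightarrow> t \<in> {a $ l<..<b $ l} \<Longrightarrow> bspline p (\<Xi> l) j t = poly (P j l) t"
    by metis
  define q where "q \<zeta> = (\<Sum>i | \<forall>l. i l < num_bsplines p (\<Xi> l). c i * (\<Prod>l\<in>UNIV. poly (P (i l) l) (\<zeta> $ l)))" for \<zeta>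
  have "q \<in> tensor_polys p"
    unfolding q_def[abs_def] by (intro tensor_polys_lincomb tensor_polys_prod) (auto intro: P(1))
  moreover have "s \<zeta> = q \<zeta>" if "\<zeta> \<in> Q" for \<zeta>
    unfolding c q_def tensor_bspline_def
    using that P(2) by (intro sum.cong refl arg_cong2[where f="(*)"] prod.cong) (auto simp: ab(1) mem_box_cart)
  ultimately show ?thesis by blast
qed

text \<open>The Remez inequality with \<open>B = 0\<close> acts as an identity theorem.\<close>

lemma coordinatewise_poly_zero:
  fixes f :: "real^'d::finite \<Rightarrow> real"
  assumes f: "coordinatewise_poly p f" and S: "open S" "S \<noteq> {}" and z: "\<And>x. x \<in> S \<Longrightarrow> f x = 0"
  shows "f x = 0"
proof -
  obtain y where "y \<in> S" using S by blast
  then obtain a b where ab: "y \<in> box a b" "box a b \<subseteq> S" using open_contains_box[OF S(1)] by metis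
  have lt: "a $ l < b $ l" for l using ab(1) unfolding mem_box_cart by (meson less_trans)
  \<comment> \<open>Any dilation factor that reaches \<open>x\<close> will do; the sum dominates the
    quotient of every coordinate.\<close>
  define M where "M = (\<Sum>l\<in>UNIV. \<bar>x $ l - a $ l\<bar> / (b $ l - a $ l))"
  have M: "M \<ge> 0" unfolding M_def using lt by (intro sum_nonneg divide_nonneg_pos) auto
  obtain C where R: "remez_constant {f :: real^'d \<Rightarrow> real. coordinatewise_poly p f} 1 M C"
    using ex_remez_constant[OF M zero_less_one] by blast
  have "\<bar>f x\<bar> \<le> C * 0"
  proof (rule remez_constantD[OF R _ lt])
    show "\<bar>x $ l - a $ l\<bar> \<le> M * (b $ l - a $ l)" for l
    proof -
      have "\<bar>x $ l - a $ l\<bar> / (b $ l - a $ l) \<le> M"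
        unfolding M_def using lt by (intro member_le_sum divide_nonneg_pos) auto
      then show ?thesis using lt[of l] by (simp add: field_simps)
    qed
    show "\<bar>f y\<bar> \<le> 0" if "y \<in> box a b" for y using z ab(2) that by auto
  qed (use f in auto)
  then show ?thesis by simp
qed

text \<open>This uniqueness gives the definite description in \<open>local_poly\<close> its
  meaning.\<close>

lemma tensor_polys_eqI:
  assumes "q \<in> tensor_polys p" "q' \<in> tensor_polys p" and S: "open S" "S \<noteq> {}"
    and eq: "\<And>x. x \<in> S \<Longrightarrow> q x = q' x"
  shows "q = q'"
proof
  fix x
  have "coordinatewise_poly p (\<lambda>x. q x - q' x)"
    using tensor_polys_partials[OF tensor_polys_diff[OF assms(1,2)]] by (auto simp: poly_with_partials_def)
  from coordinatewise_poly_zero[OF this S, of x] eq show "q x = q' x" by simp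
qed

section \<open>Lipschitz maps and gradients\<close>

text \<open>A volume bound without differentiability: \<open>T\<close> is covered by almost disjoint
  cubes inside an open superset \<open>U\<close>, the part of \<open>T\<close> in a cube of side
  \<open>s\<close> is mapped into a ball of radius \<open>L * DIM('a) * s\<close>, and outer
  regularity shrinks \<open>U\<close> to \<open>T\<close>. The constant is the volume of such a ball
  relative to its cube.\<close>

lemma emeasure_lipschitz_image:
  fixes f :: "'a::euclidean_space \<Rightarrow> 'a"
  assumes L: "L-lipschitz_on T f" and T: "T \<in> sets borel" "bounded T" and fT: "f ` T \<in> sets borel"
  shows "emeasure lborel (f ` T)
    \<le> ennreal (unit_ball_vol (real DIM('a)) * (L * real DIM('a)) ^ DIM('a)) * emeasure lborel T"
    (is "_ \<le> ennreal ?C * _")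
proof -
  have L0: "L \<ge> 0" using L by (rule lipschitz_on_nonneg)
  have C0: "?C \<ge> 0" using L0 by auto
  obtain r where r: "r > 0" "T \<subseteq> ball 0 r" using bounded_subset_ballD[OF T(2)] by blast
  \<comment> \<open>The enclosing box is a cube, so the dyadic cells of the covering lemma are cubes
    too, with equal sides \<open>2 * r / 2^k\<close>.\<close>
  define c :: 'a where "c = (\<Sum>i\<in>Basis. r *\<^sub>R i)"
  have ci: "c \<bullet> i = r" if "i \<in> Basis" for i using that by (simp add: c_def)
  have Tc: "T \<subseteq> cbox (- c) c"
  proof
    fix x assume "x \<in> T"
    then have "norm x < r" using r by auto
    then have "\<bar>x \<bullet> i\<bar> \<le> r" if "i \<in> Basis" for i using Basis_le_norm[OF that, of x] by linarith
    then show "x \<in> cbox (- c) c" by (force simp: mem_box ci abs_le_iff)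
  qed
  have main: "emeasure lborel (f ` T) \<le> ennreal ?C * emeasure lborel U" if U: "open U" "T \<subseteq> U" for U
  proof -
    \<comment> \<open>This gauge forces every covering cube into \<open>U\<close>, because the tag
      of the cube belongs to \<open>T\<close> and hence to \<open>U\<close>.\<close>
    have "gauge (\<lambda>x. if x \<in> U then U else UNIV)" using U by (auto simp: gauge_def)
    moreover have "box (- c) c \<noteq> {}" using r(1) by (auto simp: box_ne_empty ci)
    ultimately obtain \<D> where D: "countable \<D>" "\<Union>\<D> \<subseteq> cbox (- c) c"
      "\<And>K. K \<in> \<D> \<Longrightarrow> interior K \<noteq> {} \<and> (\<exists>c d. K = cbox c d)"
      "pairwise (\<lambda>A B. interior A \<inter> interior B = {}) \<D>"
      "\<And>K. K \<in> \<D> \<Longrightarrow> \<exists>x \<in> T \<inter> K. K \<subseteq> (if x \<in> U then U else UNIV)"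
      "\<And>u v. cbox u v \<in> \<D> \<Longrightarrow> \<exists>n. \<forall>i \<in> Basis. v \<bullet> i - u \<bullet> i = (c \<bullet> i - (- c) \<bullet> i) / 2^n"
      "T \<subseteq> \<Union>\<D>"
      using covering_lemma[OF Tc, of "\<lambda>x. if x \<in> U then U else UNIV"] by metis
    define J where "J = to_nat_on \<D> ` \<D>"
    define E where "E n = (if n \<in> J then from_nat_into \<D> n else {})" for n
    have E_in: "E n = {} \<or> E n \<in> \<D>" for n
      using D(1) by (auto simp: E_def J_def)
    have E_ex: "\<exists>n. E n = K" if "K \<in> \<D>" for K
      using that D(1) by (intro exI[of _ "to_nat_on \<D> K"]) (auto simp: E_def J_def)
    have disj: "disjoint_family (\<lambda>n. interior (E n))"
      unfolding disjoint_family_on_def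
    proof (intro ballI impI)
      fix m n :: nat assume mn: "m \<noteq> n"
      show "interior (E m) \<inter> interior (E n) = {}"
      proof (cases "m \<in> J \<and> n \<in> J")
        case True
        then have "E m \<in> \<D>" "E n \<in> \<D>" "E m \<noteq> E n"
          using D(1) mn by (auto simp: E_def J_def)
        then show ?thesis using D(4) by (auto simp: pairwise_def)
      qed (auto simp: E_def)
    qed
    have ESub: "interior (E n) \<subseteq> U" for n
    proof (cases "E n = {}")
      case False
      then obtain x where "x \<in> T" "E n \<subseteq> (if x \<in> U then U else UNIV)" using D(5) E_in by blast
      then show ?thesis using U(2) interior_subset by fastforce
    qed auto
    have "\<exists>B. f ` (T \<inter> E n) \<subseteq> B \<and> B \<in> sets borel \<and> emeasure lborel B \<le> ennreal ?C * emeasure lborel (interior (E n))" for n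
    proof (cases "E n = {}")
      case False
      then have En: "E n \<in> \<D>" using E_in by auto
      then obtain u v where uv: "E n = cbox u v" using D(3) by blast
      then obtain k where k: "\<And>i. i \<in> Basis \<Longrightarrow> v \<bullet> i - u \<bullet> i = (c \<bullet> i - (- c) \<bullet> i) / 2^k"
        using D(6) En by metis
      define s where "s = 2 * r / 2^k"
      have s: "s > 0" using r(1) by (simp add: s_def)
      have vu: "v \<bullet> i - u \<bullet> i = s" if "i \<in> Basis" for i using k[OF that] ci[OF that] by (simp add: s_def)
      obtain x where x: "x \<in> T" "x \<in> cbox u v" using D(5)[OF En] uv by auto
      have dist: "dist x y \<le> real DIM('a) * s" if "y \<in> cbox u v" for y
      proof -
        have "dist x y \<le> (\<Sum>i\<in>Basis. \<bar>(x - y) \<bullet> i\<bar>)" unfolding dist_norm by (rule norm_le_l1)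
        also have "\<dots> \<le> (\<Sum>i\<in>(Basis::'a set). s)"
        proof (rule sum_mono)
          fix i :: 'a assume i: "i \<in> Basis"
          then have "u \<bullet> i \<le> x \<bullet> i" "x \<bullet> i \<le> v \<bullet> i" "u \<bullet> i \<le> y \<bullet> i" "y \<bullet> i \<le> v \<bullet> i"
            using x(2) that by (auto simp: mem_box)
          then show "\<bar>(x - y) \<bullet> i\<bar> \<le> s" using vu[OF i] by (simp add: inner_diff_left)
        qed
        finally show ?thesis by simp
      qed
      let ?B = "cball (f x) (L * (real DIM('a) * s))"
      have "f ` (T \<inter> E n) \<subseteq> ?B"
      proof clarify
        fix y assume y: "y \<in> T" "y \<in> E n"
        have "dist (f x) (f y) \<le> L * dist x y" using lipschitz_onD[OF L x(1) y(1)] .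
        also have "\<dots> \<le> L * (real DIM('a) * s)" using dist y uv L0 by (intro mult_left_mono) auto
        finally show "f y \<in> ?B" by simp
      qed
      moreover have "emeasure lborel ?B = ennreal (unit_ball_vol (real DIM('a)) * (L * (real DIM('a) * s)) ^ DIM('a))"
        using L0 s by (intro emeasure_cball) auto
      moreover have "emeasure lborel (interior (E n)) = ennreal (s ^ DIM('a))"
      proof -
        have "emeasure lborel (interior (E n)) = ennreal (\<Prod>i\<in>Basis. (v - u) \<bullet> i)"
          unfolding uv interior_cbox
        proof (rule emeasure_lborel_box)
          show "u \<bullet> i \<le> v \<bullet> i" if "i \<in> Basis" for i using vu[OF that] s by linarith
        qed
        also have "(\<Prod>i\<in>Basis. (v - u) \<bullet> i) = (\<Prod>i\<in>(Basis::'a set). s)"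
          using vu by (intro prod.cong) (auto simp: inner_diff_left)
        finally show ?thesis by simp
      qed
      ultimately show ?thesis using C0 s
        by (intro exI[of _ ?B]) (simp add: ennreal_mult[symmetric] power_mult_distrib mult_ac)
    qed (auto intro!: exI[of _ "{}"])
    then obtain B where B: "\<And>n. f ` (T \<inter> E n) \<subseteq> B n" "\<And>n. B n \<in> sets borel"
       "\<And>n. emeasure lborel (B n) \<le> ennreal ?C * emeasure lborel (interior (E n))" by metis
    have "f ` T \<subseteq> (\<Union>n. B n)"
    proof clarify
      fix x assume x: "x \<in> T"
      then obtain K where "K \<in> \<D>" "x \<in> K" using D(7) by blast
      then obtain n where "x \<in> E n" using E_ex by metis
      then show "f x \<in> (\<Union>n. B n)" using B(1)[of n] x by blast
    qed
    then have "emeasure lborel (f ` T) \<le> emeasure lborel (\<Union>n. B n)"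
      using B(2) by (intro emeasure_mono) auto
    also have "\<dots> \<le> (\<Sum>n. emeasure lborel (B n))"
      using B(2) by (intro emeasure_subadditive_countably) auto
    also have "\<dots> \<le> (\<Sum>n. ennreal ?C * emeasure lborel (interior (E n)))"
      by (intro suminf_le B(3)) auto
    also have "\<dots> = ennreal ?C * (\<Sum>n. emeasure lborel (interior (E n)))" by (rule ennreal_suminf_cmult)
    also have "(\<Sum>n. emeasure lborel (interior (E n))) = emeasure lborel (\<Union>n. interior (E n))"
      using disj by (intro suminf_emeasure) auto
    also have "\<dots> \<le> emeasure lborel U" using ESub U(1) by (intro emeasure_mono) auto
    finally show ?thesis by (simp add: mult_left_mono)
  qed
  show ?thesis
  proof (rule ennreal_le_epsilon)
    fix e :: real assume e: "e > 0"
    \<comment> \<open>The tolerance is divided by \<open>?C + 1\<close> because \<open>?C\<close>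
      may be 0.\<close>
    obtain U where U: "open U" "T \<subseteq> U" "emeasure lborel (U - T) < ennreal (e / (?C + 1))"
      using outer_regular_lborel[of T "e / (?C + 1)"] T(1) e C0 by (auto simp: add_nonneg_pos)
    have "emeasure lborel U \<le> emeasure lborel T + emeasure lborel (U - T)"
      using U T(1) by (subst plus_emeasure) (auto intro!: emeasure_mono)
    also have "\<dots> \<le> emeasure lborel T + ennreal (e / (?C + 1))"
      using U(3) by (intro add_left_mono) auto
    finally have "ennreal ?C * emeasure lborel U \<le> ennreal ?C * (emeasure lborel T + ennreal (e / (?C + 1)))"
      by (rule mult_left_mono) simp
    also have "\<dots> = ennreal ?C * emeasure lborel T + ennreal (?C * (e / (?C + 1)))"
      using C0 e by (simp add: distrib_left ennreal_mult[symmetric])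
    also have "\<dots> \<le> ennreal ?C * emeasure lborel T + ennreal e"
    proof (intro add_left_mono ennreal_leI)
      have "?C * e \<le> (?C + 1) * e" using e C0 by (intro mult_right_mono) auto
      then show "?C * (e / (?C + 1)) \<le> e" using C0 e by (simp add: pos_divide_le_eq add_nonneg_pos mult.commute)
    qed
    finally show "emeasure lborel (f ` T) \<le> ennreal ?C * emeasure lborel T + ennreal e"
      using main[OF U(1,2)] by simp
  qed
qed

text \<open>\<open>Ck_on\<close> speaks of derivatives along the axes, whereas the chain rule asks
  for a Frechet derivative. The increment is split into moves along one axis each, and the mean
  value inequality controls each move through the continuity of \<open>g l\<close> at
  \<open>x\<close>.\<close>

lemma has_derivative_partials:
  fixes f :: "real^'n::finite \<Rightarrow> 'b::real_normed_vector"
  assumes U: "open U" "x \<in> U" and cont: "\<And>l. continuous_on U (g l)"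
    and part: "\<And>l y. y \<in> U \<Longrightarrow> ((\<lambda>t. f (y + t *\<^sub>R axis l 1)) has_vector_derivative g l y) (at 0)"
  shows "(f has_derivative (\<lambda>h. \<Sum>l\<in>UNIV. h $ l *\<^sub>R g l x)) (at x)"
  unfolding has_derivative_at_alt
proof (intro conjI allI impI)
  show "bounded_linear (\<lambda>h. \<Sum>l\<in>UNIV. h $ l *\<^sub>R g l x)"
    by (intro bounded_linear_sum bounded_linear_scaleR_const bounded_linear_vec_nth)
  fix e :: real assume e: "e > 0"
  define n where "n = real CARD('n)"
  have n: "n > 0" by (simp add: n_def)
  have "eventually (\<lambda>y. y \<in> U \<and> (\<forall>l\<in>UNIV. dist (g l y) (g l x) < e / n)) (nhds x)"
  proof (intro eventually_conj eventually_ball_finite ballI)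
    show "eventually (\<lambda>y. y \<in> U) (nhds x)" using U by (rule eventually_nhds_in_open)
    fix l
    have "isCont (g l) x" using cont U by (simp add: continuous_on_eq_continuous_at)
    then have "filterlim (g l) (nhds (g l x)) (nhds x)" by (simp add: isCont_def tendsto_at_iff_tendsto_nhds)
    then show "eventually (\<lambda>y. dist (g l y) (g l x) < e / n) (nhds x)"
      by (rule tendstoD) (use e n in simp)
  qed simp
  then obtain \<delta> where \<delta>: "\<delta> > 0" "\<And>y. dist y x < \<delta> \<Longrightarrow> y \<in> U \<and> (\<forall>l. dist (g l y) (g l x) < e / n)"
    unfolding eventually_nhds_metric by auto
  define d where "d = \<delta> / n"
  have d: "d > 0" using \<delta> n by (simp add: d_def)
  \<comment> \<open>A cube instead of a ball: points that mix coordinates of \<open>y\<close> and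
    \<open>z\<close> stay inside. The half side \<open>\<delta> / n\<close> keeps the cube within
    distance \<open>\<delta>\<close> of \<open>x\<close>.\<close>
  define Q where "Q = {y. \<forall>i. \<bar>y $ i - x $ i\<bar> < d}"
  have Q: "y \<in> U \<and> (\<forall>l. norm (g l y - g l x) \<le> e / n)" if "y \<in> Q" for y
  proof -
    have "norm (y - x) \<le> (\<Sum>i\<in>UNIV. \<bar>(y - x) $ i\<bar>)" by (rule norm_le_l1_cart)
    also have "\<dots> < (\<Sum>i\<in>(UNIV::'n set). d)" using that by (intro sum_strict_mono) (auto simp: Q_def)
    also have "\<dots> = \<delta>" using n by (simp add: d_def n_def)
    finally show ?thesis using \<delta>(2)[of y] by (auto simp: dist_norm less_imp_le)
  qed
  have step: "norm (f (w + s *\<^sub>R axis l 1) - f w - s *\<^sub>R g l x) \<le> e / n * \<bar>s\<bar>"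
    if w: "w \<in> Q" "w + s *\<^sub>R axis l 1 \<in> Q" for w s l
  proof -
    \<comment> \<open>With the linear part removed, the derivative of \<open>\<phi>\<close> is the
      deviation of \<open>g l\<close> from its value at \<open>x\<close>, which is at most
      \<open>e / n\<close> on \<open>Q\<close>.\<close>
    define \<phi> where "\<phi> t = f (w + t *\<^sub>R axis l 1) - t *\<^sub>R g l x" for t
    have seg: "w + t *\<^sub>R axis l 1 \<in> Q" if t: "t \<in> closed_segment 0 s" for t
    proof -
      obtain u where u: "t = u * s" "0 \<le> u" "u \<le> 1" using t by (auto simp: in_segment)
      have "\<bar>w $ l + t - x $ l\<bar> < d"
      proof -
        have 1: "\<bar>w $ l - x $ l\<bar> < d" using w(1) by (simp add: Q_def)
        have 2: "\<bar>w $ l + s - x $ l\<bar> < d" using w(2) by (auto simp: Q_def axis_def dest!: spec[of _ l])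
        have "w $ l + t - x $ l = (1 - u) * (w $ l - x $ l) + u * (w $ l + s - x $ l)"
          unfolding u by (simp add: algebra_simps)
        also have "\<bar>\<dots>\<bar> \<le> (1 - u) * \<bar>w $ l - x $ l\<bar> + u * \<bar>w $ l + s - x $ l\<bar>"
          using u by (intro order_trans[OF abs_triangle_ineq]) (simp add: abs_mult)
        also have "\<dots> < d" using convex_bound_lt[OF 1 2, of "1 - u" u] u by simp
        finally show ?thesis .
      qed
      then show ?thesis using w(1) by (auto simp: Q_def axis_def)
    qed
    have der: "(\<phi> has_derivative (\<lambda>h. h *\<^sub>R (g l (w + t *\<^sub>R axis l 1) - g l x))) (at t within closed_segment 0 s)"
      if t: "t \<in> closed_segment 0 s" for t
    proof -
      let ?y = "w + t *\<^sub>R axis l 1"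
      have "((\<lambda>\<tau>. f (?y + \<tau> *\<^sub>R axis l 1)) has_derivative (\<lambda>h. h *\<^sub>R g l ?y)) (at (t - t))"
        using part[of ?y l] Q[OF seg[OF t]] by (simp add: has_vector_derivative_def)
      then have "((\<lambda>\<tau>. f (?y + (\<tau> - t) *\<^sub>R axis l 1)) has_derivative (\<lambda>h. h *\<^sub>R g l ?y)) (at t)"
        by (intro has_derivative_compose[where f="\<lambda>\<tau>. \<tau> - t" and g="\<lambda>\<tau>. f (?y + \<tau> *\<^sub>R axis l 1)", of "\<lambda>h. h", simplified])
           (auto intro!: derivative_eq_intros)
      then have "((\<lambda>\<tau>. f (w + \<tau> *\<^sub>R axis l 1)) has_derivative (\<lambda>h. h *\<^sub>R g l ?y)) (at t)"
        by (simp add: algebra_simps)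
      then have "(\<phi> has_derivative (\<lambda>h. h *\<^sub>R g l ?y - h *\<^sub>R g l x)) (at t)"
        unfolding \<phi>_def by (intro derivative_intros)
      then show ?thesis by (auto simp: scaleR_diff_right intro: has_derivative_at_withinI)
    qed
    have "norm (\<phi> s - \<phi> 0) \<le> e / n * norm (s - 0)"
    proof (rule differentiable_bound[OF _ der])
      fix t assume t: "t \<in> closed_segment 0 s"
      have "norm (g l (w + t *\<^sub>R axis l 1) - g l x) \<le> e / n" using Q[OF seg[OF t]] by blast
      then show "onorm (\<lambda>h. h *\<^sub>R (g l (w + t *\<^sub>R axis l 1) - g l x)) \<le> e / n"
        using e n by (intro onorm_bound) (auto simp: mult.commute[of "e / n"] simp del: times_divide_eq_left times_divide_eq_right intro!: mult_left_mono)
    qed auto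
    then show ?thesis by (simp add: \<phi>_def algebra_simps)
  qed
  \<comment> \<open>Induction over a set \<open>I\<close> containing all coordinates in which
    \<open>y\<close> and \<open>z\<close> differ; the intermediate point \<open>w\<close> takes
    coordinate \<open>l\<close> from \<open>z\<close>.\<close>
  have claim: "norm (f y - f z - (\<Sum>l\<in>I. (y - z) $ l *\<^sub>R g l x)) \<le> e / n * (\<Sum>l\<in>I. \<bar>(y - z) $ l\<bar>)"
    if "finite I" "y \<in> Q" "z \<in> Q" "\<forall>i. i \<notin> I \<longrightarrow> y $ i = z $ i" for I y z
    using that
  proof (induction I arbitrary: y rule: finite_induct)
    case empty
    then have "y = z" by (simp add: vec_eq_iff)
    then show ?case by simp
  next
    case (insert l I)
    define w where "w = (\<chi> i. if i = l then z $ l else y $ i)"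
    define s where "s = (y - z) $ l"
    have y: "y = w + s *\<^sub>R axis l 1" by (auto simp: vec_eq_iff w_def s_def axis_def)
    have wQ: "w \<in> Q" using insert.prems by (auto simp: Q_def w_def)
    have IH: "norm (f w - f z - (\<Sum>l\<in>I. (w - z) $ l *\<^sub>R g l x)) \<le> e / n * (\<Sum>l\<in>I. \<bar>(w - z) $ l\<bar>)"
      using insert.prems by (intro insert.IH wQ) (auto simp: w_def)
    have wy: "(w - z) $ i = (y - z) $ i" if "i \<in> I" for i using that insert.hyps by (auto simp: w_def)
    have S: "(\<Sum>l\<in>I. (w - z) $ l *\<^sub>R g l x) = (\<Sum>l\<in>I. (y - z) $ l *\<^sub>R g l x)"
      "(\<Sum>l\<in>I. \<bar>(w - z) $ l\<bar>) = (\<Sum>l\<in>I. \<bar>(y - z) $ l\<bar>)"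
      using wy by (auto intro!: sum.cong)
    have "f y - f z - (\<Sum>l\<in>insert l I. (y - z) $ l *\<^sub>R g l x)
      = (f y - f w - s *\<^sub>R g l x) + (f w - f z - (\<Sum>l\<in>I. (w - z) $ l *\<^sub>R g l x))"
      unfolding S using insert.hyps by (simp add: s_def)
    also have "norm \<dots> \<le> e / n * \<bar>s\<bar> + e / n * (\<Sum>l\<in>I. \<bar>(w - z) $ l\<bar>)"
      using step[OF wQ, of s l] insert.prems IH y by (intro order_trans[OF norm_triangle_ineq] add_mono) auto
    also have "\<dots> = e / n * (\<Sum>l\<in>insert l I. \<bar>(y - z) $ l\<bar>)"
      unfolding S using insert.hyps by (simp add: s_def distrib_left)
    finally show ?case .
  qed
  show "\<exists>d>0. \<forall>y. norm (y - x) < d \<longrightarrow> norm (f y - f x - (\<Sum>l\<in>UNIV. (y - x) $ l *\<^sub>R g l x)) \<le> e * norm (y - x)"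
  proof (intro exI[of _ d] conjI d allI impI)
    fix y assume y: "norm (y - x) < d"
    then have "y \<in> Q" unfolding Q_def
      using component_le_norm_cart[of "y - x"] by (auto intro: le_less_trans)
    moreover have "x \<in> Q" using d by (simp add: Q_def)
    ultimately have "norm (f y - f x - (\<Sum>l\<in>UNIV. (y - x) $ l *\<^sub>R g l x)) \<le> e / n * (\<Sum>l\<in>UNIV. \<bar>(y - x) $ l\<bar>)"
      by (intro claim) auto
    moreover have "(\<Sum>l\<in>UNIV. \<bar>(y - x) $ l\<bar>) \<le> n * norm (y - x)"
      unfolding n_def by (rule sum_bounded_above) (rule component_le_norm_cart)
    ultimately have "norm (f y - f x - (\<Sum>l\<in>UNIV. (y - x) $ l *\<^sub>R g l x)) \<le> e / n * (n * norm (y - x))"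
      using e n by (meson order_trans mult_left_mono divide_nonneg_pos less_imp_le)
    then show "norm (f y - f x - (\<Sum>l\<in>UNIV. (y - x) $ l *\<^sub>R g l x)) \<le> e * norm (y - x)"
      using n by simp
  qed
qed

section \<open>Gradients under Lipschitz and smooth changes of variables\<close>

lemma grad_component:
  assumes "(f has_derivative D) (at x)"
  shows "grad f x $ l = D (axis l 1)"
  using frechet_derivative_at[OF assms] by (simp add: grad_def)

lemma grad_inner:
  assumes "(f has_derivative D) (at x)"
  shows "D h = grad f x \<bullet> h"
proof -
  interpret D: bounded_linear D using assms by (rule has_derivative_bounded_linear)
  have "h = (\<Sum>l\<in>UNIV. h $ l *\<^sub>R axis l 1)"
    by (simp add: vec_eq_iff axis_def if_distrib cong: if_cong)
  then have "D h = D (\<Sum>l\<in>UNIV. h $ l *\<^sub>R axis l 1)" by simp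
  also have "\<dots> = (\<Sum>l\<in>UNIV. h $ l * D (axis l 1))" by (simp add: D.sum D.scaleR)
  finally have "D h = (\<Sum>l\<in>UNIV. h $ l * D (axis l 1))" .
  then show ?thesis by (simp add: inner_vec_def grad_component[OF assms] mult.commute)
qed

lemma norm_grad_le:
  assumes "(f has_derivative D) (at x)" "\<And>h. D h \<le> c * norm h"
  shows "norm (grad f x) \<le> c"
proof (cases "grad f x = 0")
  case True
  \<comment> \<open>For a zero gradient the claim is \<open>0 \<le> c\<close>, which the hypothesis
    yields at a unit vector.\<close>
  have "D (axis undefined 1) = 0" using grad_inner[OF assms(1)] True by simp
  then show ?thesis using assms(2)[of "axis undefined 1"] True by simp
next
  case False
  have "norm (grad f x) * norm (grad f x) \<le> c * norm (grad f x)"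
    using assms(2)[of "grad f x"] grad_inner[OF assms(1)] by (simp add: dot_square_norm power2_eq_square)
  then show ?thesis using False by simp
qed

lemma grad_poly_with_partials:
  assumes "poly_with_partials p q r"
  shows "grad q x $ l = r l x"
proof -
  have "(q has_derivative (\<lambda>h. \<Sum>l\<in>UNIV. h $ l * r l x)) (at x)"
    using assms by (simp add: poly_with_partials_def)
  from grad_component[OF this] show ?thesis
    by (simp add: axis_def if_distrib[of "\<lambda>a. a * _"] cong: if_cong)
qed

text \<open>A member of \<open>trimmed_space\<close> is prescribed on \<open>\<Omega>\<close> only,
  so its gradient must be seen to depend on local values. The Frechet derivative is a choice;
  equality follows from equivalence of the predicates chosen from.\<close>

lemma grad_eq_on_open:
  assumes "open S" "x \<in> S" "\<And>y. y \<in> S \<Longrightarrow> f y = g y"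
  shows "grad f x = grad g x"
proof -
  have "(f has_derivative D) (at x) \<longleftrightarrow> (g has_derivative D) (at x)" for D
    using assms has_derivative_transform_within_open[of f D x UNIV S g]
      has_derivative_transform_within_open[of g D x UNIV S f] by auto
  then show ?thesis by (simp add: grad_def frechet_derivative_def)
qed

text \<open>Comparing difference quotients avoids any differentiability of the inner map \<open>F\<close>.\<close>

lemma norm_grad_lipschitz_comp:
  fixes v q :: "real^'d::finite \<Rightarrow> real"
  assumes v: "(v has_derivative D) (at (F x))" and q: "(q has_derivative E) (at x)"
    and S: "open S" "x \<in> S" and eq: "\<And>y. y \<in> S \<Longrightarrow> q y = v (F y)" and F: "L-lipschitz_on S F"
  shows "norm (grad q x) \<le> L * norm (grad v (F x))"
proof -
  have L: "L \<ge> 0" using F by (rule lipschitz_on_nonneg)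
  interpret E: bounded_linear E using q by (rule has_derivative_bounded_linear)
  define N where "N = norm (grad v (F x))"
  have *: "E h \<le> ((N + e) * L + e) * norm h" if e: "e > 0" for e h
  proof (cases "h = 0")
    case False
    obtain d1 where d1: "d1 > 0" "\<And>z. norm (z - F x) < d1 \<Longrightarrow> \<bar>v z - v (F x) - D (z - F x)\<bar> \<le> e * norm (z - F x)"
      using v e unfolding has_derivative_at_alt real_norm_def by blast
    obtain d2 where d2: "d2 > 0" "\<And>y. norm (y - x) < d2 \<Longrightarrow> \<bar>q y - q x - E (y - x)\<bar> \<le> e * norm (y - x)"
      using q e unfolding has_derivative_at_alt real_norm_def by blast
    obtain d3 where d3: "d3 > 0" "ball x d3 \<subseteq> S" using S by (meson openE)
    \<comment> \<open>The step is short enough for \<open>y\<close> to lie in \<open>S\<close> and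
      in the range \<open>d2\<close>, and for \<open>F y\<close> to lie within \<open>d1\<close> of
      \<open>F x\<close>; \<open>L + 1\<close> replaces \<open>L\<close> because \<open>L\<close>
      may be 0.\<close>
    define t where "t = min (min d2 d3) (d1 / (L + 1)) / (2 * norm h)"
    define y where "y = x + t *\<^sub>R h"
    have mpos: "min (min d2 d3) (d1 / (L + 1)) > 0" using d1(1) d2(1) d3(1) L by (auto simp: add_nonneg_pos)
    then have t: "t > 0" using False by (simp add: t_def)
    have half: "norm (y - x) = min (min d2 d3) (d1 / (L + 1)) / 2"
      using t False mpos by (simp add: y_def t_def)
    have ny: "norm (y - x) < min (min d2 d3) (d1 / (L + 1))"
      unfolding half using half_gt_zero[OF mpos] by linarith
    then have yS: "y \<in> S" using d3(2) by (auto simp: dist_norm norm_minus_commute subset_iff)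
    have Fy: "norm (F y - F x) \<le> L * norm (y - x)"
      using lipschitz_onD[OF F yS S(2)] by (simp add: dist_norm)
    also have "\<dots> \<le> (L + 1) * norm (y - x)" by (intro mult_right_mono) auto
    also have "\<dots> < d1" using ny L by (simp add: pos_less_divide_eq mult.commute add_nonneg_pos)
    finally have "\<bar>v (F y) - v (F x) - D (F y - F x)\<bar> \<le> e * norm (F y - F x)" by (rule d1(2))
    moreover have "D (F y - F x) \<le> N * norm (F y - F x)"
      unfolding grad_inner[OF v] N_def by (rule norm_cauchy_schwarz)
    ultimately have "v (F y) - v (F x) \<le> (N + e) * norm (F y - F x)" by (simp add: algebra_simps)
    also have "\<dots> \<le> (N + e) * (L * norm (y - x))" using Fy e by (intro mult_left_mono) (auto simp: N_def)
    finally have "q y - q x \<le> (N + e) * L * norm (y - x)" using eq yS S(2) by simp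
    moreover have "\<bar>q y - q x - E (y - x)\<bar> \<le> e * norm (y - x)" using ny by (intro d2(2)) auto
    ultimately have "E (y - x) \<le> ((N + e) * L + e) * norm (y - x)" by (simp add: algebra_simps)
    then have "t * E h \<le> t * (((N + e) * L + e) * norm h)"
      using t by (simp add: y_def E.scaleR algebra_simps)
    then show ?thesis using t by simp
  qed (simp add: E.zero)
  have "norm (grad q x) \<le> N * L + e" if e: "e > 0" for e
  proof -
    define e' where "e' = e / (L + 1)"
    have e': "e' > 0" using e L by (simp add: e'_def add_nonneg_pos)
    have "norm (grad q x) \<le> (N + e') * L + e'" using norm_grad_le[OF q *[OF e']] .
    also have "\<dots> = N * L + e' * (L + 1)" by (simp add: algebra_simps)
    also have "e' * (L + 1) = e" using L by (simp add: e'_def add_nonneg_eq_0_iff)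
    finally show ?thesis .
  qed
  then have "norm (grad q x) \<le> N * L" by (rule field_le_epsilon)
  then show ?thesis by (simp add: N_def mult.commute)
qed

lemma smooth_on_closed_C1:
  fixes G :: "real^'n::finite \<Rightarrow> 'b::real_normed_vector"
  assumes "smooth_on_closed S G"
  obtains U g pg where "open U" "S \<subseteq> U" "\<And>x. x \<in> S \<Longrightarrow> g x = G x" "continuous_on U g"
    "\<And>l. continuous_on U (pg l)"
    "\<And>x. x \<in> U \<Longrightarrow> (g has_derivative (\<lambda>h. \<Sum>l\<in>UNIV. h $ l *\<^sub>R pg l x)) (at x)"
proof -
  obtain U g where U: "open U" "S \<subseteq> U" "\<And>x. x \<in> S \<Longrightarrow> g x = G x" and "Ck_on (Suc 0) U g"
    using assms unfolding smooth_on_closed_def by blast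
  then have "continuous_on U g" and
    ex: "\<forall>l. \<exists>h. continuous_on U h \<and> (\<forall>x\<in>U. ((\<lambda>t. g (x + t *\<^sub>R axis l 1)) has_vector_derivative h x) (at 0))"
    by auto
  moreover from choice[OF ex] obtain pg where "\<And>l. continuous_on U (pg l)"
    "\<And>l x. x \<in> U \<Longrightarrow> ((\<lambda>t. g (x + t *\<^sub>R axis l 1)) has_vector_derivative pg l x) (at 0)" by blast
  ultimately show ?thesis
    using U by (intro that[of U g pg] has_derivative_partials) auto
qed

text \<open>\<open>E\<close> is the chain-rule gradient for the smooth extension of \<open>G\<close>
  beyond the closure. Continuity up to the boundary provides the limit in
  \<open>stabilization\<close>, and continuity inside makes superlevel sets of the gradient norm
  open.\<close>

lemma grad_poly_comp_smooth:
  fixes G :: "real^'d::finite \<Rightarrow> real^'d"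
  assumes K: "open K" and G: "smooth_on_closed (closure K) G" and q: "poly_with_partials p q r"
  obtains E where "continuous_on (closure K) E" "\<And>x. x \<in> K \<Longrightarrow> grad (q \<circ> G) x = E x"
    "\<And>x. x \<in> K \<Longrightarrow> (q \<circ> G) differentiable (at x)"
proof -
  obtain U g pg where U: "open U" "closure K \<subseteq> U" "\<And>x. x \<in> closure K \<Longrightarrow> g x = G x" "continuous_on U g"
    "\<And>l. continuous_on U (pg l)"
    "\<And>x. x \<in> U \<Longrightarrow> (g has_derivative (\<lambda>h. \<Sum>l\<in>UNIV. h $ l *\<^sub>R pg l x)) (at x)"
    using smooth_on_closed_C1[OF G] by blast
  have KU: "K \<subseteq> U" "K \<subseteq> closure K" using U(2) closure_subset by auto
  define E where "E x = (\<chi> l. \<Sum>j\<in>UNIV. pg l x $ j * r j (g x))" for x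
  have r: "continuous_on UNIV (r j)" for j using q by (simp add: poly_with_partials_def)
  have "continuous_on U E"
    unfolding E_def
    by (intro continuous_on_vec_lambda continuous_intros U continuous_on_compose2[OF r U(4)]) auto
  then have "continuous_on (closure K) E" using U(2) continuous_on_subset by blast
  moreover have der: "((q \<circ> G) has_derivative (\<lambda>h. \<Sum>j\<in>UNIV. (\<Sum>l\<in>UNIV. h $ l *\<^sub>R pg l x) $ j * r j (g x))) (at x)"
    if x: "x \<in> K" for x
  proof -
    have "((q \<circ> g) has_derivative ((\<lambda>h. \<Sum>j\<in>UNIV. h $ j * r j (g x)) \<circ> (\<lambda>h. \<Sum>l\<in>UNIV. h $ l *\<^sub>R pg l x))) (at x)"
      using q x KU by (intro diff_chain_at U) (auto simp: poly_with_partials_def)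
    then have "((q \<circ> g) has_derivative (\<lambda>h. \<Sum>j\<in>UNIV. (\<Sum>l\<in>UNIV. h $ l *\<^sub>R pg l x) $ j * r j (g x))) (at x)"
      by (simp add: o_def)
    then show ?thesis
      by (rule has_derivative_transform_within_open[OF _ K x]) (use U(3) KU in auto)
  qed
  moreover have "grad (q \<circ> G) x = E x" if x: "x \<in> K" for x
  proof -
    have "(\<Sum>l\<in>UNIV. axis m 1 $ l *\<^sub>R pg l x) = pg m x" for m
      by (simp add: axis_def if_distrib[of "\<lambda>a. a *\<^sub>R _"] cong: if_cong)
    then show ?thesis by (simp add: vec_eq_iff E_def grad_component[OF der[OF x]])
  qed
  ultimately show ?thesis using differentiableI[OF der] by (intro that[of E]) auto
qed

lemma norm_Lim_grad_le:
  fixes G :: "real^'d::finite \<Rightarrow> real^'d"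
  assumes K: "open K" and G: "smooth_on_closed (closure K) G" and q: "poly_with_partials p q r"
    and x: "x \<in> closure K" and bd: "\<And>y. y \<in> K \<Longrightarrow> norm (grad (q \<circ> G) y) \<le> B"
  shows "norm (Lim (at x within K) (grad (q \<circ> G))) \<le> B"
proof -
  obtain E where E: "continuous_on (closure K) E" "\<And>x. x \<in> K \<Longrightarrow> grad (q \<circ> G) x = E x"
    by (rule grad_poly_comp_smooth[OF K G q]) iprover
  \<comment> \<open>Since \<open>K\<close> is open, each point of its closure is a limit point of
    \<open>K\<close>, so the limit is taken along a nontrivial filter.\<close>
  have nt: "at x within K \<noteq> bot"
    using x K by (metis closure_def UnE interior_limit_point interior_open mem_Collect_eq trivial_limit_within)
  have "(E \<longlongrightarrow> E x) (at x within closure K)" using E(1) x by (simp add: continuous_on_def)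
  then have "(E \<longlongrightarrow> E x) (at x within K)" by (rule tendsto_within_subset) (rule closure_subset)
  moreover have "\<forall>\<^sub>F y in at x within K. E y = grad (q \<circ> G) y"
    using E(2) by (auto simp: eventually_at intro!: exI[of _ 1])
  ultimately have lim: "(grad (q \<circ> G) \<longlongrightarrow> E x) (at x within K)"
    by (rule Lim_transform_eventually)
  have "norm (E x) \<le> B"
  proof (rule tendsto_upperbound[OF tendsto_norm[OF lim] _ nt])
    show "\<forall>\<^sub>F y in at x within K. norm (grad (q \<circ> G) y) \<le> B"
      using bd by (auto simp: eventually_at intro!: exI[of _ 1])
  qed
  then show ?thesis using tendsto_Lim[OF nt lim] by simp
qed

lemma norm_outward_normal_le: "norm (outward_normal \<Omega> x) \<le> 1"
proof (cases "\<exists>\<nu>. is_outward_normal \<Omega> x \<nu>")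
  case True
  then have "is_outward_normal \<Omega> x (outward_normal \<Omega> x)"
    by (auto simp: outward_normal_def intro: someI)
  then obtain w where "outward_normal \<Omega> x = w /\<^sub>R norm w" by (auto simp: is_outward_normal_def)
  then show ?thesis by (cases "w = 0") auto
qed (simp add: outward_normal_def)

section \<open>The mesh and the stabilization operator\<close>

lemma diameter_box_cart:
  fixes a b :: "real^'d::finite"
  assumes "\<And>l. a $ l < b $ l"
  shows "diameter (box a b) = norm (b - a)"
proof -
  have ne: "box a b \<noteq> {}" using assms by (auto simp: interval_ne_empty_cart)
  have "diameter (box a b) = diameter (closure (box a b))" by (simp add: diameter_closure)
  also have "\<dots> = dist a b"
    unfolding closure_box[OF ne] using assms
    by (intro diameter_cbox) (auto simp: Basis_vec_def inner_axis less_imp_le)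
  finally show ?thesis by (simp add: dist_norm norm_minus_commute)
qed

text \<open>All pairs of knot spans in different directions occur as edges of a common element, so
  shape regularity of a tensor-product mesh forces quasi-uniformity in dimension at least two.\<close>

lemma param_mesh_quasi_uniform:
  fixes \<Xi> :: "'d::finite \<Rightarrow> real list"
  assumes d: "2 \<le> CARD('d)" and \<kappa>: "\<kappa> > 0"
    and shape: "\<forall>a b. box a b \<in> param_mesh \<Xi> \<longrightarrow> (\<forall>l. b $ l - a $ l \<ge> \<kappa> * diameter (box a b))"
    and Q: "Q \<in> param_mesh \<Xi>" and Q': "Q' \<in> param_mesh \<Xi>"
  obtains a b where "Q' = box a b" "\<And>l. a $ l < b $ l" "\<And>l. \<kappa> ^ 3 * diameter Q \<le> b $ l - a $ l"
proof -
  have elem: "box a b \<in> param_mesh \<Xi>"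
    if "\<And>l. a $ l \<in> set (\<Xi> l) \<and> b $ l \<in> set (\<Xi> l) \<and> a $ l < b $ l \<and> set (\<Xi> l) \<inter> {a $ l <..< b $ l} = {}" for a b
    using that unfolding param_mesh_def by blast
  obtain a b where ab: "Q = box a b" "\<And>l. a $ l \<in> set (\<Xi> l) \<and> b $ l \<in> set (\<Xi> l) \<and>
     a $ l < b $ l \<and> set (\<Xi> l) \<inter> {a $ l <..< b $ l} = {}"
    using Q unfolding param_mesh_def by blast
  obtain a' b' where ab': "Q' = box a' b'" "\<And>l. a' $ l \<in> set (\<Xi> l) \<and> b' $ l \<in> set (\<Xi> l) \<and>
     a' $ l < b' $ l \<and> set (\<Xi> l) \<inter> {a' $ l <..< b' $ l} = {}"
    using Q' unfolding param_mesh_def by blast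
  obtain l m :: 'd where lm: "l \<noteq> m"
    using d card_le_Suc0_iff_eq[of "UNIV :: 'd set"] by fastforce
  \<comment> \<open>The mixed element has the span of \<open>Q\<close> in direction \<open>l\<close>
    and the spans of \<open>Q'\<close> in all others. One factor \<open>\<kappa>\<close> is lost on
    each of \<open>Q\<close>, the mixed element and \<open>Q'\<close>, which explains the
    cube.\<close>
  define c where "c = (\<chi> i. if i = l then a $ i else a' $ i)"
  define e where "e = (\<chi> i. if i = l then b $ i else b' $ i)"
  have ce: "box c e \<in> param_mesh \<Xi>" using ab(2) ab'(2) by (intro elem) (auto simp: c_def e_def)
  have edge: "v $ i - u $ i \<le> diameter (box u v)" if "\<And>l. u $ l < v $ l" for u v :: "real^'d" and i
    using component_le_norm_cart[of "v - u" i] that by (subst diameter_box_cart) (auto intro: order_trans[OF abs_ge_self])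
  have celt: "c $ i < e $ i" for i using ab(2) ab'(2) by (simp add: c_def e_def)
  have "\<kappa> * diameter Q \<le> b $ l - a $ l" using shape Q ab(1) by blast
  also have "\<dots> \<le> diameter (box c e)" using edge[of c e l] celt by (simp add: c_def e_def)
  finally have "\<kappa> * (\<kappa> * diameter Q) \<le> \<kappa> * diameter (box c e)" using \<kappa> by (intro mult_left_mono) auto
  also have "\<dots> \<le> e $ m - c $ m" using shape ce by blast
  also have "\<dots> = b' $ m - a' $ m" using lm by (simp add: c_def e_def)
  also have "\<dots> \<le> diameter Q'" using edge[of a' b' m] ab' by simp
  finally have "\<kappa> * (\<kappa> * (\<kappa> * diameter Q)) \<le> \<kappa> * diameter Q'" using \<kappa> by (intro mult_left_mono) auto
  moreover have "\<kappa> * diameter Q' \<le> b' $ i - a' $ i" for i using shape Q' ab'(1) by blast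
  ultimately have "\<kappa> ^ 3 * diameter Q \<le> b' $ i - a' $ i" for i
    by (simp add: power3_eq_cube mult.assoc) (meson order_trans)
  then show ?thesis using that[of a' b'] ab' by blast
qed

text \<open>Markov's inequality is used at a positive level, but the level of interest is 0 when the
  gradient of \<open>v\<close> vanishes; a limit from above covers that case.\<close>

lemma le_mult_sqrtI:
  fixes x c m :: real
  assumes "\<And>\<mu>. 0 < \<mu> \<Longrightarrow> m \<le> \<mu> \<Longrightarrow> x \<le> c * sqrt \<mu>" "0 \<le> m"
  shows "x \<le> c * sqrt m"
proof (rule tendsto_lowerbound)
  show "((\<lambda>\<mu>. c * sqrt \<mu>) \<longlongrightarrow> c * sqrt m) (at_right m)" by (intro tendsto_intros)
  show "\<forall>\<^sub>F \<mu> in at_right m. x \<le> c * sqrt \<mu>"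
    using assms by (auto simp: eventually_at_right_field intro!: exI[of _ "m + 1"])
qed simp

lemma param_mesh_element:
  fixes \<Xi> :: "'d::finite \<Rightarrow> real list"
  assumes \<Xi>: "\<forall>l. open_knot_vector p (\<Xi> l)" and Q: "Q \<in> param_mesh \<Xi>"
  shows "open Q" "Q \<subseteq> box 0 1" "bounded Q" "Q \<noteq> {}" "0 < diameter Q"
proof -
  obtain a b where ab: "Q = box a b" "\<And>l. a $ l \<in> set (\<Xi> l)" "\<And>l. b $ l \<in> set (\<Xi> l)" "\<And>l. a $ l < b $ l"
    using Q unfolding param_mesh_def by blast
  have "0 \<le> a $ l \<and> b $ l \<le> 1" for l
    using \<Xi> ab(2,3)[of l] unfolding open_knot_vector_def by fastforce
  then show "Q \<subseteq> box 0 1"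
    unfolding ab(1) subset_iff mem_box_cart by (auto intro: le_less_trans less_le_trans)
  have "b \<noteq> a" using ab(4) by (metis less_irrefl)
  then show "0 < diameter Q" using diameter_box_cart[of a b] ab by simp
  show "open Q" "bounded Q" "Q \<noteq> {}" using ab by (auto simp: interval_ne_empty_cart)
qed

section \<open>Estimates for a bi-Lipschitz parametrization with fixed constants\<close>

locale bilipschitz_param =
  fixes F :: "real^'d::finite \<Rightarrow> real^'d" and L1 L2 :: real
  assumes inj: "inj_on F (cbox 0 1)" and pos: "L1 > 0" "L2 > 0"
    and lip: "L1-lipschitz_on (cbox 0 1) F" and lip_inv: "L2-lipschitz_on (F ` cbox 0 1) (param_inv F)"
begin

lemma cont: "continuous_on (cbox 0 1) F"
  using lip by (rule lipschitz_on_continuous_on)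

lemma box_sub: "box 0 1 \<subseteq> (cbox 0 1 :: (real^'d) set)"
  by (rule box_subset_cbox)

lemma param_inv_F: "\<zeta> \<in> cbox 0 1 \<Longrightarrow> param_inv F (F \<zeta>) = \<zeta>"
  using inj by (simp add: param_inv_def)

lemma open_image: "open Q \<Longrightarrow> Q \<subseteq> box 0 1 \<Longrightarrow> open (F ` Q)"
  using continuous_on_subset[OF cont, of Q] inj_on_subset[OF inj, of Q] box_sub
  by (intro invariance_of_domain) auto

lemma open_param_preimage: "open \<Omega> \<Longrightarrow> open (param_preimage F \<Omega>)"
  using continuous_open_preimage[OF continuous_on_subset[OF cont box_sub] open_box, of \<Omega>]
  unfolding param_preimage_def vimage_def Int_def by simp

lemma param_preimage_image: "Q \<subseteq> box 0 1 \<Longrightarrow> param_preimage F (F ` Q) = Q"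
  using inj_on_subset[OF inj box_sub] by (auto simp: param_preimage_def inj_on_def subset_iff)

lemma diameter_image_le:
  assumes "Q \<subseteq> box 0 1" "bounded Q"
  shows "diameter (F ` Q) \<le> L1 * diameter Q"
proof (rule diameter_le)
  show "F ` Q \<noteq> {} \<or> 0 \<le> L1 * diameter Q" using pos assms by (simp add: diameter_ge_0)
  fix x y assume "x \<in> F ` Q" "y \<in> F ` Q"
  then obtain u w where uw: "x = F u" "y = F w" "u \<in> Q" "w \<in> Q" by auto
  have "dist (F u) (F w) \<le> L1 * dist u w"
    using lipschitz_onD[OF lip] uw assms(1) box_sub by (meson subsetD)
  also have "\<dots> \<le> L1 * diameter Q"
    using pos diameter_bounded_bound[OF assms(2) uw(3,4)] by (intro mult_left_mono) auto
  finally show "norm (x - y) \<le> L1 * diameter Q" by (simp add: uw dist_norm)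
qed

text \<open>Markov's inequality for \<open>norm (grad v)\<^sup>2\<close> in the physical domain, pulled back with the
  Lipschitz bound on measures, leaves a subset of the good element of relative size at least
  \<open>\<theta> / 2\<close> on which the partial derivatives of \<open>q\<close> are controlled pointwise.\<close>

lemma good_element_partials_bound:
  fixes q v :: "real^'d \<Rightarrow> real"
  defines "CL \<equiv> unit_ball_vol (real CARD('d)) * (L2 * real CARD('d)) ^ CARD('d)"
  assumes remez: "remez_constant {f :: real^'d \<Rightarrow> real. coordinatewise_poly p f} (\<theta> / 2) M CR"
    and \<Omega>: "open \<Omega>" and Q: "box a b \<subseteq> box 0 1" "\<And>l. a $ l < b $ l"
    and good: "\<theta> * measure lborel (box a b) \<le> measure lborel (param_preimage F \<Omega> \<inter> box a b)" and \<theta>: "0 < \<theta>"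
    and smooth: "smooth_on_closed (closure (F ` box a b)) (param_inv F)"
    and q: "poly_with_partials p q r" and v: "\<And>x. x \<in> \<Omega> \<inter> F ` box a b \<Longrightarrow> v x = q (param_inv F x)"
    and I: "(\<integral>\<^sup>+x\<in>(\<Omega> \<inter> F ` box a b). ennreal ((norm (grad v x))\<^sup>2) \<partial>lborel) = ennreal i0" and i0: "0 \<le> i0"
    and \<mu>: "\<mu> > 0" "2 * CL * i0 / (\<theta> * measure lborel (box a b)) \<le> \<mu>"
    and \<zeta>: "\<And>l. \<bar>\<zeta> $ l - a $ l\<bar> \<le> M * (b $ l - a $ l)"
  shows "\<bar>r l \<zeta>\<bar> \<le> CR * (L1 * sqrt \<mu>)"
proof -
  define A where "A = \<Omega> \<inter> F ` box a b"
  have Kopen: "open (F ` box a b)" using Q by (intro open_image) auto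
  then have A: "open A" using \<Omega> by (auto simp: A_def)
  obtain E where E: "continuous_on (closure (F ` box a b)) E"
    "\<And>x. x \<in> F ` box a b \<Longrightarrow> grad (q \<circ> param_inv F) x = E x"
    "\<And>x. x \<in> F ` box a b \<Longrightarrow> (q \<circ> param_inv F) differentiable (at x)"
    using grad_poly_comp_smooth[OF Kopen smooth q] by metis
  have grad_v: "grad v x = E x" if "x \<in> A" for x
    using grad_eq_on_open[OF A that, of v "q \<circ> param_inv F"] v E(2)[of x] that by (auto simp: A_def)
  have diff_v: "\<exists>D. (v has_derivative D) (at x)" if x: "x \<in> A" for x
  proof -
    obtain D where "((q \<circ> param_inv F) has_derivative D) (at x)"
      using E(3)[of x] x by (auto simp: A_def differentiable_def)
    then have "(v has_derivative D) (at x)"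
      by (rule has_derivative_transform_within_open[OF _ A x]) (use v in \<open>auto simp: A_def\<close>)
    then show ?thesis by blast
  qed
  have "continuous_on A E" using E(1) by (rule continuous_on_subset) (use closure_subset[of "F ` box a b"] in \<open>auto simp: A_def\<close>)
  then have contA: "continuous_on A (\<lambda>x. (norm (E x))\<^sup>2)" by (intro continuous_intros)
  \<comment> \<open>The exceptional set of Markov's inequality. It is open by continuity of
    \<open>E\<close>, so it and its pullback \<open>T'\<close> are measurable.\<close>
  define T where "T = {x\<in>A. \<mu> < (norm (grad v x))\<^sup>2}"
  have "T = A \<inter> (\<lambda>x. (norm (E x))\<^sup>2) -` {\<mu><..}" using grad_v by (auto simp: T_def)
  then have Topen: "open T" using continuous_open_preimage[OF contA A, of "{\<mu><..}"] by simp
  have "ennreal \<mu> * emeasure lborel T = (\<integral>\<^sup>+x. ennreal \<mu> * indicator T x \<partial>lborel)"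
    using Topen by (subst nn_integral_cmult_indicator) auto
  also have "\<dots> \<le> (\<integral>\<^sup>+x\<in>A. ennreal ((norm (grad v x))\<^sup>2) \<partial>lborel)"
    by (intro nn_integral_mono) (auto simp: T_def indicator_def intro!: ennreal_leI)
  finally have Markov: "ennreal \<mu> * emeasure lborel T \<le> ennreal i0" using I by (simp add: A_def)
  define S where "S = param_preimage F \<Omega> \<inter> box a b"
  have Sopen: "open S" unfolding S_def using \<Omega> by (intro open_Int open_param_preimage) auto
  have S01: "S \<subseteq> cbox 0 1" using Q box_sub by (auto simp: S_def)
  have FS: "F \<zeta> \<in> A" if "\<zeta> \<in> S" for \<zeta> using that by (auto simp: S_def A_def param_preimage_def)
  define T' where "T' = S \<inter> F -` T"
  have T'open: "open T'" unfolding T'_def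
    using continuous_open_preimage[OF continuous_on_subset[OF cont S01] Sopen Topen] .
  have T_sub: "T \<subseteq> F ` cbox 0 1" using Q box_sub by (auto simp: T_def A_def)
  \<comment> \<open>Writing the pullback as an image under the Lipschitz map
    \<open>param_inv F\<close> permits the volume estimate
    \<open>emeasure_lipschitz_image\<close>.\<close>
  have T'_image: "param_inv F ` T = T'"
  proof
    show "param_inv F ` T \<subseteq> T'"
    proof clarify
      fix x assume x: "x \<in> T"
      then obtain \<zeta> where \<zeta>: "\<zeta> \<in> box a b" "x = F \<zeta>" by (auto simp: T_def A_def)
      have "\<zeta> \<in> cbox 0 1" using \<zeta>(1) Q(1) box_sub by blast
      then have "param_inv F x = \<zeta>" using \<zeta>(2) param_inv_F by simp
      then show "param_inv F x \<in> T'"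
        using \<zeta> x Q(1) by (auto simp: T'_def S_def param_preimage_def T_def A_def)
    qed
    show "T' \<subseteq> param_inv F ` T"
    proof
      fix \<zeta> assume "\<zeta> \<in> T'"
      then show "\<zeta> \<in> param_inv F ` T" using S01 param_inv_F[of \<zeta>] by (auto simp: T'_def intro!: image_eqI[of _ _ "F \<zeta>"])
    qed
  qed
  have "bounded T"
    using T_sub compact_imp_bounded[OF compact_continuous_image[OF cont compact_cbox]] bounded_subset by blast
  then have T'_le: "emeasure lborel T' \<le> ennreal CL * emeasure lborel T"
    using emeasure_lipschitz_image[OF lipschitz_on_subset[OF lip_inv T_sub]] Topen T'open
    by (simp add: T'_image CL_def)
  have CL: "CL \<ge> 0" using pos by (simp add: CL_def)
  have vol: "measure lborel (box a b) > 0"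
    unfolding measure_lborel_box_eq using Q(2) by (auto intro!: prod_pos simp: Basis_vec_def inner_axis less_imp_le)
  have fin: "emeasure lborel (box a b) < \<infinity>" by (simp add: emeasure_lborel_box_eq)
  \<comment> \<open>The factor 2 in the lower bound for \<open>\<mu>\<close> is chosen so that
    \<open>T'\<close> takes at most half of the guaranteed fraction \<open>\<theta>\<close>.\<close>
  have T'm: "measure lborel T' \<le> \<theta> / 2 * measure lborel (box a b)"
  proof -
    have "ennreal \<mu> * emeasure lborel T' \<le> ennreal \<mu> * (ennreal CL * emeasure lborel T)"
      using T'_le by (rule mult_left_mono) simp
    also have "\<dots> = ennreal CL * (ennreal \<mu> * emeasure lborel T)" by (simp add: mult_ac)
    also have "\<dots> \<le> ennreal CL * ennreal i0" using Markov by (rule mult_left_mono) simp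
    also have "\<dots> = ennreal (CL * i0)" using CL i0 by (simp add: ennreal_mult)
    finally have *: "ennreal \<mu> * emeasure lborel T' \<le> ennreal (CL * i0)" .
    have "emeasure lborel T' < \<infinity>"
      using emeasure_mono[of T' "box a b" lborel] fin by (auto simp: T'_def S_def intro: le_less_trans)
    then have "emeasure lborel T' = ennreal (measure lborel T')" by (simp add: emeasure_eq_ennreal_measure less_top)
    then have "\<mu> * measure lborel T' \<le> CL * i0"
      using * \<mu>(1) CL i0 by (simp add: ennreal_mult[symmetric])
    also have "\<dots> \<le> \<mu> * (\<theta> / 2 * measure lborel (box a b))"
      using \<mu>(2) vol \<theta> by (simp add: pos_divide_le_eq mult_ac)
    finally show ?thesis using \<mu>(1) by simp
  qed
  have big: "\<theta> / 2 * measure lborel (box a b) \<le> measure lborel (S - T')"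
  proof -
    have "S \<in> fmeasurable lborel"
      using Sopen emeasure_mono[of S "box a b" lborel] fin by (intro fmeasurableI) (auto simp: S_def intro: le_less_trans)
    then have "measure lborel (S - T') = measure lborel S - measure lborel T'"
      using T'open Sopen by (intro measurable_measure_Diff) (auto simp: T'_def)
    then show ?thesis using good T'm by (simp add: S_def)
  qed
  \<comment> \<open>Off \<open>T'\<close> the gradient of \<open>v\<close> has norm at most
    \<open>sqrt \<mu>\<close>, and composition with \<open>F\<close> on the open set
    \<open>S\<close> costs the factor \<open>L1\<close>.\<close>
  have bd: "\<bar>r l \<eta>\<bar> \<le> L1 * sqrt \<mu>" if \<eta>: "\<eta> \<in> S - T'" for \<eta>
  proof -
    obtain D where D: "(v has_derivative D) (at (F \<eta>))" using diff_v FS \<eta> by blast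
    have "(q has_derivative (\<lambda>h. \<Sum>l\<in>UNIV. h $ l * r l \<eta>)) (at \<eta>)"
      using q by (simp add: poly_with_partials_def)
    moreover have "q y = v (F y)" if "y \<in> S" for y
      using v[of "F y"] FS[OF that] param_inv_F[of y] that S01 by (auto simp: A_def)
    ultimately have "norm (grad q \<eta>) \<le> L1 * norm (grad v (F \<eta>))"
      using \<eta> by (intro norm_grad_lipschitz_comp[OF D _ Sopen _ _ lipschitz_on_subset[OF lip S01]]) auto
    also have "\<dots> \<le> L1 * sqrt \<mu>"
    proof -
      have "(norm (grad v (F \<eta>)))\<^sup>2 \<le> \<mu>" using \<eta> FS[of \<eta>] by (auto simp: T'_def T_def)
      then show ?thesis using pos by (intro mult_left_mono real_le_rsqrt) auto
    qed
    finally show ?thesis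
      using component_le_norm_cart[of "grad q \<eta>" l] grad_poly_with_partials[OF q, of \<eta> l] by simp
  qed
  show ?thesis
  proof (rule remez_constantD[OF remez _ Q(2) _ _ big bd \<zeta>])
    show "r l \<in> {f. coordinatewise_poly p f}" using q by (simp add: poly_with_partials_def)
  qed (use Sopen T'open in \<open>auto simp: S_def\<close>)
qed

lemma local_poly_eq:
  assumes \<Omega>: "open \<Omega>" and Q: "open Q" "Q \<subseteq> box 0 1" "Q \<inter> param_preimage F \<Omega> \<noteq> {}"
    and q: "q \<in> tensor_polys p" and v: "\<And>\<zeta>. \<zeta> \<in> Q \<Longrightarrow> F \<zeta> \<in> \<Omega> \<Longrightarrow> v (F \<zeta>) = q \<zeta>"
  shows "local_poly p F \<Omega> v (F ` Q) = q"
  unfolding local_poly_def param_preimage_image[OF Q(2)]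
proof (rule the_equality)
  show "q \<in> tensor_polys p \<and> (\<forall>\<zeta>\<in>Q \<inter> param_preimage F \<Omega>. q \<zeta> = v (F \<zeta>))"
    using q v by (auto simp: param_preimage_def)
  fix q' assume q': "q' \<in> tensor_polys p \<and> (\<forall>\<zeta>\<in>Q \<inter> param_preimage F \<Omega>. q' \<zeta> = v (F \<zeta>))"
  show "q' = q"
  proof (rule tensor_polys_eqI[OF _ q _ Q(3)])
    show "open (Q \<inter> param_preimage F \<Omega>)" using Q \<Omega> by (intro open_Int open_param_preimage)
  qed (use q' v in \<open>auto simp: param_preimage_def\<close>)
qed

text \<open>The extended polynomial is \<open>q\<close> itself, viewed on the whole space, so bounds
  for its partial derivatives on \<open>Q\<close> suffice, whichever element determined
  \<open>q\<close>. Composition with \<open>param_inv F\<close> contributes \<open>L2\<close>, and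
  bounding the Euclidean norm by the sum of the components contributes the dimension.\<close>

lemma abs_stabilization_le:
  assumes Q: "open Q" "Q \<subseteq> box 0 1" and smooth: "smooth_on_closed (closure (F ` Q)) (param_inv F)"
    and lp: "local_poly p F \<Omega> v K' = q" and q: "poly_with_partials p' q r"
    and bd: "\<And>\<zeta> l. \<zeta> \<in> Q \<Longrightarrow> \<bar>r l \<zeta>\<bar> \<le> c" and x: "x \<in> closure (F ` Q)"
  shows "\<bar>stabilization p F \<Omega> (F ` Q) K' v x\<bar> \<le> L2 * (real CARD('d) * c)"
proof -
  have K: "open (F ` Q)" by (rule open_image[OF Q])
  have KF: "F ` Q \<subseteq> F ` cbox 0 1" using Q(2) box_sub by blast
  have "norm (grad (q \<circ> param_inv F) y) \<le> L2 * (real CARD('d) * c)" if y: "y \<in> F ` Q" for y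
  proof -
    obtain \<zeta> where \<zeta>: "\<zeta> \<in> Q" "y = F \<zeta>" using y by blast
    have G: "param_inv F y = \<zeta>" using \<zeta> Q(2) box_sub param_inv_F by blast
    obtain D where D: "((q \<circ> param_inv F) has_derivative D) (at y)"
      using grad_poly_comp_smooth[OF K smooth q] y by (metis differentiable_def)
    have "(q has_derivative (\<lambda>h. \<Sum>l\<in>UNIV. h $ l * r l (param_inv F y))) (at (param_inv F y))"
      using q by (simp add: poly_with_partials_def)
    then have "norm (grad (q \<circ> param_inv F) y) \<le> L2 * norm (grad q (param_inv F y))"
      using y by (intro norm_grad_lipschitz_comp[OF _ D K _ _ lipschitz_on_subset[OF lip_inv KF]]) auto
    also have "\<dots> \<le> L2 * (real CARD('d) * c)"
    proof (intro mult_left_mono)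
      have "norm (grad q \<zeta>) \<le> (\<Sum>l\<in>UNIV. \<bar>grad q \<zeta> $ l\<bar>)" by (rule norm_le_l1_cart)
      also have "\<dots> \<le> real CARD('d) * c"
        by (rule sum_bounded_above) (simp add: grad_poly_with_partials[OF q] bd[OF \<zeta>(1)])
      finally show "norm (grad q (param_inv F y)) \<le> real CARD('d) * c" by (simp add: G)
    qed (use pos in simp)
    finally show ?thesis .
  qed
  then have lim: "norm (Lim (at x within F ` Q) (grad (q \<circ> param_inv F))) \<le> L2 * (real CARD('d) * c)"
    by (rule norm_Lim_grad_le[OF K smooth q x])
  have "\<bar>stabilization p F \<Omega> (F ` Q) K' v x\<bar>
      \<le> norm (outward_normal \<Omega> x) * norm (Lim (at x within F ` Q) (grad (q \<circ> param_inv F)))"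
    unfolding stabilization_def lp by (rule Cauchy_Schwarz_ineq2)
  also have "\<dots> \<le> 1 * norm (Lim (at x within F ` Q) (grad (q \<circ> param_inv F)))"
    by (intro mult_right_mono norm_outward_normal_le) simp
  finally show ?thesis using lim by simp
qed

text \<open>With \<open>\<delta>\<close> the diameter of the element and \<open>B\<close> the
  pointwise bound, the square of the left side is at most \<open>\<delta> * B\<^sup>2 * (C\<Gamma> *
  \<delta> ^ (CARD('d) - 1))\<close>. Quasi-uniformity bounds \<open>\<delta> ^ CARD('d)\<close> by
  \<open>(L1 / \<kappa> ^ 3) ^ CARD('d)\<close> times the volume of \<open>Q'\<close>, which cancels
  the volume in the denominator of \<open>\<mu>\<close>.\<close>

lemma stabilization_L2_bound:
  fixes \<Xi> :: "'d \<Rightarrow> real list" and \<Gamma> :: "(real^'d) set" and \<kappa> CN \<theta> C\<Gamma> CR :: real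
  defines "CL \<equiv> unit_ball_vol (real CARD('d)) * (L2 * real CARD('d)) ^ CARD('d)"
    and "M \<equiv> (1 + L1 * L2 * (CN + 1)) / \<kappa> ^ 3 + 1"
  assumes remez: "remez_constant {f :: real^'d \<Rightarrow> real. coordinatewise_poly p f} (\<theta> / 2) M CR"
    and CR: "0 < CR" and \<Omega>: "open \<Omega>" and \<Xi>: "\<forall>l. open_knot_vector p (\<Xi> l)"
    and d: "2 \<le> CARD('d)" and \<kappa>: "0 < \<kappa>" and \<theta>: "0 < \<theta>" and CN: "0 \<le> CN" and C\<Gamma>: "0 \<le> C\<Gamma>"
    and shape: "\<forall>a b. box a b \<in> param_mesh \<Xi> \<longrightarrow> (\<forall>l. b $ l - a $ l \<ge> \<kappa> * diameter (box a b))"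
    and Q: "Q \<in> param_mesh \<Xi>" and Q': "Q' \<in> param_mesh \<Xi>" "Q' \<inter> param_preimage F \<Omega> \<noteq> {}"
    and good: "\<theta> * measure lborel Q' \<le> measure lborel (param_preimage F \<Omega> \<inter> Q')"
    and near: "setdist (F ` Q) (F ` Q') \<le> CN * diameter (F ` Q)"
    and smooth: "\<forall>Q\<in>param_mesh \<Xi>. smooth_on_closed (closure (F ` Q)) (param_inv F)"
    and v: "v \<in> trimmed_space p \<Xi> F \<Omega>" and \<Gamma>: "\<Gamma> \<in> sets borel"
    and area: "emeasure surface_measure (\<Gamma> \<inter> closure (F ` Q)) \<le> ennreal (C\<Gamma> * diameter (F ` Q) ^ (CARD('d) - 1))"
  shows "L2_norm surface_measure (\<Gamma> \<inter> closure (F ` Q))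
      (\<lambda>x. sqrt (diameter (F ` Q)) * stabilization p F \<Omega> (F ` Q) (F ` Q') v x)
    \<le> ennreal (1 + sqrt (C\<Gamma> * (L2 * (real CARD('d) * (CR * L1)))\<^sup>2 * (2 * CL / \<theta> * (L1 / \<kappa> ^ 3) ^ CARD('d))))
      * L2_norm lborel (\<Omega> \<inter> F ` Q') (grad v)"
proof -
  let ?n = "CARD('d)" and ?K = "F ` Q"
  let ?I = "\<integral>\<^sup>+x\<in>(\<Omega> \<inter> F ` Q'). ennreal ((norm (grad v x))\<^sup>2) \<partial>lborel"
  define W where "W = C\<Gamma> * (L2 * (real ?n * (CR * L1)))\<^sup>2 * (2 * CL / \<theta> * (L1 / \<kappa> ^ 3) ^ ?n)"
  have CL: "0 \<le> CL" using pos by (simp add: CL_def)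
  have W: "0 \<le> W" using CL C\<Gamma> \<theta> \<kappa> pos by (simp add: W_def)
  show ?thesis
  \<comment> \<open>The summand 1 keeps the constant nonzero, so the right side is infinite in this
    case even if the square root is 0.\<close>
  proof (cases "?I = \<infinity>")
    case True
    then have "L2_norm lborel (\<Omega> \<inter> F ` Q') (grad v) = \<infinity>" by (simp add: L2_norm_def)
    then show ?thesis unfolding W_def[symmetric] using W
      by (simp add: ennreal_mult_top add_nonneg_eq_0_iff)
  next
    case False
    then obtain i0 where i0: "?I = ennreal i0" "0 \<le> i0" by (cases ?I) auto
    note Qm = param_mesh_element[OF \<Xi> Q] and Qm' = param_mesh_element[OF \<Xi> Q'(1)]
    obtain a b where ab: "Q' = box a b" "\<And>l. a $ l < b $ l" "\<And>l. \<kappa> ^ 3 * diameter Q \<le> b $ l - a $ l"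
      using param_mesh_quasi_uniform[OF d \<kappa> shape Q Q'(1)] by blast
    obtain s where s: "s \<in> spline_space p \<Xi>" "\<And>x. x \<in> \<Omega> \<Longrightarrow> v x = s (param_inv F x)"
      using v by (auto simp: trimmed_space_def)
    obtain q where q: "q \<in> tensor_polys p" "\<And>\<zeta>. \<zeta> \<in> Q' \<Longrightarrow> s \<zeta> = q \<zeta>"
      using spline_tensor_poly_on_element[OF \<Xi> s(1) Q'(1)] by blast
    obtain r where r: "poly_with_partials p q r" using tensor_polys_partials[OF q(1)] by blast
    have invQ': "param_inv F (F \<zeta>) = \<zeta>" if "\<zeta> \<in> Q'" for \<zeta> using param_inv_F that Qm'(2) box_sub by blast
    have vq: "v x = q (param_inv F x)" if x: "x \<in> \<Omega> \<inter> F ` Q'" for x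
      using x s(2)[of x] q(2) invQ' by auto
    have lp: "local_poly p F \<Omega> v (F ` Q') = q"
      using vq invQ' by (intro local_poly_eq \<Omega> Qm' Q' q) auto
    define \<mu> where "\<mu> = 2 * CL * i0 / (\<theta> * measure lborel Q')"
    have \<mu>: "0 \<le> \<mu>" using CL i0 \<theta> by (simp add: \<mu>_def)
    \<comment> \<open>The path from \<open>\<zeta>\<close> through \<open>\<eta>\<close> in
      \<open>Q\<close> and \<open>\<eta>'\<close> in \<open>Q'\<close> to \<open>a\<close> consists
      of the diameter of \<open>Q\<close>, a pulled-back distance and an edge of \<open>Q'\<close>;
      these are the three contributions to \<open>M\<close>.\<close>
    have dilate: "\<bar>\<zeta> $ l - a $ l\<bar> \<le> M * (b $ l - a $ l)" if \<zeta>: "\<zeta> \<in> Q" for \<zeta> l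
    proof -
      \<comment> \<open>\<open>setdist\<close> is an infimum; the positive surplus
        \<open>L1 * diameter Q\<close> yields two actual points and turns \<open>CN\<close> into
        \<open>CN + 1\<close>.\<close>
      have "setdist ?K (F ` Q') < CN * diameter ?K + L1 * diameter Q"
        using near pos Qm(5) by (intro le_less_trans[OF near]) simp
      then obtain k k' where k: "k \<in> ?K" "k' \<in> F ` Q'" "dist k k' < CN * diameter ?K + L1 * diameter Q"
        using setdist_ltE Qm(4) Qm'(4) by (metis image_is_empty)
      then obtain \<eta> \<eta>' where \<eta>: "k = F \<eta>" "\<eta> \<in> Q" "k' = F \<eta>'" "\<eta>' \<in> Q'" by blast
      have in01: "\<eta> \<in> cbox 0 1" "\<eta>' \<in> cbox 0 1" using \<eta> Qm(2) Qm'(2) box_sub by blast+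
      have "dist \<eta> \<eta>' \<le> L2 * dist k k'"
        using lipschitz_onD[OF lip_inv, of k k'] in01 by (simp add: \<eta> param_inv_F)
      also have "\<dots> \<le> L2 * (CN * (L1 * diameter Q) + L1 * diameter Q)"
        using k(3) pos CN diameter_image_le[OF Qm(2,3)]
        by (intro mult_left_mono) (auto intro!: order_trans[OF less_imp_le[OF k(3)]] add_mono mult_left_mono)
      finally have d2: "dist \<eta> \<eta>' \<le> L1 * L2 * (CN + 1) * diameter Q" by (simp add: algebra_simps)
      have d1: "dist \<zeta> \<eta> \<le> diameter Q" using diameter_bounded_bound[OF Qm(3) \<zeta> \<eta>(2)] .
      have "\<bar>\<zeta> $ l - \<eta> $ l\<bar> \<le> dist \<zeta> \<eta>" "\<bar>\<eta> $ l - \<eta>' $ l\<bar> \<le> dist \<eta> \<eta>'"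
        using component_le_norm_cart[of "\<zeta> - \<eta>" l] component_le_norm_cart[of "\<eta> - \<eta>'" l] by (auto simp: dist_norm)
      moreover have "a $ l < \<eta>' $ l" "\<eta>' $ l < b $ l" using \<eta>(4) ab(1) by (auto simp: mem_box_cart)
      ultimately have "\<bar>\<zeta> $ l - a $ l\<bar> \<le> diameter Q + L1 * L2 * (CN + 1) * diameter Q + (b $ l - a $ l)"
        using d1 d2 by linarith
      also have "diameter Q + L1 * L2 * (CN + 1) * diameter Q = (1 + L1 * L2 * (CN + 1)) / \<kappa> ^ 3 * (\<kappa> ^ 3 * diameter Q)"
        using \<kappa> by (simp add: field_simps)
      also have "\<dots> \<le> (1 + L1 * L2 * (CN + 1)) / \<kappa> ^ 3 * (b $ l - a $ l)"
        using ab(3) pos CN \<kappa> by (intro mult_left_mono) auto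
      finally show ?thesis by (simp add: M_def algebra_simps)
    qed
    have bd: "\<bar>r l \<zeta>\<bar> \<le> CR * L1 * sqrt \<mu>" if \<zeta>: "\<zeta> \<in> Q" for \<zeta> l
    proof (rule le_mult_sqrtI[OF _ \<mu>])
      fix \<nu> :: real assume \<nu>: "0 < \<nu>" "\<mu> \<le> \<nu>"
      have "\<bar>r l \<zeta>\<bar> \<le> CR * (L1 * sqrt \<nu>)"
        by (rule good_element_partials_bound[where \<theta>=\<theta> and M=M and p=p and a=a and b=b and \<Omega>=\<Omega> and q=q and v=v and ?i0.0=i0])
          (fact remez \<Omega> Qm'(2)[unfolded ab(1)] ab(2) good[unfolded ab(1)] \<theta>
            smooth[THEN bspec, OF Q'(1), unfolded ab(1)] r vq[unfolded ab(1)] i0(1)[unfolded ab(1)] i0(2)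
            \<nu>(1) \<nu>(2)[unfolded \<mu>_def CL_def ab(1)] dilate[OF \<zeta>])+
      then show "\<bar>r l \<zeta>\<bar> \<le> CR * L1 * sqrt \<nu>" by (simp add: mult.assoc)
    qed
    define B where "B = L2 * (real ?n * (CR * L1 * sqrt \<mu>))"
    have B: "\<bar>stabilization p F \<Omega> ?K (F ` Q') v x\<bar> \<le> B" if x: "x \<in> closure ?K" for x
      unfolding B_def using smooth Q by (intro abs_stabilization_le[OF Qm(1,2) _ lp r bd x]) auto
    have B2: "B\<^sup>2 = (L2 * (real ?n * (CR * L1)))\<^sup>2 * \<mu>"
      using \<mu> by (simp add: B_def power_mult_distrib mult_ac)
    define \<delta> where "\<delta> = diameter ?K"
    have "bounded (F ` Q)"
      using compact_imp_bounded[OF compact_continuous_image[OF cont compact_cbox]]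
      by (rule bounded_subset) (use Qm(2) box_sub in blast)
    then have \<delta>: "0 \<le> \<delta>" "\<delta> \<le> L1 * diameter Q"
      using diameter_image_le[OF Qm(2,3)] by (auto simp: \<delta>_def diameter_ge_0)
    let ?J = "\<integral>\<^sup>+x\<in>(\<Gamma> \<inter> closure ?K). ennreal ((norm (sqrt \<delta> * stabilization p F \<Omega> ?K (F ` Q') v x))\<^sup>2) \<partial>surface_measure"
    have "?J \<le> (\<integral>\<^sup>+x. ennreal (\<delta> * B\<^sup>2) * indicator (\<Gamma> \<inter> closure ?K) x \<partial>surface_measure)"
    proof (intro nn_integral_mono)
      fix x
      show "ennreal ((norm (sqrt \<delta> * stabilization p F \<Omega> ?K (F ` Q') v x))\<^sup>2) * indicator (\<Gamma> \<inter> closure ?K) x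
        \<le> ennreal (\<delta> * B\<^sup>2) * indicator (\<Gamma> \<inter> closure ?K) x"
        using B[of x] \<delta> by (auto simp: indicator_def power_mult_distrib abs_le_square_iff[symmetric]
            intro!: ennreal_leI mult_left_mono)
    qed
    also have "\<dots> = ennreal (\<delta> * B\<^sup>2) * emeasure surface_measure (\<Gamma> \<inter> closure ?K)"
      using \<Gamma> by (intro nn_integral_cmult_indicator) auto
    also have "\<dots> \<le> ennreal (\<delta> * B\<^sup>2) * ennreal (C\<Gamma> * \<delta> ^ (?n - 1))"
      using area by (intro mult_left_mono) (auto simp: \<delta>_def)
    also have "\<dots> = ennreal (\<delta> * B\<^sup>2 * (C\<Gamma> * \<delta> ^ (?n - 1)))"
      using \<delta> C\<Gamma> by (intro ennreal_mult[symmetric]) auto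
    also have "\<dots> \<le> ennreal (W * i0)"
    proof (rule ennreal_leI)
      have dn: "\<delta> * \<delta> ^ (?n - 1) = \<delta> ^ ?n" using d by (cases ?n) auto
      have "(\<kappa> ^ 3 * diameter Q) ^ ?n = (\<Prod>i\<in>(Basis :: (real^'d) set). \<kappa> ^ 3 * diameter Q)" by simp
      also have "\<dots> \<le> (\<Prod>i\<in>Basis. (b - a) \<bullet> i)"
        using ab(3) \<kappa> Qm(5) by (intro prod_mono) (auto simp: Basis_vec_def inner_axis)
      also have "\<dots> = measure lborel Q'"
        unfolding ab(1) measure_lborel_box_eq using ab(2) by (auto simp: Basis_vec_def inner_axis less_imp_le)
      finally have vol: "(\<kappa> ^ 3 * diameter Q) ^ ?n \<le> measure lborel Q'" .
      have vpos: "0 < measure lborel Q'" using vol \<kappa> Qm(5) by (intro less_le_trans[OF _ vol]) simp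
      have "\<delta> ^ ?n \<le> (L1 * diameter Q) ^ ?n" using \<delta> by (intro power_mono)
      also have "\<dots> = (L1 / \<kappa> ^ 3) ^ ?n * (\<kappa> ^ 3 * diameter Q) ^ ?n"
        using \<kappa> by (simp flip: power_mult_distrib)
      also have "\<dots> \<le> (L1 / \<kappa> ^ 3) ^ ?n * measure lborel Q'" using vol pos \<kappa> by (intro mult_left_mono) auto
      finally have "\<delta> ^ ?n * \<mu> \<le> (L1 / \<kappa> ^ 3) ^ ?n * measure lborel Q' * \<mu>" using \<mu> by (intro mult_right_mono)
      also have "\<dots> = 2 * CL / \<theta> * (L1 / \<kappa> ^ 3) ^ ?n * i0" using vpos \<theta> by (simp add: \<mu>_def)
      finally have "C\<Gamma> * (L2 * (real ?n * (CR * L1)))\<^sup>2 * (\<delta> ^ ?n * \<mu>)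
          \<le> C\<Gamma> * (L2 * (real ?n * (CR * L1)))\<^sup>2 * (2 * CL / \<theta> * (L1 / \<kappa> ^ 3) ^ ?n * i0)"
        using C\<Gamma> by (intro mult_left_mono) auto
      also have "\<dots> = W * i0" by (simp add: W_def)
      also have "C\<Gamma> * (L2 * (real ?n * (CR * L1)))\<^sup>2 * (\<delta> ^ ?n * \<mu>) = \<delta> * B\<^sup>2 * (C\<Gamma> * \<delta> ^ (?n - 1))"
        unfolding B2 dn[symmetric] by (simp only: mult_ac)
      finally show "\<delta> * B\<^sup>2 * (C\<Gamma> * \<delta> ^ (?n - 1)) \<le> W * i0" .
    qed
    finally have J: "?J \<le> ennreal (W * i0)" .
    have "L2_norm surface_measure (\<Gamma> \<inter> closure ?K) (\<lambda>x. sqrt \<delta> * stabilization p F \<Omega> ?K (F ` Q') v x)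
        \<le> ennreal (sqrt (W * i0))"
    proof -
      have "?J \<noteq> \<infinity>" using J by (auto simp: top_unique)
      moreover have "enn2real ?J \<le> W * i0" using J W i0 by (intro enn2real_leI) auto
      ultimately show ?thesis by (simp add: L2_norm_def Let_def ennreal_leI)
    qed
    also have "\<dots> \<le> ennreal (1 + sqrt W) * ennreal (sqrt i0)"
      using W i0(2) by (subst ennreal_mult[symmetric]) (auto simp: real_sqrt_mult intro!: ennreal_leI mult_right_mono)
    also have "ennreal (sqrt i0) = L2_norm lborel (\<Omega> \<inter> F ` Q') (grad v)"
      using i0 by (simp add: L2_norm_def)
    finally show ?thesis by (simp add: W_def \<delta>_def)
  qed
qed

end

section \<open>Constants chosen uniformly for the whole mesh family\<close>

theorem theorem6p4:
  fixes p p0 :: nat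
    and \<Xi>0 :: "'d::finite \<Rightarrow> real list"
    and H :: "real set"
    and \<Xi> :: "real \<Rightarrow> 'd \<Rightarrow> real list"
    and F :: "real^'d \<Rightarrow> real^'d"
    and \<Omega>0 \<Omega>1 \<Omega> \<Gamma>trim \<Gamma>D \<Gamma>N :: "(real^'d) set"
    and \<theta> CN C\<Gamma> :: real
    and nb :: "real \<Rightarrow> (real^'d) set \<Rightarrow> (real^'d) set"
  assumes "CARD('d) \<in> {2, 3}" and "p \<ge> 1" and "p0 \<ge> 1"
    and "\<forall>l. open_knot_vector p0 (\<Xi>0 l)"
    and "\<forall>h\<in>H. \<forall>l. open_knot_vector p (\<Xi> h l)"
    and "\<forall>h\<in>H. mesh_size (\<Xi> h) = h"
    and "shape_regular \<Xi> H"
    and "\<forall>h\<in>H. spline_space p0 \<Xi>0 \<subseteq> spline_space p (\<Xi> h)"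
    and "\<forall>l. \<exists>s\<in>spline_space p0 \<Xi>0. \<forall>\<zeta>\<in>cbox 0 1. F \<zeta> $ l = s \<zeta>"
    and "bi_lipschitz_on (cbox 0 1) F"
    and "\<forall>h\<in>H. \<forall>Q\<in>param_mesh (\<Xi> h). smooth_on_closed (closure Q) F"
    and "\<forall>h\<in>H. \<forall>Q\<in>param_mesh (\<Xi> h). smooth_on_closed (closure (F ` Q)) (param_inv F)"
    and "\<Omega>0 = F ` box 0 1"
    and "open \<Omega>1" and "connected \<Omega>1" and "bounded \<Omega>1"
    and "\<Omega> = \<Omega>0 - closure \<Omega>1"
    and "lipschitz_domain \<Omega>"
    and "\<Gamma>trim = frontier \<Omega> \<inter> frontier \<Omega>1"
    and "frontier \<Omega> = \<Gamma>D \<union> \<Gamma>N"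
    and "(top_of_set (frontier \<Omega>)) interior_of \<Gamma>D \<inter>
         (top_of_set (frontier \<Omega>)) interior_of \<Gamma>N = {}"
    and "\<Gamma>D \<in> sets borel"
    and "\<forall>h\<in>H. \<forall>K\<in>physical_mesh (\<Xi> h) F \<Omega>.
           emeasure surface_measure (\<Gamma>D \<inter> closure K) \<le> ennreal (C\<Gamma> * diameter K ^ (CARD('d) - 1))"
    and "0 < \<theta>" and "\<theta> \<le> 1"
    and "\<forall>h\<in>H. \<forall>K\<in>bad_elements \<theta> (\<Xi> h) F \<Omega>.
           neighbors CN (\<Xi> h) F \<Omega> K \<inter> good_elements \<theta> (\<Xi> h) F \<Omega> \<noteq> {}"
    and "\<forall>h\<in>H. \<forall>K\<in>cut_elements (\<Xi> h) F \<Omega> \<Gamma>trim \<inter> bad_elements \<theta> (\<Xi> h) F \<Omega>.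
           nb h K \<in> neighbors CN (\<Xi> h) F \<Omega> K \<inter> good_elements \<theta> (\<Xi> h) F \<Omega>"
  shows "\<exists>C>0. \<forall>h\<in>H. \<forall>K\<in>cut_elements (\<Xi> h) F \<Omega> \<Gamma>trim.
           let K' = (if K \<in> good_elements \<theta> (\<Xi> h) F \<Omega> then K else nb h K) in
           \<forall>v\<in>trimmed_space p (\<Xi> h) F \<Omega>.
             L2_norm surface_measure (\<Gamma>D \<inter> closure K)
               (\<lambda>x. sqrt (diameter K) * stabilization p F \<Omega> K K' v x)
             \<le> ennreal C * L2_norm lborel (\<Omega> \<inter> K') (grad v)"
proof -
  have d: "2 \<le> CARD('d)" using assms(1) by auto
  obtain l1 l2 where inj: "inj_on F (cbox 0 1)" and l1: "l1-lipschitz_on (cbox 0 1) F"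
    and l2: "l2-lipschitz_on (F ` cbox 0 1) (param_inv F)"
    using assms(10) unfolding bi_lipschitz_on_def param_inv_def by blast
  \<comment> \<open>Enlarging both Lipschitz constants to at least 1 supplies the positivity that
    the locale asks for.\<close>
  define L1 where "L1 = max 1 l1"
  define L2 where "L2 = max 1 l2"
  interpret bilipschitz_param F L1 L2
  proof
    show "L1-lipschitz_on (cbox 0 1) F" using l1 by (rule lipschitz_on_le) (simp add: L1_def)
    show "L2-lipschitz_on (F ` cbox 0 1) (param_inv F)" using l2 by (rule lipschitz_on_le) (simp add: L2_def)
  qed (use inj in \<open>auto simp: L1_def L2_def\<close>)
  obtain \<kappa> where \<kappa>: "0 < \<kappa>" "\<And>h. h \<in> H \<Longrightarrow> \<forall>a b. box a b \<in> param_mesh (\<Xi> h) \<longrightarrow>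
     (\<forall>l. b $ l - a $ l \<ge> \<kappa> * diameter (box a b))"
    using assms(7) unfolding shape_regular_def by blast
  \<comment> \<open>No sign is prescribed for \<open>CN\<close> and \<open>C\<Gamma>\<close>.
    Truncation at 0 makes them nonnegative and only enlarges the bounds, since diameters of bounded
    elements are nonnegative.\<close>
  define N where "N = max 0 CN"
  define A where "A = max 0 C\<Gamma>"
  \<comment> \<open>\<open>M\<close>, and with it the Remez constant \<open>CR\<close>, is fixed
    before any mesh or element is chosen; this is the source of uniformity in \<open>h\<close> and
    \<open>K\<close>.\<close>
  define M where "M = (1 + L1 * L2 * (N + 1)) / \<kappa> ^ 3 + 1"
  have "0 \<le> M" using pos \<kappa>(1) by (simp add: M_def N_def)
  then obtain CR where remez: "remez_constant {f :: real^'d \<Rightarrow> real. coordinatewise_poly p f} (\<theta> / 2) M CR"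
    using ex_remez_constant[OF _ half_gt_zero[OF \<open>0 < \<theta>\<close>]] by blast
  then have CR: "0 < CR" by (simp add: remez_constant_def)
  define C where "C = 1 + sqrt (A * (L2 * (real CARD('d) * (CR * L1)))\<^sup>2 *
    (2 * (unit_ball_vol (real CARD('d)) * (L2 * real CARD('d)) ^ CARD('d)) / \<theta> * (L1 / \<kappa> ^ 3) ^ CARD('d)))"
  have "0 \<le> A * (L2 * (real CARD('d) * (CR * L1)))\<^sup>2 *
    (2 * (unit_ball_vol (real CARD('d)) * (L2 * real CARD('d)) ^ CARD('d)) / \<theta> * (L1 / \<kappa> ^ 3) ^ CARD('d))"
    using pos \<open>0 < \<theta>\<close> \<kappa>(1) by (simp add: A_def)
  then have "0 < C" unfolding C_def by (intro add_pos_nonneg) auto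
  have \<Omega>: "open \<Omega>" using assms(18) by (simp add: lipschitz_domain_def)
  have bounded_element: "bounded K" if h: "h \<in> H" and K: "K \<in> physical_mesh (\<Xi> h) F \<Omega>" for h K
  proof -
    obtain Q where Q: "K = F ` Q" "Q \<in> param_mesh (\<Xi> h)" using K unfolding physical_mesh_def by blast
    have "Q \<subseteq> cbox 0 1"
      using param_mesh_element(2)[OF bspec[OF assms(5) h] Q(2)] box_sub by blast
    then show ?thesis unfolding Q(1)
      using compact_imp_bounded[OF compact_continuous_image[OF cont compact_cbox]]
      by (meson bounded_subset image_mono)
  qed
  \<comment> \<open>One estimate for both cases: a good \<open>K\<close> is its own partner, at
    distance 0, and so counts as near.\<close>
  have main: "L2_norm surface_measure (\<Gamma>D \<inter> closure K)
               (\<lambda>x. sqrt (diameter K) * stabilization p F \<Omega> K K' v x)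
             \<le> ennreal C * L2_norm lborel (\<Omega> \<inter> K') (grad v)"
    if h: "h \<in> H" and K: "K \<in> physical_mesh (\<Xi> h) F \<Omega>" and K': "K' \<in> good_elements \<theta> (\<Xi> h) F \<Omega>"
      and near: "setdist K K' \<le> N * diameter K" and v: "v \<in> trimmed_space p (\<Xi> h) F \<Omega>" for h K K' v
  proof -
    obtain Q where Q: "K = F ` Q" "Q \<in> param_mesh (\<Xi> h)" using K unfolding physical_mesh_def by blast
    obtain Q' where Q': "K' = F ` Q'" "Q' \<in> param_mesh (\<Xi> h)" "Q' \<inter> param_preimage F \<Omega> \<noteq> {}"
      "\<theta> * measure lborel Q' \<le> measure lborel (param_preimage F \<Omega> \<inter> Q')"
      using K' unfolding good_elements_def by blast
    have "C\<Gamma> * diameter K ^ (CARD('d) - 1) \<le> A * diameter K ^ (CARD('d) - 1)"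
      using bounded_element[OF h K]
      by (intro mult_right_mono zero_le_power diameter_ge_0) (simp_all add: A_def)
    then have area: "emeasure surface_measure (\<Gamma>D \<inter> closure K) \<le> ennreal (A * diameter K ^ (CARD('d) - 1))"
      using assms(23)[rule_format, OF h K] by (meson ennreal_leI order_trans)
    show ?thesis unfolding Q(1) Q'(1) C_def
      using remez[unfolded M_def]
      by (rule stabilization_L2_bound[where CN=N and p=p and \<Xi>="\<Xi> h"])
        (use CR \<Omega> assms(5,12,22) h d \<kappa> \<open>0 < \<theta>\<close> Q Q' near v area in \<open>auto simp: N_def A_def\<close>)
  qed
  show ?thesis
  proof (intro exI[of _ C] conjI \<open>0 < C\<close> ballI)
    fix h K assume h: "h \<in> H" and K: "K \<in> cut_elements (\<Xi> h) F \<Omega> \<Gamma>trim"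
    then have KM: "K \<in> physical_mesh (\<Xi> h) F \<Omega>" by (simp add: cut_elements_def)
    define K' where "K' = (if K \<in> good_elements \<theta> (\<Xi> h) F \<Omega> then K else nb h K)"
    have "K' \<in> good_elements \<theta> (\<Xi> h) F \<Omega> \<and> setdist K K' \<le> N * diameter K"
    proof (cases "K \<in> good_elements \<theta> (\<Xi> h) F \<Omega>")
      case True
      moreover have "0 \<le> N * diameter K"
        using bounded_element[OF h KM] by (intro mult_nonneg_nonneg diameter_ge_0) (simp_all add: N_def)
      ultimately show ?thesis by (simp add: K'_def setdist_refl)
    next
      case False
      then have "K \<in> bad_elements \<theta> (\<Xi> h) F \<Omega>" using KM by (simp add: bad_elements_def)
      then have nb: "nb h K \<in> neighbors CN (\<Xi> h) F \<Omega> K \<inter> good_elements \<theta> (\<Xi> h) F \<Omega>"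
        using assms(27) h K by blast
      have "CN * diameter K \<le> N * diameter K"
        using bounded_element[OF h KM] by (intro mult_right_mono diameter_ge_0) (simp_all add: N_def)
      then show ?thesis using nb False by (auto simp: K'_def neighbors_def)
    qed
    then show "let K' = (if K \<in> good_elements \<theta> (\<Xi> h) F \<Omega> then K else nb h K) in
           \<forall>v\<in>trimmed_space p (\<Xi> h) F \<Omega>.
             L2_norm surface_measure (\<Gamma>D \<inter> closure K)
               (\<lambda>x. sqrt (diameter K) * stabilization p F \<Omega> K K' v x)
             \<le> ennreal C * L2_norm lborel (\<Omega> \<inter> K') (grad v)"
      unfolding Let_def K'_def[symmetric] using main[OF h KM] by blast
  qed
qed

end
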